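(* Consider the unrestarted KT process $L_t=\log\widehat M_t^{(J)}$ under the change-point law $\mathbb P_\tau$, with calibrated and Ville crossing times $D_{\mathrm C},D_{\mathrm V}$, on the event $\{D_{\mathrm C}<D_{\mathrm V}\}$, and write $d:=D_{\mathrm C}$ and $h_d:=\log\frac1\alpha-L_d$. Let $\eta,\eta_0\in(0,1)$ with $c_{\tau,J}(\eta_0)>0$. On $\mathcal A_\tau(\eta_0)$, conditionally on $\mathcal H_d$, with probability at least $1-\eta$, $$L_{d+m}-L_d\le U_{d,m}(b_d,V_d;\eta_0,\eta)$$ simultaneously for all $m\ge1$. Define $$r_d(\eta_0,\eta):=\sup\Big\{r\in\mathbb N_0:\max_{1\le m\le r}U_{d,m}(b_d,V_d;\eta_0,\eta)<h_d\Big\}.$$ Then, on $\mathcal A_\tau(\eta_0)$, $$\mathbb P_\tau\big(D_{\mathrm V}-D_{\mathrm C}>r_d(\eta_0,\eta)\,\big|\,\mathcal H_d\big)\ge1-\eta .$$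
   Context: Change-point model (law $\mathbb P_\tau$), $\tau\ge1$: $X_1,\ldots,X_\tau$ i.i.d. from $F_0$, $X_{\tau+1},X_{\tau+2},\ldots$ i.i.d. from $F_1$, the two samples independent, $F_0,F_1$ continuous distributions on $\mathbb R$ (with distribution functions also denoted $F_0,F_1$), $U_1,U_2,\ldots$ i.i.d. $\mathrm{Unif}(0,1)$ independent of the $X$'s, and $p_t=t^{-1}\big(\sum_{r=1}^{t-1}\mathbf 1\{X_r>X_t\}+U_t\big)$. KT process: $J\ge2$; $I_j=[(j-1)/J,j/J)$ for $j<J$, $I_J=[(J-1)/J,1]$; $N_{t,j}:=\sum_{i=1}^t\mathbf 1\{p_i\in I_j\}$; $\widehat M_0^{(J)}=1$ and $\widehat M_t^{(J)}=\prod_{i=1}^tJ\,\frac{N_{i-1,j_i}+1/2}{i-1+J/2}$, where $p_i\in I_{j_i}$. Crossings: $\alpha\in(0,1)$; $(B_t^{\mathrm C})$ is a deterministic positive (calibrated) boundary; $D_{\mathrm C}:=\inf\{t\ge\tau+1:\widehat M_t^{(J)}>B_t^{\mathrm C}\}$, $D_{\mathrm V}:=\inf\{t\ge\tau+1:\widehat M_t^{(J)}>1/\alpha\}$ ($\inf\varnothing=\infty$). $\mathcal H_t:=\sigma(X_1,\ldots,X_t,U_1,\ldots,U_t)$; statements conditional on $\mathcal H_d$ with $d=D_{\mathrm C}$ mean: for each integer $n\ge\tau+1$, conditionally on $\mathcal H_n$, on the event $\{D_{\mathrm C}=n<D_{\mathrm V}\}\in\mathcal H_n$ with $d=n$. Notation: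 $\boldsymbol u_J=(1/J,\ldots,1/J)$, $\widehat{\boldsymbol\theta}_t=(N_{t,1}/t,\ldots,N_{t,J}/t)$, $V_d:=\mathrm{TV}(\widehat{\boldsymbol\theta}_d,\boldsymbol u_J)$ (half the $\ell_1$ distance), $b_d:=\sup_x\big|\frac1d\sum_{\ell=1}^d\mathbf 1\{X_\ell\le x\}-F_1(x)\big|$. For $k\ge1$, $\lambda_k(\eta):=\sqrt{\frac1{2k}\log\frac{2\pi^2k^2}{3\eta}}$, $\lambda_0(\eta):=0$, and for $b\ge0$ $$a_{d,m}(b;\eta):=\frac2m\sum_{i=1}^m\Big[\frac{d}{d+i-1}b+\frac{i-1}{d+i-1}\lambda_{i-1}(\eta)+\frac1{d+i}\Big]+\sqrt{\frac1{2m}\log\frac{2J\pi^2m^2}{3\eta}} .$$ $\Phi_J(a):=\sup\{D_{\mathrm{KL}}(\boldsymbol q\|\boldsymbol u_J):\boldsymbol q\in\Delta_J,\ \|\boldsymbol q-\boldsymbol u_J\|_\infty\le a\}$, $\Delta_J$ the probability simplex in $\mathbb R^J$. $$c_{\tau,J}(\eta_0):=\frac1J-\sqrt{\frac1{2\tau}\log\frac J{\eta_0}},\qquad \mathcal A_\tau(\eta_0):=\Big\{\min_{1\le j\le J}\frac{N_{\tau,j}}{\tau}\ge c_{\tau,J}(\eta_0)\Big\},$$ $$K_{\tau,J}(\eta_0):=\frac{J(J-1)}4+\frac{J^2(J+1)}{16}+\frac1{12}+\frac{5J}{24c_{\tau,J}(\eta_0)},\qquad \varepsilon_{\tau,J}(\eta_0):=\frac{2K_{\tau,J}(\eta_0)}{\tau},$$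 $$U_{d,m}(b,V;\eta_0,\eta):=m\,\Phi_J(a_{d,m}(b;\eta))-\frac{2dm}{d+m}\Big[V-\frac J2a_{d,m}(b;\eta)\Big]_+^2-\frac{J-1}2\log\Big(1+\frac md\Big)+\varepsilon_{\tau,J}(\eta_0).$$ $[x]_+=\max(x,0)$; the maximum over an empty set is $-\infty$ (so $r=0$ always belongs to the set defining $r_d$). *)

theory Defs
  imports "HOL-Probability.Probability"
begin

text \<open>Sequences \<open>X\<close>, \<open>U\<close> are used at indices \<open>t \<ge> 1\<close> only; index \<open>0\<close> is unconstrained.\<close>

locale change_point_model = prob_space M
  for M :: "'a measure"
    and tau :: nat
    and F0 F1 :: "real measure"
    and X U :: "nat \<Rightarrow> 'a \<Rightarrow> real" +
  assumes tau_ge_1: "1 \<le> tau"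
    and F0_distribution: "real_distribution F0"
    and F1_distribution: "real_distribution F1"
    and F0_continuous: "continuous_on UNIV (cdf F0)"
    and F1_continuous: "continuous_on UNIV (cdf F1)"
    and independent: "indep_vars (\<lambda>_. borel) (case_sum X U) ({1..} <+> {1..})"
    and pre_change_law: "\<And>t. 1 \<le> t \<Longrightarrow> t \<le> tau \<Longrightarrow> distr M borel (X t) = F0"
    and post_change_law: "\<And>t. tau < t \<Longrightarrow> distr M borel (X t) = F1"
    and uniform_law: "\<And>t. 1 \<le> t \<Longrightarrow> distr M borel (U t) = uniform_measure lborel {0..1}"

definition hist :: "'a measure \<Rightarrow> (nat \<Rightarrow> 'a \<Rightarrow> real) \<Rightarrow> (nat \<Rightarrow> 'a \<Rightarrow> real) \<Rightarrow> nat \<Rightarrow> 'a measure" where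
  "hist M X U t = sigma (space M)
     (\<Union>i\<in>{1..t}. {X i -` A \<inter> space M | A. A \<in> sets borel} \<union> {U i -` A \<inter> space M | A. A \<in> sets borel})"

definition pval :: "(nat \<Rightarrow> 'a \<Rightarrow> real) \<Rightarrow> (nat \<Rightarrow> 'a \<Rightarrow> real) \<Rightarrow> nat \<Rightarrow> 'a \<Rightarrow> real" where
  "pval X U t \<omega> = ((\<Sum>r = 1..<t. of_bool (X r \<omega> > X t \<omega>)) + U t \<omega>) / real t"

definition bin :: "nat \<Rightarrow> nat \<Rightarrow> real set" where
  "bin J j = (if j < J then {(real j - 1) / real J ..< real j / real J}
              else {(real J - 1) / real J .. 1})"

definition bin_count ::
    "nat \<Rightarrow> (nat \<Rightarrow> 'a \<Rightarrow> real) \<Rightarrow> (nat \<Rightarrow> 'a \<Rightarrow> real) \<Rightarrow> nat \<Rightarrow> nat \<Rightarrow> 'a \<Rightarrow> nat" where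
  "bin_count J X U t j \<omega> = (\<Sum>i = 1..t. of_bool (pval X U i \<omega> \<in> bin J j))"

text \<open>The bins partition \<open>[0, 1]\<close>, so \<open>bin_index\<close> is well defined whenever the p-value lies in
  \<open>[0, 1]\<close>; this can fail only on the null set where some \<open>U t\<close> falls outside \<open>[0, 1]\<close>.\<close>

definition bin_index :: "nat \<Rightarrow> real \<Rightarrow> nat" where
  "bin_index J p = (THE j. j \<in> {1..J} \<and> p \<in> bin J j)"

definition KT :: "nat \<Rightarrow> (nat \<Rightarrow> 'a \<Rightarrow> real) \<Rightarrow> (nat \<Rightarrow> 'a \<Rightarrow> real) \<Rightarrow> nat \<Rightarrow> 'a \<Rightarrow> real" where
  "KT J X U t \<omega> = (\<Prod>i = 1..t. real J *
     ((real (bin_count J X U (i - 1) (bin_index J (pval X U i \<omega>)) \<omega>) + 1 / 2)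
       / (real (i - 1) + real J / 2)))"

definition log_KT :: "nat \<Rightarrow> (nat \<Rightarrow> 'a \<Rightarrow> real) \<Rightarrow> (nat \<Rightarrow> 'a \<Rightarrow> real) \<Rightarrow> nat \<Rightarrow> 'a \<Rightarrow> real" where
  "log_KT J X U t \<omega> = ln (KT J X U t \<omega>)"

definition crossing_time :: "nat \<Rightarrow> (nat \<Rightarrow> 'a \<Rightarrow> real) \<Rightarrow> (nat \<Rightarrow> real) \<Rightarrow> 'a \<Rightarrow> enat" where
  "crossing_time tau W B \<omega> = Inf {enat t | t. tau + 1 \<le> t \<and> W t \<omega> > B t}"

text \<open>Vectors in \<open>\<real>\<^sup>J\<close> are functions \<open>nat \<Rightarrow> real\<close> of which only the values on \<open>{1..J}\<close> matter.\<close>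

definition simplex_vec :: "nat \<Rightarrow> (nat \<Rightarrow> real) set" where
  "simplex_vec J = {q. (\<forall>j\<in>{1..J}. 0 \<le> q j) \<and> (\<Sum>j = 1..J. q j) = 1}"

definition unif_vec :: "nat \<Rightarrow> nat \<Rightarrow> real" where
  "unif_vec J j = 1 / real J"

definition TV_vec :: "nat \<Rightarrow> (nat \<Rightarrow> real) \<Rightarrow> (nat \<Rightarrow> real) \<Rightarrow> real" where
  "TV_vec J p q = (1 / 2) * (\<Sum>j = 1..J. \<bar>p j - q j\<bar>)"

text \<open>Here \<open>0 log 0 = 0\<close>. The formula is used only for \<open>p\<close> with positive entries, where it is the
  Kullback--Leibler divergence of the library, which takes its arguments in the opposite order.\<close>

definition KL_vec :: "nat \<Rightarrow> (nat \<Rightarrow> real) \<Rightarrow> (nat \<Rightarrow> real) \<Rightarrow> real" where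
  "KL_vec J q p = (\<Sum>j = 1..J. q j * ln (q j / p j))"

lemma KL_vec_eq_KL_divergence:
  assumes "\<And>j. j \<in> {1..J} \<Longrightarrow> 0 < p j" and "\<And>j. j \<in> {1..J} \<Longrightarrow> 0 \<le> q j"
  shows "KL_vec J q p = KL_divergence (exp 1) (point_measure {1..J} p) (point_measure {1..J} q)"
proof -
  interpret sigma_finite_measure "count_space {1..J}"
    by (rule sigma_finite_measure_count_space_finite) simp
  have b: "1 < (exp 1 :: real)" by simp
  have "KL_divergence (exp 1) (density (count_space {1..J}) p) (density (count_space {1..J}) q)
      = (\<integral>j. q j * log (exp 1) (q j / p j) \<partial>count_space {1..J})"
    using assms by (intro KL_density_density b) (force simp: AE_count_space)+
  also have "\<dots> = KL_vec J q p"
    by (simp add: KL_vec_def lebesgue_integral_count_space_finite log_def)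
  finally show ?thesis by (simp add: point_measure_def)
qed

definition Phi :: "nat \<Rightarrow> real \<Rightarrow> real" where
  "Phi J a = Sup {KL_vec J q (unif_vec J) | q.
     q \<in> simplex_vec J \<and> (MAX j\<in>{1..J}. \<bar>q j - unif_vec J j\<bar>) \<le> a}"

definition lam :: "real \<Rightarrow> nat \<Rightarrow> real" where
  "lam eta k = (if k = 0 then 0
     else sqrt (1 / (2 * real k) * ln (2 * pi\<^sup>2 * (real k)\<^sup>2 / (3 * eta))))"

definition a_bound :: "nat \<Rightarrow> real \<Rightarrow> nat \<Rightarrow> nat \<Rightarrow> real \<Rightarrow> real" where
  "a_bound J eta d m b =
     2 / real m * (\<Sum>i = 1..m. real d / (real d + real i - 1) * b
        + (real i - 1) / (real d + real i - 1) * lam eta (i - 1)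
        + 1 / (real d + real i))
     + sqrt (1 / (2 * real m) * ln (2 * real J * pi\<^sup>2 * (real m)\<^sup>2 / (3 * eta)))"

definition c_const :: "nat \<Rightarrow> nat \<Rightarrow> real \<Rightarrow> real" where
  "c_const tau J eta0 = 1 / real J - sqrt (1 / (2 * real tau) * ln (real J / eta0))"

definition A_event :: "'a measure \<Rightarrow> nat \<Rightarrow> nat \<Rightarrow> (nat \<Rightarrow> 'a \<Rightarrow> real) \<Rightarrow> (nat \<Rightarrow> 'a \<Rightarrow> real) \<Rightarrow> real \<Rightarrow> 'a set" where
  "A_event M tau J X U eta0 = {\<omega> \<in> space M.
     (MIN j\<in>{1..J}. real (bin_count J X U tau j \<omega>) / real tau) \<ge> c_const tau J eta0}"

definition K_const :: "nat \<Rightarrow> nat \<Rightarrow> real \<Rightarrow> real" where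
  "K_const tau J eta0 = real J * (real J - 1) / 4 + (real J)\<^sup>2 * (real J + 1) / 16 + 1 / 12
     + 5 * real J / (24 * c_const tau J eta0)"

definition eps_const :: "nat \<Rightarrow> nat \<Rightarrow> real \<Rightarrow> real" where
  "eps_const tau J eta0 = 2 * K_const tau J eta0 / real tau"

definition U_bound ::
    "nat \<Rightarrow> nat \<Rightarrow> real \<Rightarrow> real \<Rightarrow> nat \<Rightarrow> nat \<Rightarrow> real \<Rightarrow> real \<Rightarrow> real" where
  "U_bound tau J eta0 eta d m b V =
     real m * Phi J (a_bound J eta d m b)
     - 2 * real d * real m / (real d + real m)
         * (max (V - real J / 2 * a_bound J eta d m b) 0)\<^sup>2
     - (real J - 1) / 2 * ln (1 + real m / real d)
     + eps_const tau J eta0"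

definition V_dev :: "nat \<Rightarrow> (nat \<Rightarrow> 'a \<Rightarrow> real) \<Rightarrow> (nat \<Rightarrow> 'a \<Rightarrow> real) \<Rightarrow> nat \<Rightarrow> 'a \<Rightarrow> real" where
  "V_dev J X U d \<omega> = TV_vec J (\<lambda>j. real (bin_count J X U d j \<omega>) / real d) (unif_vec J)"

definition b_dev :: "real measure \<Rightarrow> (nat \<Rightarrow> 'a \<Rightarrow> real) \<Rightarrow> nat \<Rightarrow> 'a \<Rightarrow> real" where
  "b_dev F1 X d \<omega> =
     (SUP x. \<bar>1 / real d * (\<Sum>l = 1..d. of_bool (X l \<omega> \<le> x)) - cdf F1 x\<bar>)"

definition U_path :: "nat \<Rightarrow> nat \<Rightarrow> real measure \<Rightarrow> (nat \<Rightarrow> 'a \<Rightarrow> real) \<Rightarrow> (nat \<Rightarrow> 'a \<Rightarrow> real)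
    \<Rightarrow> real \<Rightarrow> real \<Rightarrow> nat \<Rightarrow> nat \<Rightarrow> 'a \<Rightarrow> real" where
  "U_path tau J F1 X U eta0 eta d m \<omega> =
     U_bound tau J eta0 eta d m (b_dev F1 X d \<omega>) (V_dev J X U d \<omega>)"

definition gap :: "nat \<Rightarrow> (nat \<Rightarrow> 'a \<Rightarrow> real) \<Rightarrow> (nat \<Rightarrow> 'a \<Rightarrow> real) \<Rightarrow> real \<Rightarrow> nat \<Rightarrow> 'a \<Rightarrow> real" where
  "gap J X U alpha d \<omega> = ln (1 / alpha) - log_KT J X U d \<omega>"

text \<open>The inner maximum is an \<open>ereal\<close> supremum, so that it is \<open>-\<infinity>\<close> for \<open>r = 0\<close>; the outer
  supremum is taken in \<open>enat\<close>, so that it is \<open>\<infinity>\<close> for an unbounded set.\<close>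

definition r_delay :: "nat \<Rightarrow> nat \<Rightarrow> real measure \<Rightarrow> (nat \<Rightarrow> 'a \<Rightarrow> real) \<Rightarrow> (nat \<Rightarrow> 'a \<Rightarrow> real)
    \<Rightarrow> real \<Rightarrow> real \<Rightarrow> real \<Rightarrow> nat \<Rightarrow> 'a \<Rightarrow> enat" where
  "r_delay tau J F1 X U alpha eta0 eta d \<omega> =
     Sup {enat r | r. (SUP m\<in>{1..r}. ereal (U_path tau J F1 X U eta0 eta d m \<omega>))
                        < ereal (gap J X U alpha d \<omega>)}"

end

theory Submission
  imports Defs
begin

text \<open>Conditionally on \<open>hist n\<close>, the later observations are i.i.d. from \<open>F1\<close>. Given the past, the
  event that the p-value at time \<open>n + i\<close> falls into bin \<open>j\<close> is the event that the next observation
  falls into a random interval which contains a fraction \<open>1/J\<close> of the observed points, up to one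
  point. If the empirical mass of every interval deviates from its \<open>F1\<close>-mass by at most \<open>2 b\<close> for the
  first \<open>n\<close> points and by at most \<open>2 \<lambda>\<^sub>k\<close> for the \<open>k\<close> points after them, the conditional bin
  probability is therefore close to \<open>1/J\<close>, and Azuma's inequality controls the new bin frequencies
  \<open>q\<close> at all times. Only intervals matter, and their deviation \<open>2 \<lambda>\<^sub>k\<close> is twice that of the
  distribution function; so Hoeffding's inequality on a grid of quantiles suffices in place of the
  Dvoretzky--Kiefer--Wolfowitz inequality with Massart's constant.

  Deterministically, the log-likelihood of the KT predictor increases by at most the increment of
  \<open>t KL(\<theta>\<^sub>t, u) - (J - 1)/2 ln t\<close> plus an error of order \<open>1/\<tau>\<close>. The compensation identity writes
  \<open>(d + m) KL(\<theta>\<^sub>d\<^sub>+\<^sub>m, u)\<close> as \<open>d KL(\<theta>\<^sub>d, u) + m KL(q, u)\<close> minus divergences to the mixture, which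
  Pinsker's inequality bounds in terms of the total variation distance of \<open>\<theta>\<^sub>d\<close> and \<open>q\<close>. Finally, \<open>r_d\<close>
  is finite because the Azuma term alone makes \<open>m \<Phi>(a)\<close> at least \<open>J ln m\<close>.\<close>

section \<open>Logarithms and divergences\<close>

text \<open>The bin interval of the next observation is selected by the past, new points included,
  so a deviation bound for one fixed interval would not apply to it; uniformity over all intervals
  is what the grid has to supply.

  Conditioning is done without conditional exponential moments: each probability bound is proved on
  an arbitrary event \<open>B\<close> of the past, with the factor \<open>prob B\<close>. The
  conditional statement then follows by letting \<open>B\<close> be the set where it would fail. All
  failures lie in one event \<open>bad\<close>, which involves neither the boundary nor the crossing
  times, so that both claims hold outside it.

  The constants under the square roots come from a budget. For each k, the Azuma bounds over all
  bins and the interval discrepancies may each fail with conditional probability 3 eta / (pi^2 k^2);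
  the sum of 6 / (pi^2 k^2) over k is 1.\<close>

lemma ln_1p_ge:
  fixes y :: real assumes "0 \<le> y" shows "2 * y / (2 + y) \<le> ln (1 + y)"
proof -
  have "ln (1 + 0) - 2 * 0 / (2 + 0) \<le> ln (1 + y) - 2 * y / (2 + y)"
  proof (rule DERIV_nonneg_imp_nondecreasing[OF assms], intro exI conjI)
    fix x :: real assume x: "0 \<le> x" "x \<le> y"
    show "((\<lambda>y. ln (1 + y) - 2 * y / (2 + y)) has_real_derivative 1 / (1 + x) - 4 / (2 + x)\<^sup>2) (at x)"
      using x by (auto intro!: derivative_eq_intros simp: power2_eq_square field_simps)
    \<comment> \<open>The derivative equals x^2 / ((1 + x) (2 + x)^2): the Pade approximant 2 y / (2
      + y) agrees with ln (1 + y) up to second order and stays below it.\<close>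
    have "4 * (1 + x) \<le> (2 + x)\<^sup>2" by (simp add: power2_eq_square algebra_simps)
    then show "0 \<le> 1 / (1 + x) - 4 / (2 + x)\<^sup>2"
      using x by (simp add: divide_simps)
  qed
  then show ?thesis by simp
qed

lemma ln_1m_le:
  fixes y :: real assumes "0 \<le> y" "y < 1" shows "ln (1 - y) \<le> - y - y\<^sup>2 / 2"
proof -
  have "- 0 - 0\<^sup>2 / 2 - ln (1 - 0) \<le> - y - y\<^sup>2 / 2 - ln (1 - y)"
  proof (rule DERIV_nonneg_imp_nondecreasing[OF assms(1)], intro exI conjI)
    fix x :: real assume x: "0 \<le> x" "x \<le> y"
    then have "x < 1" using assms by simp
    then show "((\<lambda>y. - y - y\<^sup>2 / 2 - ln (1 - y)) has_real_derivative - 1 - x + 1 / (1 - x)) (at x)"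
      by (auto intro!: derivative_eq_intros simp: power2_eq_square field_simps)
    show "0 \<le> - 1 - x + 1 / (1 - x)"
      using x \<open>x < 1\<close> by (simp add: divide_simps algebra_simps)
  qed
  then show ?thesis by simp
qed

text \<open>Concavity of ln in disguise: left side minus right side is the integral of ln over
  [1 - y, 1 + y], which is at most 2 y times ln 1.\<close>

lemma entropy_diff_le:
  fixes y :: real assumes "0 \<le> y" "y < 1"
  shows "(1 + y) * ln (1 + y) - (1 - y) * ln (1 - y) \<le> 2 * y"
proof -
  have "2 * 0 - ((1 + 0) * ln (1 + 0) - (1 - 0) * ln (1 - 0))
      \<le> 2 * y - ((1 + y) * ln (1 + y) - (1 - y) * ln (1 - y))"
  proof (rule DERIV_nonneg_imp_nondecreasing[OF assms(1)], intro exI conjI)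
    fix x :: real assume x: "0 \<le> x" "x \<le> y"
    then have "x < 1" using assms by simp
    then show "((\<lambda>y. 2 * y - ((1 + y) * ln (1 + y) - (1 - y) * ln (1 - y))) has_real_derivative
        - ln (1 + x) - ln (1 - x)) (at x)"
      using x by (auto intro!: derivative_eq_intros)
    have "ln (1 + x) + ln (1 - x) \<le> x + - x"
      using ln_add_one_self_le_self[of x] ln_1m_le[of x] x \<open>x < 1\<close>
      by (intro add_mono) (auto intro: order_trans)
    then show "0 \<le> - ln (1 + x) - ln (1 - x)" by simp
  qed
  then show ?thesis by simp
qed

text \<open>Division by the midpoint t + 1/2 maps [t, t + 1] onto [1 - y, 1 + y]. The left-hand side
  is 1 plus the integral of ln over [t, t + 1], so the error of the midpoint rule becomes a function
  of y alone.\<close>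

lemma midpoint_ln_split:
  fixes t :: real assumes "0 < t"
  defines "y \<equiv> 1 / (2 * t + 1)"
  shows "(t + 1) * ln (t + 1) - t * ln t
       = ln (t + 1/2) + ((1 + y) * ln (1 + y) - (1 - y) * ln (1 - y)) / (2 * y)"
proof -
  have y: "0 < y" "y < 1" using assms by (auto simp: y_def field_simps)
  have 1: "t + 1 = (t + 1/2) * (1 + y)" "t = (t + 1/2) * (1 - y)" 
    using assms by (auto simp: y_def field_simps)
  have l1: "ln (t + 1) = ln (t + 1/2) + ln (1 + y)"
    using y assms(1) by (subst 1(1)) (simp add: ln_mult)
  have l2: "ln t = ln (t + 1/2) + ln (1 - y)"
    using y assms(1) by (subst 1(2)) (simp add: ln_mult)
  have 2: "(1 + y) / (2 * y) = t + 1" "(1 - y) / (2 * y) = t"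
    using assms(1) by (auto simp: y_def field_simps)
  have "((1 + y) * ln (1 + y) - (1 - y) * ln (1 - y)) / (2 * y)
      = (1 + y) / (2 * y) * ln (1 + y) - (1 - y) / (2 * y) * ln (1 - y)"
    unfolding diff_divide_distrib[of "_ * _"] times_divide_eq_left ..
  then show ?thesis unfolding 2 l1 l2 by (simp add: algebra_simps)
qed

lemma integral_ln_le_midpoint:
  fixes t :: real assumes "0 < t"
  shows "(t + 1) * ln (t + 1) - t * ln t - 1 \<le> ln (t + 1/2)"
proof -
  define y where "y = 1 / (2 * t + 1)"
  have y: "0 < y" "y < 1" using assms by (auto simp: y_def field_simps)
  have "((1 + y) * ln (1 + y) - (1 - y) * ln (1 - y)) / (2 * y) \<le> 1"
    using entropy_diff_le[of y] y by (simp add: field_simps)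
  with midpoint_ln_split[OF assms] show ?thesis unfolding y_def by simp
qed

text \<open>The midpoint error is of order 1 / t^2; a multiple of 1 / t - 1 / (t + 1) has the same
  order and telescopes. The Taylor coefficient is 1/24, and 3/32 is what the elementary bounds on ln
  yield.\<close>

lemma midpoint_ln_le_integral:
  fixes t :: real assumes "0 < t"
  shows "ln (t + 1/2) \<le> (t + 1) * ln (t + 1) - t * ln t - 1 + 3/32 * (1 / t - 1 / (t + 1))"
proof -
  define y where "y = 1 / (2 * t + 1)"
  have y: "0 < y" "y < 1" using assms by (auto simp: y_def field_simps)
  have "(1 + y) * (2 * y / (2 + y)) - (1 - y) * (- y - y\<^sup>2 / 2)
      \<le> (1 + y) * ln (1 + y) - (1 - y) * ln (1 - y)"
    using ln_1p_ge[of y] ln_1m_le[of y] y by (intro diff_mono mult_left_mono) auto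
  then have "((1 + y) * (2 * y / (2 + y)) - (1 - y) * (- y - y\<^sup>2 / 2)) / (2 * y)
      \<le> ((1 + y) * ln (1 + y) - (1 - y) * ln (1 - y)) / (2 * y)"
    using y by (intro divide_right_mono) auto
  moreover have "1 - ((1 + y) * (2 * y / (2 + y)) - (1 - y) * (- y - y\<^sup>2 / 2)) / (2 * y)
      = y\<^sup>2 * (3 + y) / (4 * (2 + y))"
    using y by (simp add: divide_simps power2_eq_square) (simp add: algebra_simps)
  \<comment> \<open>The factor (3 + y) / (4 (2 + y)) decreases from 3/8 at y = 0. Afterwards (2 t +
    1)^2 \<ge> 4 t (t + 1) turns 3/8 into 3/32.\<close>
  moreover have "y\<^sup>2 * (3 + y) / (4 * (2 + y)) \<le> y\<^sup>2 * (3 / 8)"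
  proof -
    have "(3 + y) / (4 * (2 + y)) \<le> 3 / 8" using y by (simp add: field_simps)
    from mult_left_mono[OF this, of "y\<^sup>2"] show ?thesis by simp
  qed
  moreover have "y\<^sup>2 * (3 / 8) \<le> 3/32 * (1 / t - 1 / (t + 1))"
    using assms by (simp add: y_def divide_simps power2_eq_square) (simp add: algebra_simps)
  ultimately show ?thesis using midpoint_ln_split[OF assms] unfolding y_def by linarith
qed

text \<open>With w = (J - 1) / 2 this treats the denominator t + J/2 of the predictor. In the
  factorization (t + 1/2) (1 + z), the first factor gives the integral of ln over [t, t + 1], and ln
  (1 + z) gives w ln ((t + 1) / t), the source of the (J - 1)/2 ln t term. The losses w / t - z and
  z^2 / 2 are both dominated by telescoping differences.\<close>

lemma ln_shift_ge:
  fixes t w :: real assumes "1 \<le> t" "0 \<le> w"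
  shows "(t + 1) * ln (t + 1) - t * ln t - 1 + w * ln ((t + 1) / t)
     \<le> ln (t + (w + 1/2)) + (w + w\<^sup>2 / 2) * (1 / t - 1 / (t + 1))"
proof -
  define z where "z = w / (t + 1/2)"
  have z: "0 \<le> z" using assms by (simp add: z_def)
  have "t + (w + 1/2) = (t + 1/2) * (1 + z)" using assms by (simp add: z_def field_simps)
  then have l: "ln (t + (w + 1/2)) = ln (t + 1/2) + ln (1 + z)"
    using assms z by (simp add: ln_mult)
  have "z - z\<^sup>2 / 2 \<le> 2 * z / (2 + z)"
    using z by (simp add: divide_simps power2_eq_square) (simp add: algebra_simps)
  then have a: "z - z\<^sup>2 / 2 \<le> ln (1 + z)" using ln_1p_ge[OF z] by simp
  have "(t + 1) / t = 1 + 1 / t" using assms by (simp add: field_simps)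
  then have "ln ((t + 1) / t) \<le> 1 / t" using ln_add_one_self_le_self[of "1/t"] assms by simp
  then have b: "w * ln ((t + 1) / t) \<le> w * (1 / t)" using assms by (intro mult_left_mono) auto
  have c: "w * (1 / t) - z \<le> w * (1 / t - 1 / (t + 1))"
  proof -
    have "1 / t - 1 / (t + 1/2) \<le> 1 / t - 1 / (t + 1)"
      using assms by (intro diff_left_mono divide_left_mono) auto
    from mult_left_mono[OF this assms(2)] show ?thesis by (simp add: z_def algebra_simps)
  qed
  have d: "z\<^sup>2 / 2 \<le> w\<^sup>2 / 2 * (1 / t - 1 / (t + 1))"
  proof -
    have "1 / (t + 1/2)\<^sup>2 \<le> 1 / t - 1 / (t + 1)"
      using assms by (simp add: divide_simps power2_eq_square) (simp add: algebra_simps)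
    from mult_left_mono[OF this, of "w\<^sup>2 / 2"] show ?thesis by (simp add: z_def power_divide)
  qed
  have "(w + w\<^sup>2 / 2) * (1 / t - 1 / (t + 1)) = w * (1 / t - 1 / (t + 1)) + w\<^sup>2 / 2 * (1 / t - 1 / (t + 1))"
    by (simp add: algebra_simps)
  with integral_ln_le_midpoint[of t] assms l a b c d show ?thesis by linarith
qed

section \<open>Gibbs' and Pinsker's inequalities on a finite alphabet\<close>

lemma mult_ln_ratio_ge:
  fixes q r :: real assumes "0 \<le> q" "0 < r" shows "q - r \<le> q * ln (q / r)"
proof (cases "q = 0")
  case False
  with assms have "q > 0" by simp
  have "ln (r / q) \<le> r / q - 1" using \<open>q > 0\<close> assms by (intro ln_le_minus_one) auto
  then have "q * ln (r / q) \<le> q * (r / q - 1)" using \<open>q > 0\<close> by (intro mult_left_mono) auto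
  moreover have "q * (r / q - 1) = r - q" using \<open>q > 0\<close> by (simp add: field_simps)
  moreover have "ln (r / q) = - ln (q / r)" using \<open>q > 0\<close> assms by (simp add: ln_div)
  ultimately show ?thesis by simp
qed (use assms in auto)

text \<open>Donsker--Varadhan variational lower bound with a multiple of the indicator of
  \<open>{q \<ge> p}\<close> as test function; Hoeffding's lemma bounds its cumulant generating function.\<close>

lemma pinsker:
  assumes p: "\<And>j. j \<in> {1..J} \<Longrightarrow> 0 < p j" "(\<Sum>j=1..J. p j) = 1"
    and q: "\<And>j. j \<in> {1..J} \<Longrightarrow> 0 \<le> q j" "(\<Sum>j=1..J. q j) = 1"
  shows "2 * (TV_vec J p q)\<^sup>2 \<le> KL_vec J q p"
proof -
  define A where "A = {j\<in>{1..J}. p j \<le> q j}"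
  define d where "d = (\<Sum>j\<in>A. q j - p j)"
  define P where "P = (\<Sum>j\<in>A. p j)"
  have split: "(\<Sum>j=1..J. f j) = (\<Sum>j\<in>A. f j) + (\<Sum>j\<in>{1..J}-A. f j)" for f :: "nat \<Rightarrow> real"
  proof -
    have "A \<subseteq> {1..J}" by (auto simp: A_def)
    from sum.subset_diff[OF this, of f] show ?thesis by (simp add: add.commute)
  qed
  \<comment> \<open>Since q - p has total mass 0, the deficit outside A equals the excess d on A,
    and half the absolute sum is d.\<close>
  have "d + (\<Sum>j\<in>{1..J}-A. q j - p j) = 0"
    using split[of "\<lambda>j. q j - p j"] p q by (simp add: d_def sum_subtractf)
  moreover have "(\<Sum>j=1..J. \<bar>p j - q j\<bar>) = d + - (\<Sum>j\<in>{1..J}-A. q j - p j)"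
    unfolding split[of "\<lambda>j. \<bar>p j - q j\<bar>"] d_def sum_negf[symmetric]
    by (intro arg_cong2[where f="(+)"] sum.cong) (auto simp: A_def)
  ultimately have TV: "TV_vec J p q = d" by (simp add: TV_vec_def)
  have d0: "0 \<le> d" unfolding d_def by (intro sum_nonneg) (auto simp: A_def)
  have P0: "0 \<le> P" unfolding P_def using p by (intro sum_nonneg) (auto simp: A_def less_imp_le)
  \<comment> \<open>The maximizer of h d - h^2 / 8, whose maximum is 2 d^2.\<close>
  define h where "h = 4 * d"
  define f where "f j = (if j \<in> A then h else 0)" for j
  define Z where "Z = 1 + P * (exp h - 1)"
  have Z1: "1 \<le> Z" unfolding Z_def using d0 P0 by (simp add: h_def)
  have sumZ: "(\<Sum>j=1..J. p j * exp (f j)) = Z"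
  proof -
    have "(\<Sum>j=1..J. p j * exp (f j)) = (\<Sum>j\<in>A. p j * exp h) + (\<Sum>j\<in>{1..J}-A. p j)"
      unfolding split[of "\<lambda>j. p j * exp (f j)"]
      by (intro arg_cong2[where f="(+)"] sum.cong) (auto simp: f_def)
    also have "\<dots> = P * exp h + (1 - P)"
      using split[of p] p by (simp add: P_def sum_distrib_right)
    finally show ?thesis by (simp add: Z_def algebra_simps)
  qed
  have sumqf: "(\<Sum>j=1..J. q j * f j) = h * (d + P)"
  proof -
    have "(\<Sum>j=1..J. q j * f j) = (\<Sum>j\<in>A. q j * h) + (\<Sum>j\<in>{1..J}-A. 0)"
      unfolding split[of "\<lambda>j. q j * f j"]
      by (intro arg_cong2[where f="(+)"] sum.cong) (auto simp: f_def)
    also have "\<dots> = h * (d + P)" by (simp add: d_def P_def sum_subtractf mult.commute flip: sum_distrib_left)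
    finally show ?thesis .
  qed
  \<comment> \<open>Gibbs' inequality against the tilted law \<open>p j * exp (f j) / Z\<close>.
    Both laws have mass 1, so the left-hand sum vanishes.\<close>
  have "(\<Sum>j=1..J. q j - p j * exp (f j) / Z) \<le> (\<Sum>j=1..J. q j * ln (q j / (p j * exp (f j) / Z)))"
    using p q Z1 by (intro sum_mono mult_ln_ratio_ge) auto
  moreover have "(\<Sum>j=1..J. q j - p j * exp (f j) / Z) = 0"
    using Z1 q(2) sumZ by (simp add: sum_subtractf flip: sum_divide_distrib)
  moreover have "(\<Sum>j=1..J. q j * ln (q j / (p j * exp (f j) / Z)))
     = (\<Sum>j=1..J. q j * ln (q j / p j) - q j * f j + q j * ln Z)"
  proof (intro sum.cong refl)
    fix j assume j: "j \<in> {1..J}"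
    show "q j * ln (q j / (p j * exp (f j) / Z)) = q j * ln (q j / p j) - q j * f j + q j * ln Z"
    proof (cases "q j = 0")
      case False
      with q(1)[OF j] have "q j > 0" by simp
      then show ?thesis using p(1)[OF j] Z1
        by (simp add: ln_div ln_mult algebra_simps)
    qed simp
  qed
  ultimately have "0 \<le> KL_vec J q p - h * (d + P) + ln Z"
    using sumqf q(2) by (simp add: KL_vec_def sum.distrib sum_subtractf flip: sum_distrib_right)
  moreover have "- h * P + ln Z \<le> h\<^sup>2 / 8"
    unfolding Z_def using Hoeffdings_lemma_aux[of h P] P0 d0 by (simp add: h_def)
  ultimately have "h * d - h\<^sup>2 / 8 \<le> KL_vec J q p" by (simp add: algebra_simps)
  then show ?thesis by (simp add: TV h_def power2_eq_square)
qed

lemma TV_vec_triangle: "TV_vec J p r \<le> TV_vec J p q + TV_vec J q r"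
proof -
  have "(\<Sum>j=1..J. \<bar>p j - r j\<bar>) \<le> (\<Sum>j=1..J. \<bar>p j - q j\<bar> + \<bar>q j - r j\<bar>)"
    by (intro sum_mono) auto
  then show ?thesis by (simp add: TV_vec_def sum.distrib)
qed

text \<open>The terms with \<open>u\<close> cancel and leave the divergences of \<open>p\<close> and
  \<open>q\<close> to the mixture \<open>r\<close>. Since r - p = b / (a + b) (q - p) and r - q = a
  / (a + b) (p - q), the two Pinsker bounds combine through a b^2 + b a^2 = a b (a + b).\<close>

lemma KL_vec_mixture:
  fixes a b :: real
  assumes ab: "0 < a" "0 < b"
    and u: "\<And>j. j \<in> {1..J} \<Longrightarrow> 0 < u j"
    and p: "\<And>j. j \<in> {1..J} \<Longrightarrow> 0 < p j" "(\<Sum>j=1..J. p j) = 1"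
    and q: "\<And>j. j \<in> {1..J} \<Longrightarrow> 0 \<le> q j" "(\<Sum>j=1..J. q j) = 1"
    and r: "\<And>j. j \<in> {1..J} \<Longrightarrow> r j = (a * p j + b * q j) / (a + b)"
  shows "(a + b) * KL_vec J r u
     \<le> a * KL_vec J p u + b * KL_vec J q u - 2 * a * b / (a + b) * (TV_vec J p q)\<^sup>2"
proof -
  have r0: "0 < r j" if "j \<in> {1..J}" for j
    using ab p(1)[OF that] q(1)[OF that] r[OF that] by (simp add: add_pos_nonneg)
  have "(\<Sum>j=1..J. r j) = (\<Sum>j=1..J. (a * p j + b * q j) / (a + b))" using r by simp
  also have "\<dots> = (a * (\<Sum>j=1..J. p j) + b * (\<Sum>j=1..J. q j)) / (a + b)"
    by (simp add: sum.distrib sum_distrib_left flip: sum_divide_distrib)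
  also have "\<dots> = 1" using ab p q by simp
  finally have r1: "(\<Sum>j=1..J. r j) = 1" .
  have "a * KL_vec J p u + b * KL_vec J q u - (a + b) * KL_vec J r u
      = a * KL_vec J p r + b * KL_vec J q r"
    unfolding KL_vec_def sum_distrib_left sum.distrib[symmetric] sum_subtractf[symmetric]
  proof (intro sum.cong refl)
    fix j assume j: "j \<in> {1..J}"
    have e: "(a + b) * (r j * ln (r j / u j)) = (a * p j + b * q j) * ln (r j / u j)"
      using ab r[OF j] by simp
    have 1: "x * ln (x / u j) - x * ln (r j / u j) = x * ln (x / r j)" if "0 \<le> x" for x
      using that r0[OF j] u[OF j] by (cases "x = 0") (auto simp: ln_div algebra_simps)
    show "a * (p j * ln (p j / u j)) + b * (q j * ln (q j / u j)) - (a + b) * (r j * ln (r j / u j))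
        = a * (p j * ln (p j / r j)) + b * (q j * ln (q j / r j))"
      unfolding e using 1[of "p j"] 1[of "q j"] p(1)[OF j] q(1)[OF j] by (simp add: algebra_simps)
  qed
  moreover have "2 * (TV_vec J r p)\<^sup>2 \<le> KL_vec J p r"
    by (intro pinsker) (auto simp: r0 r1 p less_imp_le simp del: One_nat_def)
  moreover have "2 * (TV_vec J r q)\<^sup>2 \<le> KL_vec J q r"
    by (intro pinsker) (auto simp: r0 r1 q simp del: One_nat_def)
  moreover have "TV_vec J r p = b / (a + b) * TV_vec J p q"
    unfolding TV_vec_def mult.left_commute[of _ "1/2"] sum_distrib_left
  proof (intro arg_cong[where f="\<lambda>x. (1/2) * x"] sum.cong refl)
    fix j assume j: "j \<in> {1..J}"
    have "r j - p j = b / (a + b) * (q j - p j)" using ab r[OF j] by (simp add: field_simps)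
    then show "\<bar>r j - p j\<bar> = b / (a + b) * \<bar>p j - q j\<bar>" using ab by (simp add: abs_mult)
  qed
  moreover have "TV_vec J r q = a / (a + b) * TV_vec J p q"
    unfolding TV_vec_def mult.left_commute[of _ "1/2"] sum_distrib_left
  proof (intro arg_cong[where f="\<lambda>x. (1/2) * x"] sum.cong refl)
    fix j assume j: "j \<in> {1..J}"
    have "r j - q j = a / (a + b) * (p j - q j)" using ab r[OF j] by (simp add: field_simps)
    then show "\<bar>r j - q j\<bar> = a / (a + b) * \<bar>p j - q j\<bar>" using ab by (simp add: abs_mult)
  qed
  ultimately have "a * (2 * (b / (a + b) * TV_vec J p q)\<^sup>2) + b * (2 * (a / (a + b) * TV_vec J p q)\<^sup>2)
      \<le> a * KL_vec J p u + b * KL_vec J q u - (a + b) * KL_vec J r u"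
    using ab by (metis add_mono mult_left_mono less_imp_le)
  moreover have "a * (2 * (b / (a + b) * TV_vec J p q)\<^sup>2) + b * (2 * (a / (a + b) * TV_vec J p q)\<^sup>2)
     = 2 * a * b / (a + b) * (TV_vec J p q)\<^sup>2"
    using ab by (simp add: divide_simps power2_eq_square add_nonneg_eq_0_iff) (simp add: algebra_simps)
  ultimately show ?thesis by linarith
qed

section \<open>The Krichevsky--Trofimov process\<close>

lemma ex1_bin:
  assumes "1 \<le> J" "0 \<le> p" "p \<le> 1"
  shows "\<exists>!j. j \<in> {1..J} \<and> p \<in> bin J j"
proof (rule ex_ex1I)
  \<comment> \<open>The bin index is k + 1, capped at J because the last bin is closed and also
    contains p = 1.\<close>
  define k where "k = nat \<lfloor>p * real J\<rfloor>"
  have k: "real k \<le> p * real J" "p * real J < real k + 1"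
    using assms by (auto simp: k_def)
  show "\<exists>j. j \<in> {1..J} \<and> p \<in> bin J j"
  proof (cases "k < J - 1")
    case True
    then show ?thesis using k assms
      by (intro exI[of _ "Suc k"]) (auto simp: bin_def field_simps)
  next
    case False
    then have "real J - 1 \<le> real k" using assms by linarith
    with k have "real J - 1 \<le> p * real J" by linarith
    then show ?thesis using assms
      by (intro exI[of _ J]) (auto simp: bin_def field_simps)
  qed
next
  fix i j assume ij: "i \<in> {1..J} \<and> p \<in> bin J i" "j \<in> {1..J} \<and> p \<in> bin J j"
  have *: "\<not> i < j" if "i \<in> {1..J} \<and> p \<in> bin J i" "j \<in> {1..J} \<and> p \<in> bin J j" for i j
  proof
    assume "i < j"
    with that have "p < real i / real J" by (auto simp: bin_def)
    also have "\<dots> \<le> (real j - 1) / real J"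
      using \<open>i < j\<close> by (intro divide_right_mono) auto
    also have "\<dots> \<le> p" using that by (auto simp: bin_def split: if_splits)
    finally show False by simp
  qed
  show "i = j" using *[of i j] *[of j i] ij by linarith
qed

lemma bin_index:
  assumes "1 \<le> J" "0 \<le> p" "p \<le> 1"
  shows "bin_index J p \<in> {1..J}" "j \<in> {1..J} \<Longrightarrow> p \<in> bin J j \<longleftrightarrow> j = bin_index J p"
proof -
  note * = theI'[OF ex1_bin[OF assms], folded bin_index_def]
  show "bin_index J p \<in> {1..J}" using * by simp
  show "j \<in> {1..J} \<Longrightarrow> p \<in> bin J j \<longleftrightarrow> j = bin_index J p"
    using ex1_bin[OF assms] * by blast
qed

lemma bin_count_Suc:
  "bin_count J X U (Suc t) j \<omega> = bin_count J X U t j \<omega> + of_bool (pval X U (Suc t) \<omega> \<in> bin J j)"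
  by (simp add: bin_count_def)

lemma bin_count_mono: "s \<le> t \<Longrightarrow> bin_count J X U s j \<omega> \<le> bin_count J X U t j \<omega>"
  by (induction t rule: dec_induct) (auto simp: bin_count_Suc)

lemma KT_pos: "1 \<le> J \<Longrightarrow> 0 < KT J X U t \<omega>"
  unfolding KT_def by (intro prod_pos) (auto intro!: mult_pos_pos divide_pos_pos add_nonneg_pos)

lemma log_KT_Suc:
  assumes "1 \<le> J"
  shows "log_KT J X U (Suc t) \<omega> = log_KT J X U t \<omega>
    + ln (real J * ((real (bin_count J X U t (bin_index J (pval X U (Suc t) \<omega>)) \<omega>) + 1/2)
         / (real t + real J / 2)))"
proof -
  have "KT J X U (Suc t) \<omega> = KT J X U t \<omega>
    * (real J * ((real (bin_count J X U t (bin_index J (pval X U (Suc t) \<omega>)) \<omega>) + 1/2)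
         / (real t + real J / 2)))"
    by (simp add: KT_def)
  moreover have "0 < real J * ((real (bin_count J X U t (bin_index J (pval X U (Suc t) \<omega>)) \<omega>) + 1/2)
         / (real t + real J / 2))" (is "0 < ?x")
    using assms by (intro mult_pos_pos divide_pos_pos add_nonneg_pos) auto
  ultimately show ?thesis
    using KT_pos[OF assms, of X U t \<omega>] by (simp only: log_KT_def ln_mult_pos)
qed

lemma sum_bin_count:
  assumes "1 \<le> J" "\<And>i. 1 \<le> i \<Longrightarrow> 0 \<le> pval X U i \<omega> \<and> pval X U i \<omega> \<le> 1"
  shows "(\<Sum>j=1..J. bin_count J X U t j \<omega>) = t"
proof (induction t)
  case 0
  show ?case by (simp add: bin_count_def)
next
  case (Suc t)
  have p: "0 \<le> pval X U (Suc t) \<omega>" "pval X U (Suc t) \<omega> \<le> 1" using assms(2)[of "Suc t"] by auto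
  have "(\<Sum>j=1..J. of_bool (pval X U (Suc t) \<omega> \<in> bin J j)) =
        (\<Sum>j=1..J. if j = bin_index J (pval X U (Suc t) \<omega>) then 1 else 0::nat)"
    using bin_index(2)[OF assms(1) p] by (intro sum.cong) auto
  also have "\<dots> = 1" using bin_index(1)[OF assms(1) p] by simp
  finally show ?case using Suc.IH by (simp add: bin_count_Suc sum.distrib)
qed

definition KT_potential :: "nat \<Rightarrow> (nat \<Rightarrow> nat) \<Rightarrow> nat \<Rightarrow> real" where
  "KT_potential J N t = (\<Sum>j=1..J. real (N j) * ln (real (N j))) + real t * ln (real J)
     - real t * ln (real t) - (real J - 1) / 2 * ln (real t)"

text \<open>The sum of all remainders still to come: a step into bin c costs at most the decrease of
  this quantity. The coefficient 3/32 belongs to the midpoint rule in the numerator, w + w^2 / 2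
  with w = (J - 1) / 2 to the shifted denominator.\<close>

definition KT_error :: "nat \<Rightarrow> (nat \<Rightarrow> nat) \<Rightarrow> nat \<Rightarrow> real" where
  "KT_error J N t = 3/32 * (\<Sum>j=1..J. 1 / real (N j))
     + ((real J - 1) / 2 + ((real J - 1) / 2)\<^sup>2 / 2) * (1 / real t)"

text \<open>The potential consists of the leading Stirling terms of the Dirichlet(1/2) mixture likelihood; the
  midpoint rule for \<open>ln\<close> makes the remainders of the single steps telescope, so that no bounds on the
  Gamma function are needed.\<close>

lemma KT_potential_step:
  assumes J: "1 \<le> J" and t: "1 \<le> t" and c: "c \<in> {1..J}" "1 \<le> N c"
    and N': "\<And>j. j \<in> {1..J} \<Longrightarrow> N' j = N j + of_bool (j = c)"
  shows "ln (real J * ((real (N c) + 1/2) / (real t + real J / 2)))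
     \<le> KT_potential J N' (Suc t) + KT_error J N t - KT_potential J N t - KT_error J N' (Suc t)"
proof -
  define w where "w = (real J - 1) / 2"
  have w: "0 \<le> w" "real J / 2 = w + 1/2" using J by (auto simp: w_def field_simps)
  have s: "(\<Sum>j=1..J. f (N' j)) = (\<Sum>j=1..J. f (N j)) + (f (N c + 1) - f (N c))" for f :: "nat \<Rightarrow> real"
  proof -
    have "(\<Sum>j=1..J. f (N' j)) = (\<Sum>j=1..J. f (N j) + (if j = c then f (N c + 1) - f (N c) else 0))"
      using N' by (intro sum.cong) auto
    also have "\<dots> = (\<Sum>j=1..J. f (N j)) + (f (N c + 1) - f (N c))"
      using c by (simp add: sum.distrib)
    finally show ?thesis .
  qed
  \<comment> \<open>The numerator is a logarithm at a midpoint and is bounded above; the denominator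
    enters with a minus sign and therefore needs the lower bound \<open>b\<close>.\<close>
  have a: "ln (real (N c) + 1/2) \<le> (real (N c) + 1) * ln (real (N c) + 1) - real (N c) * ln (real (N c))
      - 1 + 3/32 * (1 / real (N c) - 1 / (real (N c) + 1))"
    using c by (intro midpoint_ln_le_integral) auto
  have b: "(real t + 1) * ln (real t + 1) - real t * ln (real t) - 1 + w * ln ((real t + 1) / real t)
     \<le> ln (real t + (w + 1/2)) + (w + w\<^sup>2 / 2) * (1 / real t - 1 / (real t + 1))"
    using t w by (intro ln_shift_ge) auto
  have l: "ln ((real t + 1) / real t) = ln (real t + 1) - ln (real t)" using t by (simp add: ln_div)
  have "ln (real J * ((real (N c) + 1/2) / (real t + real J / 2)))
      = ln (real J) + ln (real (N c) + 1/2) - ln (real t + (w + 1/2))"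
    unfolding w(2) using J t c w(1) by (subst ln_mult, auto simp: ln_div add_pos_pos add_nonneg_pos)
  then show ?thesis
    using a b unfolding KT_potential_def KT_error_def s[of "\<lambda>x. real x * ln (real x)"]
      s[of "\<lambda>x. 1 / real x"] w_def[symmetric] l
    by (simp add: algebra_simps)
qed

lemma log_KT_increment_le:
  assumes J: "1 \<le> J" and n: "1 \<le> n"
    and p: "\<And>i. 1 \<le> i \<Longrightarrow> 0 \<le> pval X U i \<omega> \<and> pval X U i \<omega> \<le> 1"
    and N: "\<And>j. j \<in> {1..J} \<Longrightarrow> 1 \<le> bin_count J X U n j \<omega>"
  defines "N \<equiv> \<lambda>t j. bin_count J X U t j \<omega>"
  shows "log_KT J X U (n + m) \<omega> - log_KT J X U n \<omega>
     \<le> KT_potential J (N (n + m)) (n + m) - KT_potential J (N n) n + KT_error J (N n) n"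
proof -
  \<comment> \<open>The final error term is kept so that the step errors telescope in the induction;
    being nonnegative, it is dropped afterwards.\<close>
  have "log_KT J X U (n + m) \<omega> - log_KT J X U n \<omega>
     \<le> KT_potential J (N (n + m)) (n + m) - KT_potential J (N n) n + KT_error J (N n) n
        - KT_error J (N (n + m)) (n + m)"
  proof (induction m)
    case (Suc m)
    define c where "c = bin_index J (pval X U (Suc (n + m)) \<omega>)"
    have p': "0 \<le> pval X U (Suc (n + m)) \<omega>" "pval X U (Suc (n + m)) \<omega> \<le> 1"
      using p[of "Suc (n + m)"] by auto
    have c: "c \<in> {1..J}" unfolding c_def by (rule bin_index(1)[OF J p'])
    have "1 \<le> N (n + m) c" using N[OF c] bin_count_mono[of n "n+m" J X U c \<omega>] by (simp add: N_def)
    moreover have "N (Suc (n + m)) j = N (n + m) j + of_bool (j = c)" if "j \<in> {1..J}" for j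
      using bin_index(2)[OF J p' that] by (simp add: N_def bin_count_Suc c_def)
    ultimately have "ln (real J * ((real (N (n + m) c) + 1/2) / (real (n + m) + real J / 2)))
     \<le> KT_potential J (N (Suc (n + m))) (Suc (n + m)) + KT_error J (N (n + m)) (n + m)
       - KT_potential J (N (n + m)) (n + m) - KT_error J (N (Suc (n + m))) (Suc (n + m))"
      using J n c by (intro KT_potential_step) auto
    then show ?case using Suc.IH log_KT_Suc[OF J, of X U "n + m" \<omega>] by (simp add: c_def N_def)
  qed simp
  moreover have "0 \<le> KT_error J (N (n + m)) (n + m)"
    unfolding KT_error_def using J by (intro add_nonneg_nonneg mult_nonneg_nonneg sum_nonneg) auto
  ultimately show ?thesis by linarith
qed

text \<open>As the counts sum to \<open>t\<close>, the contributions of ln J and ln t leave the sum.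
  The Stirling terms thereby become divergences, to which the mixture inequality applies.\<close>

lemma KT_potential_eq_KL:
  assumes "1 \<le> J" "1 \<le> t" "\<And>j. j \<in> {1..J} \<Longrightarrow> 1 \<le> N j" "(\<Sum>j=1..J. N j) = t"
  shows "KT_potential J N t
     = real t * KL_vec J (\<lambda>j. real (N j) / real t) (unif_vec J) - (real J - 1) / 2 * ln (real t)"
proof -
  have "real t * KL_vec J (\<lambda>j. real (N j) / real t) (unif_vec J)
      = (\<Sum>j=1..J. real (N j) * ln (real (N j)) + real (N j) * (ln (real J) - ln (real t)))"
    unfolding KL_vec_def sum_distrib_left
  proof (intro sum.cong refl)
    fix j assume "j \<in> {1..J}"
    with assms have "0 < real (N j)" by fastforce
    then show "real t * (real (N j) / real t * ln (real (N j) / real t / unif_vec J j))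
        = real (N j) * ln (real (N j)) + real (N j) * (ln (real J) - ln (real t))"
      using assms by (simp add: unif_vec_def ln_div ln_mult algebra_simps)
  qed
  also have "\<dots> = (\<Sum>j=1..J. real (N j) * ln (real (N j))) + real t * (ln (real J) - ln (real t))"
    by (simp add: sum.distrib flip: sum_distrib_right assms(4))
  finally show ?thesis by (simp add: KT_potential_def algebra_simps)
qed

section \<open>The function \<open>Phi\<close>\<close>

lemma KL_unif_le_ln:
  assumes "1 \<le> J" "q \<in> simplex_vec J" shows "KL_vec J q (unif_vec J) \<le> ln (real J)"
proof -
  have "KL_vec J q (unif_vec J) \<le> (\<Sum>j=1..J. q j * ln (real J))"
    unfolding KL_vec_def
  proof (intro sum_mono)
    fix j assume j: "j \<in> {1..J}"
    have q: "0 \<le> q j" "q j \<le> 1"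
      using assms(2) j member_le_sum[of j "{1..J}" q] by (auto simp: simplex_vec_def)
    show "q j * ln (q j / unif_vec J j) \<le> q j * ln (real J)"
    proof (cases "q j = 0")
      case False
      then have "0 < q j * real J" "q j * real J \<le> real J" using q assms(1) by (auto simp: mult_le_cancel_right1)
      then show ?thesis using q by (intro mult_left_mono) (auto simp: unif_vec_def)
    qed simp
  qed
  also have "\<dots> = ln (real J)" using assms(2) by (simp add: simplex_vec_def flip: sum_distrib_right)
  finally show ?thesis .
qed

lemma bdd_above_Phi:
  assumes "1 \<le> J"
  shows "bdd_above {KL_vec J q (unif_vec J) | q.
     q \<in> simplex_vec J \<and> (MAX j\<in>{1..J}. \<bar>q j - unif_vec J j\<bar>) \<le> a}"
  using KL_unif_le_ln[OF assms] by (intro bdd_aboveI[of _ "ln (real J)"]) auto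

lemma KL_le_Phi:
  assumes "1 \<le> J" "q \<in> simplex_vec J" "\<And>j. j \<in> {1..J} \<Longrightarrow> \<bar>q j - 1 / real J\<bar> \<le> a"
  shows "KL_vec J q (unif_vec J) \<le> Phi J a"
  unfolding Phi_def
  by (rule cSup_upper[OF _ bdd_above_Phi[OF assms(1)]]) (use assms in \<open>auto simp: unif_vec_def\<close>)

lemma unif_in_simplex: "1 \<le> J \<Longrightarrow> unif_vec J \<in> simplex_vec J"
  by (auto simp: simplex_vec_def unif_vec_def)

text \<open>For a negative radius the set in \<open>Phi\<close> is empty and its real supremum
  carries no information; a nonnegative radius admits at least the uniform vector.\<close>

lemma Phi_mono:
  assumes "1 \<le> J" "0 \<le> a" "a \<le> b" shows "Phi J a \<le> Phi J b"
  unfolding Phi_def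
proof (rule cSup_subset_mono[OF _ bdd_above_Phi[OF assms(1)]])
  show "{KL_vec J q (unif_vec J) | q. q \<in> simplex_vec J \<and> (MAX j\<in>{1..J}. \<bar>q j - unif_vec J j\<bar>) \<le> a} \<noteq> {}"
    using unif_in_simplex[OF assms(1)] assms by auto
qed (use assms in force)

text \<open>The frequencies at time n + m are the mixture of those at time n and of the new ones
  \<open>q\<close>, with weights n and m. In the difference of potentials the divergence at time n
  cancels, m KL(q, u) is at most m Phi(a), and the logarithms merge into ln (1 + m / n). Since
  \<open>q\<close> is within \<open>a\<close> of uniform in each coordinate, its total variation
  distance to uniform is at most J a / 2, and the triangle inequality leaves
  \<open>V - J / 2 * a\<close> for the Pinsker term.\<close>

lemma log_KT_le_U_bound:
  fixes \<omega> :: 'a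
  assumes J: "2 \<le> J" and tau: "1 \<le> tau" "tau \<le> n" and m: "1 \<le> m"
    and p: "\<And>i. 1 \<le> i \<Longrightarrow> 0 \<le> pval X U i \<omega> \<and> pval X U i \<omega> \<le> 1"
    and c: "0 < c_const tau J eta0"
    and N: "\<And>j. j \<in> {1..J} \<Longrightarrow> c_const tau J eta0 \<le> real (bin_count J X U tau j \<omega>) / real tau"
    and dev: "\<And>j. j \<in> {1..J} \<Longrightarrow>
       \<bar>real (bin_count J X U (n + m) j \<omega> - bin_count J X U n j \<omega>) / real m - 1 / real J\<bar>
         \<le> a_bound J eta n m b"
  shows "log_KT J X U (n + m) \<omega> - log_KT J X U n \<omega>
      \<le> U_bound tau J eta0 eta n m b (V_dev J X U n \<omega>)"
proof -
  define a where "a = a_bound J eta n m b"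
  define N where "N = (\<lambda>t j. bin_count J X U t j \<omega>)"
  define cc where "cc = c_const tau J eta0"
  define q where "q j = real (N (n + m) j - N n j) / real m" for j
  have J1: "1 \<le> J" and n: "1 \<le> n" using J tau by auto
  have Nn: "cc * real tau \<le> real (N n j)" if "j \<in> {1..J}" for j
    using N[OF that] tau bin_count_mono[of tau n J X U j \<omega>]
    by (simp add: cc_def N_def field_simps)
  have N1: "1 \<le> N t j" if "j \<in> {1..J}" "n \<le> t" for t j
  proof -
    have "0 < cc * real tau" using c tau by (simp add: cc_def)
    then have "0 < real (N n j)" using Nn[OF that(1)] by linarith
    then show ?thesis using bin_count_mono[OF that(2), of J X U j \<omega>] by (simp add: N_def)
  qed
  have sumN: "(\<Sum>j=1..J. N t j) = t" for t unfolding N_def by (rule sum_bin_count[OF J1 p])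
  have s: "(\<Sum>j=1..J. real (N t j)) = real t" for t using sumN[of t] by (simp flip: of_nat_sum)
  have mono: "N n j \<le> N (n + m) j" for j by (simp add: N_def bin_count_mono)
  have q: "q \<in> simplex_vec J"
  proof -
    have "(\<Sum>j=1..J. real (N (n + m) j - N n j)) = real (n + m) - real n"
      using mono s[of "n + m"] s[of n] by (simp add: of_nat_diff sum_subtractf)
    then show ?thesis using m by (simp add: simplex_vec_def q_def flip: sum_divide_distrib)
  qed
  have qa: "\<bar>q j - 1 / real J\<bar> \<le> a" if "j \<in> {1..J}" for j
    using dev[OF that] by (simp add: q_def N_def a_def)
  have "(real n + real m) * KL_vec J (\<lambda>j. real (N (n + m) j) / real (n + m)) (unif_vec J)
     \<le> real n * KL_vec J (\<lambda>j. real (N n j) / real n) (unif_vec J) + real m * KL_vec J q (unif_vec J)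
       - 2 * real n * real m / (real n + real m) * (TV_vec J (\<lambda>j. real (N n j) / real n) q)\<^sup>2"
  proof (rule KL_vec_mixture)
    show "0 < real n" "0 < real m" using n m by auto
    show "0 < unif_vec J j" for j using J1 by (simp add: unif_vec_def)
    show "0 < real (N n j) / real n" if "j \<in> {1..J}" for j using N1[OF that order_refl] n by simp
    show "(\<Sum>j=1..J. real (N n j) / real n) = 1" using n s[of n] by (simp flip: sum_divide_distrib)
    show "0 \<le> q j" if "j \<in> {1..J}" for j using q that by (auto simp: simplex_vec_def)
    show "(\<Sum>j=1..J. q j) = 1" using q by (auto simp: simplex_vec_def)
    show "real (N (n + m) j) / real (n + m) = (real n * (real (N n j) / real n) + real m * q j) / (real n + real m)" for j
      using n m mono[of j] by (simp add: q_def of_nat_diff)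
  qed
  moreover have "real m * KL_vec J q (unif_vec J) \<le> real m * Phi J a"
    using KL_le_Phi[OF J1 q qa] by (intro mult_left_mono) auto
  moreover have "2 * real n * real m / (real n + real m) * (max (V_dev J X U n \<omega> - real J / 2 * a) 0)\<^sup>2
     \<le> 2 * real n * real m / (real n + real m) * (TV_vec J (\<lambda>j. real (N n j) / real n) q)\<^sup>2"
  proof (intro mult_left_mono power_mono)
    have "(\<Sum>j=1..J. \<bar>q j - 1 / real J\<bar>) \<le> (\<Sum>j=1..J. a)" by (intro sum_mono qa)
    then have "TV_vec J q (unif_vec J) \<le> real J / 2 * a" by (simp add: TV_vec_def unif_vec_def)
    moreover have "0 \<le> TV_vec J (\<lambda>j. real (N n j) / real n) q" by (simp add: TV_vec_def sum_nonneg)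
    ultimately show "max (V_dev J X U n \<omega> - real J / 2 * a) 0 \<le> TV_vec J (\<lambda>j. real (N n j) / real n) q"
      using TV_vec_triangle[of J "\<lambda>j. real (N n j) / real n" "unif_vec J" q]
      by (simp add: V_dev_def N_def)
  qed auto
  \<comment> \<open>Every count at time n is at least c tau, so the reciprocals sum to at most J /
    (c tau), and 3/32 is below the 5/12 available in \<open>eps_const\<close>. The coefficient of 1
    / n is at most J (J - 1) / 2, twice the first summand of \<open>K_const\<close>.\<close>
  moreover have "KT_error J (N n) n \<le> eps_const tau J eta0"
  proof -
    have "(\<Sum>j=1..J. 1 / real (N n j)) \<le> (\<Sum>j=1..J. 1 / (cc * real tau))"
      using Nn N1 c tau by (intro sum_mono divide_left_mono mult_pos_pos) (auto simp: cc_def Suc_le_eq)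
    then have "3/32 * (\<Sum>j=1..J. 1 / real (N n j)) \<le> 3/32 * (real J / (cc * real tau))" by simp
    also have "\<dots> \<le> 2 * (5 * real J / (24 * cc)) / real tau"
      using c tau J by (simp add: cc_def field_simps)
    finally have 1: "3/32 * (\<Sum>j=1..J. 1 / real (N n j)) \<le> 2 * (5 * real J / (24 * cc)) / real tau" .
    have "(real J - 1) / 2 + ((real J - 1) / 2)\<^sup>2 / 2
        \<le> 2 * (real J * (real J - 1) / 4 + (real J)\<^sup>2 * (real J + 1) / 16 + 1 / 12)"
    proof -
      have "(real J - 1) * (2 + (real J - 1) / 2) \<le> (real J - 1) * (2 * real J)"
        using J by (intro mult_left_mono) (auto simp: field_simps)
      moreover have "(real J - 1) / 2 + ((real J - 1) / 2)\<^sup>2 / 2 = (real J - 1) * (2 + (real J - 1) / 2) / 4"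
        "(real J - 1) * (2 * real J) / 4 = 2 * (real J * (real J - 1) / 4)"
        by (auto simp: power2_eq_square field_simps)
      ultimately have "(real J - 1) / 2 + ((real J - 1) / 2)\<^sup>2 / 2 \<le> 2 * (real J * (real J - 1) / 4)"
        by (metis divide_right_mono zero_le_numeral)
      also have "\<dots> \<le> 2 * (real J * (real J - 1) / 4 + (real J)\<^sup>2 * (real J + 1) / 16 + 1 / 12)"
        by simp
      finally show ?thesis .
    qed
    then have "((real J - 1) / 2 + ((real J - 1) / 2)\<^sup>2 / 2) * (1 / real n)
        \<le> 2 * (real J * (real J - 1) / 4 + (real J)\<^sup>2 * (real J + 1) / 16 + 1 / 12) * (1 / real tau)"
      using J tau n by (intro mult_mono) (auto intro!: divide_left_mono)
    with 1 have "KT_error J (N n) n \<le> 2 * (5 * real J / (24 * cc)) / real tau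
       + 2 * (real J * (real J - 1) / 4 + (real J)\<^sup>2 * (real J + 1) / 16 + 1 / 12) * (1 / real tau)"
      unfolding KT_error_def by linarith
    also have "\<dots> = eps_const tau J eta0"
      by (simp add: eps_const_def K_const_def cc_def add_divide_distrib distrib_left)
    finally show ?thesis .
  qed
  moreover have "log_KT J X U (n + m) \<omega> - log_KT J X U n \<omega>
     \<le> KT_potential J (N (n + m)) (n + m) - KT_potential J (N n) n + KT_error J (N n) n"
    unfolding N_def using N1[OF _ order_refl] by (intro log_KT_increment_le[OF J1 n p]) (auto simp: N_def)
  moreover have "KT_potential J (N (n + m)) (n + m)
     = real (n + m) * KL_vec J (\<lambda>j. real (N (n + m) j) / real (n + m)) (unif_vec J)
       - (real J - 1) / 2 * ln (real (n + m))"
    using n N1 by (intro KT_potential_eq_KL[OF J1]) (auto simp: sumN simp del: One_nat_def)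
  moreover have "KT_potential J (N n) n
     = real n * KL_vec J (\<lambda>j. real (N n j) / real n) (unif_vec J) - (real J - 1) / 2 * ln (real n)"
    using n N1 by (intro KT_potential_eq_KL[OF J1]) (auto simp: sumN simp del: One_nat_def)
  moreover have "(real J - 1) / 2 * ln (1 + real m / real n)
     = (real J - 1) / 2 * ln (real (n + m)) - (real J - 1) / 2 * ln (real n)"
  proof -
    have "1 + real m / real n = real (n + m) / real n" using n by (simp add: field_simps)
    then show ?thesis using n m by (simp add: ln_div right_diff_distrib)
  qed
  ultimately show ?thesis unfolding U_bound_def a_def[symmetric] of_nat_add by linarith
qed

section \<open>Mass of a window of counts\<close>

context real_distribution
begin

context
  assumes cont: "continuous_on UNIV (cdf M)"
begin

text \<open>The probability integral transform. Continuity makes the set closed and monotonicity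
  makes it a half-line with a largest point c, unless it is empty or \<beta> = 1; the distribution
  function exceeds \<beta> to the right of c, so right continuity forces its value at c to be
  \<beta>.\<close>

lemma measure_cdf_le:
  assumes "0 \<le> \<beta>" "\<beta> \<le> 1" shows "measure M {x. cdf M x \<le> \<beta>} = \<beta>"
proof (cases "\<beta> = 1")
  case True
  then show ?thesis using cdf_bounded_prob prob_space by simp
next
  case False
  with assms have b1: "\<beta> < 1" by simp
  let ?S = "{x. cdf M x \<le> \<beta>}"
  have "\<forall>\<^sub>F x in at_top. \<beta> < cdf M x" using cdf_lim_at_top_prob b1 by (rule order_tendstoD)
  then obtain B where B: "\<And>x. B \<le> x \<Longrightarrow> \<beta> < cdf M x" by (auto simp: eventually_at_top_linorder)
  have bdd: "bdd_above ?S" using B by (intro bdd_aboveI[of _ B]) (meson leD le_cases mem_Collect_eq)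
  show ?thesis
  proof (cases "?S = {}")
    case True
    have "\<beta> \<le> 0"
      using cdf_lim_at_bot True
      by (intro tendsto_lowerbound[OF cdf_lim_at_bot]) (auto intro!: always_eventually simp: not_le less_imp_le)
    then show ?thesis using True assms by simp
  next
    case ne: False
    define c where "c = Sup ?S"
    have cl: "closed ?S"
      using cont by (intro closed_Collect_le) auto
    have cS: "c \<in> ?S" unfolding c_def by (rule closed_contains_Sup[OF ne bdd cl])
    have S: "?S = {..c}"
      using cS cdf_nondecreasing bdd by (auto simp: c_def intro: cSup_upper order_trans)
    have "\<beta> \<le> cdf M c"
    proof (rule tendsto_lowerbound)
      show "(cdf M \<longlongrightarrow> cdf M c) (at_right c)"
        using cdf_is_right_cont[of c] by (simp add: continuous_within)
      have "\<beta> < cdf M x" if "c < x" for x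
        using S[unfolded set_eq_iff, THEN spec, of x] that by simp
      then show "\<forall>\<^sub>F x in at_right c. \<beta> \<le> cdf M x"
        by (auto simp: eventually_at_right_less less_imp_le eventually_at_filter)
    qed simp
    then show ?thesis using cS S by (simp add: cdf_def)
  qed
qed

lemma measure_cdf_less:
  assumes "0 \<le> \<beta>" "\<beta> \<le> 1" shows "measure M {x. cdf M x < \<beta>} = \<beta>"
proof (rule antisym)
  have [measurable]: "cdf M \<in> borel_measurable borel"
    using cont by (rule borel_measurable_continuous_onI)
  show "measure M {x. cdf M x < \<beta>} \<le> \<beta>"
    using measure_cdf_le[OF assms] by (metis (mono_tags, lifting) finite_measure_mono less_imp_le mem_Collect_eq subsetI events_eq_borel borel_measurable_le borel_measurable_const \<open>cdf M \<in> borel_measurable borel\<close> space_borel UNIV_I Collect_cong)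
  show "\<beta> \<le> measure M {x. cdf M x < \<beta>}"
  proof (rule field_le_epsilon)
    fix e :: real assume e: "0 < e"
    show "\<beta> \<le> measure M {x. cdf M x < \<beta>} + e"
    proof (cases "\<beta> \<le> e")
      case False
      have "\<beta> - e = measure M {x. cdf M x \<le> \<beta> - e}" using assms e False by (intro measure_cdf_le[symmetric]) auto
      also have "\<dots> \<le> measure M {x. cdf M x < \<beta>}"
        using e by (intro finite_measure_mono) auto
      finally show ?thesis by simp
    qed (use measure_nonneg[of M "{x. cdf M x < \<beta>}"] in linarith)
  qed
qed

text \<open>The set \<open>{lo \<le> S < hi}\<close> is an interval; its endpoints are approached from inside for the upper
  bound and from outside for the lower bound.\<close>

lemma count_window_measure:
  fixes S :: "real \<Rightarrow> real"
  assumes D: "0 < D" and S: "antimono S" "\<And>x. 0 \<le> S x" "\<And>x. S x \<le> D"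
    and lim: "(S \<longlongrightarrow> D) at_bot" "(S \<longlongrightarrow> 0) at_top"
    and E: "\<And>x y. x \<le> y \<Longrightarrow> \<bar>(S x - S y) - D * (cdf M y - cdf M x)\<bar> \<le> E"
    and u: "0 \<le> u" "u \<le> 1"
    and lohi: "- u \<le> lo" "hi \<le> D + 1 - u" "lo \<le> hi" "full \<Longrightarrow> hi = D + 1 - u"
  shows "D * measure M {x. lo \<le> S x \<and> (full \<or> S x < hi)} \<le> hi - lo + E" (is "D * measure M ?I \<le> _")
    and "hi - lo - 1 - E \<le> D * measure M {x. lo \<le> S x \<and> (full \<or> S x < hi)}"
proof -
  let ?F = "cdf M"
  have E0: "0 \<le> E" using E[of 0 0] by simp
  have F01: "0 \<le> ?F x" "?F x \<le> 1" for x using cdf_nonneg cdf_bounded_prob by auto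
  have Fm[measurable]: "?F \<in> borel_measurable borel"
    using cont by (rule borel_measurable_continuous_onI)
  have Sm[measurable]: "S \<in> borel_measurable borel"
  proof -
    have "mono (\<lambda>x. - S x)" using S(1) by (auto simp: mono_def antimono_def)
    from borel_measurable_uminus[OF borel_measurable_mono[OF this]] show ?thesis by simp
  qed
  have E': "S x - S y - E \<le> D * (?F y - ?F x)" "D * (?F y - ?F x) \<le> S x - S y + E" for x y
    using E[of x y] E[of y x] by (cases "x \<le> y"; auto simp: abs_le_iff algebra_simps)+
  \<comment> \<open>If \<open>full\<close> holds there is no upper constraint, but then hi = D + 1 -
    u \<ge> D because u \<le> 1.\<close>
  have Sle: "S x \<le> hi" if "x \<in> ?I" for x using that S(3)[of x] lohi u by fastforce
  show "D * measure M ?I \<le> hi - lo + E"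
  proof (cases "?I = {}")
    case True
    then show ?thesis using lohi E0 by (simp only:) simp
  next
    case ne: False
    \<comment> \<open>The endpoints are measured on the scale of the distribution function: the
      window lies in {a \<le> F \<le> b}, whose mass is exactly b - a, and no case distinction on
      attained endpoints arises.\<close>
    define a where "a = Inf (?F ` ?I)"
    define b where "b = Sup (?F ` ?I)"
    have bdd: "bdd_below (?F ` ?I)" "bdd_above (?F ` ?I)"
      using F01 by (auto intro!: bdd_belowI2[of _ 0] bdd_aboveI2[of _ _ 1])
    have ab: "a \<le> ?F x" "?F x \<le> b" if "x \<in> ?I" for x
      using that bdd unfolding a_def b_def by (auto intro: cINF_lower cSUP_upper)
    have a0: "0 \<le> a" unfolding a_def using ne F01 by (intro cINF_greatest) auto
    have b1: "b \<le> 1" unfolding b_def using ne F01 by (intro cSUP_least) auto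
    have "a \<le> b" using ab ne by (auto intro: order_trans)
    have "D * b \<le> D * a + (hi - lo + E)"
    proof -
      have "b \<le> ?F x + (hi - lo + E) / D" if x: "x \<in> ?I" for x
        unfolding b_def
      proof (rule cSUP_least[OF ne])
        fix y assume y: "y \<in> ?I"
        have "S x - S y \<le> hi - lo" using Sle[OF x] y by auto
        then have "D * (?F y - ?F x) \<le> hi - lo + E" using E'(2)[of y x] by linarith
        then show "?F y \<le> ?F x + (hi - lo + E) / D" using D by (simp add: field_simps)
      qed
      then have "b - (hi - lo + E) / D \<le> a"
        unfolding a_def using ne by (intro cINF_greatest) (auto simp: diff_le_eq)
      then show ?thesis using D by (simp add: field_simps)
    qed
    moreover have "measure M ?I \<le> b - a"
    proof -
      have "measure M ?I \<le> measure M ({x. ?F x \<le> b} - {x. ?F x < a})"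
      proof (rule finite_measure_mono)
        show "?I \<subseteq> {x. ?F x \<le> b} - {x. ?F x < a}"
          using ab by (intro subsetI) (simp add: not_less)
      qed simp
      also have "\<dots> = measure M {x. ?F x \<le> b} - measure M {x. ?F x < a}"
        using \<open>a \<le> b\<close> by (intro finite_measure_Diff) auto
      also have "\<dots> = b - a"
        using a0 b1 \<open>a \<le> b\<close> by (simp add: measure_cdf_le measure_cdf_less)
      finally show ?thesis .
    qed
    then have "D * measure M ?I \<le> D * (b - a)" using D by simp
    ultimately show ?thesis by (simp add: algebra_simps)
  qed
  show "hi - lo - 1 - E \<le> D * measure M ?I"
  proof -
    \<comment> \<open>\<open>L\<close> and \<open>R\<close> are the parts of the complement to the
      left and to the right of the window. An empty part gets the limits of the distribution
      function (0 or 1) and of the count (D or 0) at the respective infinity.\<close>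
    define L where "L = {x. \<not> full \<and> hi \<le> S x}"
    define R where "R = {x. S x < lo}"
    have bddL: "bdd_above (?F ` L)" and bddR: "bdd_below (?F ` R)"
      using F01 by (auto intro!: bdd_belowI2[of _ 0] bdd_aboveI2[of _ _ 1])
    define a where "a = (if L = {} then 0 else Sup (?F ` L))"
    define b where "b = (if R = {} then 1 else Inf (?F ` R))"
    have a: "0 \<le> a" "a \<le> 1" "\<And>x. x \<in> L \<Longrightarrow> ?F x \<le> a"
      using F01 bddL by (auto simp: a_def intro: cSUP_upper cSUP_least intro!: cSUP_upper2)
    have b: "0 \<le> b" "b \<le> 1" "\<And>x. x \<in> R \<Longrightarrow> b \<le> ?F x"
      using F01 bddR by (auto simp: b_def intro: cINF_lower cINF_greatest intro!: cINF_lower2)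
    define sL where "sL = (if L = {} then D else hi)"
    define sR where "sR = (if R = {} then 0 else lo)"
    have 1: "D * a \<le> D * ?F y - sL + S y + E" for y
    proof (cases "L = {}")
      case True
      have "S x - S y - E \<le> D * (?F y - ?F x)" for x by (rule E')
      then have "D - S y - E \<le> D * (?F y - 0)"
        by (intro tendsto_le[OF _ tendsto_mult_left[OF tendsto_diff[OF tendsto_const cdf_lim_at_bot]]
             tendsto_diff[OF tendsto_diff[OF lim(1) tendsto_const] tendsto_const]]) auto
      then show ?thesis using True by (simp add: a_def sL_def)
    next
      case False
      have "a \<le> (D * ?F y - sL + S y + E) / D"
        unfolding a_def using False
      proof (simp, intro cSUP_least)
        fix x assume "x \<in> L"
        then have "hi - S y - E \<le> D * (?F y - ?F x)" using E'(1)[of x y] by (auto simp: L_def)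
        then show "?F x \<le> (D * ?F y - sL + S y + E) / D"
          using D False by (simp add: sL_def field_simps)
      qed
      then show ?thesis using D by (simp add: field_simps)
    qed
    have 2: "D * a \<le> D * b - sL + sR + E"
    proof (cases "R = {}")
      case True
      have "D * a \<le> D * 1 - sL + 0 + E"
        by (rule tendsto_lowerbound[OF tendsto_add[OF tendsto_add[OF tendsto_diff[OF tendsto_mult_left[OF cdf_lim_at_top_prob] tendsto_const] lim(2)] tendsto_const]])
           (use 1 in auto)
      then show ?thesis using True by (simp add: b_def sR_def)
    next
      case False
      have "(D * a + sL - sR - E) / D \<le> b"
        unfolding b_def using False
      proof (simp, intro cINF_greatest)
        fix y assume "y \<in> R"
        then have "S y \<le> lo" by (simp add: R_def)
        with 1[of y] show "(D * a + sL - sR - E) / D \<le> ?F y"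
          using D False by (simp add: sR_def field_simps)
      qed
      then show ?thesis using D by (simp add: field_simps)
    qed
    \<comment> \<open>Replacing hi by D loses at most 1 - u and replacing lo by 0 at most u; this is
      the single point by which the lower bound is worse.\<close>
    have 3: "hi - lo - 1 \<le> sL - sR"
      using lohi u by (auto simp: sL_def sR_def)
    have "1 = measure M (?I \<union> L \<union> R)"
    proof -
      have "?I \<union> L \<union> R = space M" by (auto simp: L_def R_def)
      then show ?thesis by (simp only: prob_space)
    qed
    also have "\<dots> \<le> measure M ?I + measure M L + measure M R"
      unfolding L_def R_def
      by (intro order_trans[OF measure_Un_le] add_mono) auto
    also have "measure M L \<le> measure M {x. ?F x \<le> a}"
      using a(3) by (intro finite_measure_mono subsetI) simp_all
    also have "\<dots> = a" using a by (intro measure_cdf_le)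
    also have "measure M R \<le> measure M (space M - {x. ?F x < b})"
      using b(3) by (intro finite_measure_mono subsetI) (simp_all add: not_less)
    also have "\<dots> = 1 - b" using b by (subst prob_compl) (auto simp: measure_cdf_less)
    finally have "b - a \<le> measure M ?I" by simp
    then have "D * (b - a) \<le> D * measure M ?I" using D by simp
    with 2 3 show ?thesis by (simp add: algebra_simps)
  qed
qed

end

end

section \<open>Azuma's inequality given the past\<close>

text \<open>Hoeffding's lemma for a centred Bernoulli variable. The auxiliary bound covers
  nonnegative exponents only; exchanging success and failure reduces a negative \<theta> to
  it.\<close>

lemma bernoulli_mgf_le:
  fixes p \<theta> :: real assumes "0 \<le> p" "p \<le> 1"
  shows "p * exp (\<theta> * (1 - p)) + (1 - p) * exp (- \<theta> * p) \<le> exp (\<theta>\<^sup>2 / 8)"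
proof -
  have *: "p * exp (h * (1 - p)) + (1 - p) * exp (- h * p) \<le> exp (h\<^sup>2 / 8)"
    if "0 \<le> h" "0 \<le> p" "p \<le> 1" for h p :: real
  proof -
    have "p * exp (h * (1 - p)) + (1 - p) * exp (- h * p) = exp (- h * p) * (1 + p * (exp h - 1))"
      by (simp add: algebra_simps flip: exp_add)
    moreover have "0 < 1 + p * (exp h - 1)" using that by (simp add: add_pos_nonneg)
    ultimately have "p * exp (h * (1 - p)) + (1 - p) * exp (- h * p) = exp (- h * p + ln (1 + p * (exp h - 1)))"
      by (simp only: exp_add exp_ln)
    then show ?thesis using Hoeffdings_lemma_aux[OF that(1,2)] by simp
  qed
  show ?thesis
  proof (cases "0 \<le> \<theta>")
    case False
    then show ?thesis using *[of "- \<theta>" "1 - p"] assms by (simp add: algebra_simps)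
  qed (use * assms in auto)
qed

lemma (in prob_space) nn_integral_centered_indicator_mgf:
  assumes A: "A \<in> events"
  shows "(\<integral>\<^sup>+x. ennreal (exp (\<theta> * (indicator A x - prob A))) \<partial>M) \<le> ennreal (exp (\<theta>\<^sup>2 / 8))"
proof -
  have "(\<integral>\<^sup>+x. ennreal (exp (\<theta> * (indicator A x - prob A))) \<partial>M)
     = (\<integral>\<^sup>+x. ennreal (exp (\<theta> * (1 - prob A))) * indicator A x
          + ennreal (exp (- \<theta> * prob A)) * indicator (space M - A) x \<partial>M)"
    by (intro nn_integral_cong) (auto simp: indicator_def algebra_simps)
  also have "\<dots> = ennreal (exp (\<theta> * (1 - prob A))) * emeasure M A
     + ennreal (exp (- \<theta> * prob A)) * emeasure M (space M - A)"
    using A by (subst nn_integral_add) (auto simp: nn_integral_cmult)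
  also have "\<dots> = ennreal (prob A * exp (\<theta> * (1 - prob A)) + (1 - prob A) * exp (- \<theta> * prob A))"
    using A by (simp add: emeasure_eq_measure prob_compl ennreal_mult ennreal_plus mult.commute)
  also have "\<dots> \<le> ennreal (exp (\<theta>\<^sup>2 / 8))"
    by (intro ennreal_leI bernoulli_mgf_le) auto
  finally show ?thesis .
qed

section \<open>The filtration and the law of the next observation\<close>

context change_point_model
begin

sublocale F1: real_distribution F1 by (rule F1_distribution)

text \<open>The randomizers \<open>U\<close> are revealed in advance, so that each step only integrates over the next
  observation.\<close>

definition past :: "nat \<Rightarrow> 'a measure" where
  "past N = sigma (space M) (\<Union>i\<in>Inl ` {1..N} \<union> Inr ` {1..}.
     {case_sum X U i -` A \<inter> space M | A. A \<in> sets borel})"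

lemma case_sum_measurable: "i \<in> {1..} <+> {1..} \<Longrightarrow> case_sum X U i \<in> borel_measurable M"
  using independent unfolding indep_vars_def by auto

lemma X_measurable: "1 \<le> i \<Longrightarrow> X i \<in> borel_measurable M"
  using case_sum_measurable[of "Inl i"] by auto

lemma U_measurable: "1 \<le> i \<Longrightarrow> U i \<in> borel_measurable M"
  using case_sum_measurable[of "Inr i"] by auto

lemma space_past [simp]: "space (past N) = space M"
  unfolding past_def by (rule space_measure_of) auto

lemma sets_past: "sets (past N) = sigma_sets (space M) (\<Union>i\<in>Inl ` {1..N} \<union> Inr ` {1..}.
     {case_sum X U i -` A \<inter> space M | A. A \<in> sets borel})"
  unfolding past_def by (rule sets_measure_of) auto

lemma sets_past_mono: "m \<le> n \<Longrightarrow> sets (past m) \<subseteq> sets (past n)"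
  unfolding sets_past by (intro sigma_sets_mono' UN_mono) auto

lemma sets_past_le: "sets (past N) \<subseteq> sets M"
  unfolding sets_past
proof (intro sets.sigma_sets_subset UN_least subsetI)
  fix i S assume i: "i \<in> Inl ` {1..N} \<union> Inr ` {1::nat..}"
    and "S \<in> {case_sum X U i -` A \<inter> space M | A. A \<in> sets borel}"
  then obtain A where "S = case_sum X U i -` A \<inter> space M" "A \<in> sets borel" by blast
  moreover have "i \<in> {1..} <+> {1..}" using i by (elim UnE imageE) (simp_all add: InlI InrI)
  ultimately show "S \<in> sets M" using measurable_sets[OF case_sum_measurable] by blast
qed

lemma measurable_pastI:
  assumes "i \<in> Inl ` {1..N} \<union> Inr ` {1..}"
  shows "case_sum X U i \<in> borel_measurable (past N)"
proof (rule measurableI)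
  fix A :: "real set" assume "A \<in> sets borel"
  then show "case_sum X U i -` A \<inter> space (past N) \<in> sets (past N)"
    unfolding sets_past space_past using \<open>A \<in> sets borel\<close>
    by (intro sigma_sets.Basic UN_I[OF assms]) (simp, rule exI[of _ A], simp)
qed simp

lemma X_measurable_past: "1 \<le> i \<Longrightarrow> i \<le> N \<Longrightarrow> X i \<in> borel_measurable (past N)"
  using measurable_pastI[of "Inl i" N] by auto

lemma U_measurable_past: "1 \<le> i \<Longrightarrow> U i \<in> borel_measurable (past N)"
  using measurable_pastI[of "Inr i" N] by auto

lemma space_hist [simp]: "space (hist M X U n) = space M"
  unfolding hist_def by (rule space_measure_of) auto

lemma sets_hist: "sets (hist M X U n) = sigma_sets (space M)
     (\<Union>i\<in>{1..n}. {X i -` A \<inter> space M | A. A \<in> sets borel} \<union> {U i -` A \<inter> space M | A. A \<in> sets borel})"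
  unfolding hist_def by (rule sets_measure_of) auto

lemma sets_hist_le_past: "sets (hist M X U n) \<subseteq> sets (past n)"
proof -
  have "S \<in> sets (past n)"
    if i: "i \<in> {1..n}" and S: "S \<in> {X i -` A \<inter> space M | A. A \<in> sets borel} \<union> {U i -` A \<inter> space M | A. A \<in> sets borel}"
    for i S
  proof -
    from S obtain Y A where "Y = X i \<or> Y = U i" "S = Y -` A \<inter> space M" "A \<in> sets borel" by blast
    moreover have "X i \<in> borel_measurable (past n)" "U i \<in> borel_measurable (past n)"
      using i by (simp_all add: X_measurable_past U_measurable_past)
    ultimately show ?thesis using measurable_sets[of _ "past n" borel A] by fastforce
  qed
  then show ?thesis
    unfolding sets_hist space_past[of n, symmetric]
    by (intro sets.sigma_sets_subset UN_least subsetI) blast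
qed

lemma subalgebra_hist: "subalgebra M (hist M X U n)"
  using sets_hist_le_past[of n] sets_past_le[of n] by (auto simp: subalgebra_def)

lemma X_measurable_hist: "1 \<le> i \<Longrightarrow> i \<le> n \<Longrightarrow> X i \<in> borel_measurable (hist M X U n)"
proof (rule measurableI)
  fix A :: "real set" assume "A \<in> sets borel" "1 \<le> i" "i \<le> n"
  then show "X i -` A \<inter> space (hist M X U n) \<in> sets (hist M X U n)"
    unfolding sets_hist space_hist
    by (intro sigma_sets.Basic UN_I[of i] UnI1 CollectI exI[of _ A] conjI refl) simp_all
qed simp

lemma U_measurable_hist: "1 \<le> i \<Longrightarrow> i \<le> n \<Longrightarrow> U i \<in> borel_measurable (hist M X U n)"
proof (rule measurableI)
  fix A :: "real set" assume "A \<in> sets borel" "1 \<le> i" "i \<le> n"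
  then show "U i -` A \<inter> space (hist M X U n) \<in> sets (hist M X U n)"
    unfolding sets_hist space_hist
    by (intro sigma_sets.Basic UN_I[of i] UnI2 CollectI exI[of _ A] conjI refl) simp_all
qed simp

lemma id_measurable_past: "(\<lambda>\<omega>. \<omega>) \<in> measurable M (past N)"
  using sets_past_le[of N] by (intro measurableI) (auto simp: Int_absorb2 sets.sets_into_space)

lemma id_past_measurable_past: "m \<le> n \<Longrightarrow> (\<lambda>\<omega>. \<omega>) \<in> measurable (past n) (past m)"
  using sets_past_mono[of m n] sets_past_le[of m]
  by (intro measurableI) (auto simp: Int_absorb2 sets.sets_into_space)

text \<open>The indices generating the past and the index of \<open>X (Suc N)\<close> form disjoint
  blocks of an independent family, and disjoint blocks generate independent sigma-algebras. All
  randomizers, also the future ones, sit in the first block.\<close>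

lemma indep_past_next:
  "indep_set (sets (past N)) (sigma_sets (space M) {X (Suc N) -` A \<inter> space M | A. A \<in> sets borel})"
proof -
  define I where "I b = (if b then Inl ` {1..N} \<union> Inr ` {1..} else {Inl (Suc N)} :: (nat + nat) set)" for b
  define E where "E i = {case_sum X U i -` A \<inter> space M | A. A \<in> sets borel}" for i
  have "indep_sets (\<lambda>b. sigma_sets (space M) (\<Union>i\<in>I b. E i)) UNIV"
  proof (rule indep_sets_collect_sigma)
    have "indep_sets E ({1..} <+> {1..})"
      using independent unfolding indep_vars_def2 E_def by simp
    then show "indep_sets E (\<Union>b. I b)"
      by (rule indep_sets_mono_index[rotated]) (auto simp: I_def split: if_splits)
    show "Int_stable (E i)" for i
      unfolding E_def Int_stable_def
    proof safe
      fix A B :: "real set" assume "A \<in> sets borel" "B \<in> sets borel"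
      then show "\<exists>C. case_sum X U i -` A \<inter> space M \<inter> (case_sum X U i -` B \<inter> space M)
          = case_sum X U i -` C \<inter> space M \<and> C \<in> sets borel"
        by (intro exI[of _ "A \<inter> B"]) auto
    qed
    show "disjoint_family_on I UNIV"
      by (auto simp: disjoint_family_on_def I_def)
  qed
  then have ind: "indep_set (sigma_sets (space M) (\<Union>i\<in>I True. E i)) (sigma_sets (space M) (\<Union>i\<in>I False. E i))"
    unfolding indep_set_def by (rule indep_sets_cong[THEN iffD1, rotated 2]) (auto split: bool.split)
  have 1: "sigma_sets (space M) (\<Union>i\<in>I True. E i) = sets (past N)"
    unfolding sets_past I_def E_def by simp
  have 3: "sigma_sets (space M) (\<Union>i\<in>I False. E i)
     = sigma_sets (space M) {X (Suc N) -` A \<inter> space M | A. A \<in> sets borel}"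
    by (simp add: I_def E_def)
  show ?thesis using ind unfolding 1 3 .
qed

text \<open>The freezing lemma. The identity, viewed as a random element of the sample space
  equipped with \<open>past N\<close>, is independent of \<open>X (Suc N)\<close>; the joint law is
  therefore a product with F1 as second factor, and Tonelli's theorem integrates out the new
  observation.\<close>

lemma nn_integral_next:
  assumes f: "f \<in> borel_measurable (past N \<Otimes>\<^sub>M borel)" and N: "tau \<le> N"
  shows "(\<integral>\<^sup>+\<omega>. f (\<omega>, X (Suc N) \<omega>) \<partial>M) = (\<integral>\<^sup>+\<omega>. (\<integral>\<^sup>+x. f (\<omega>, x) \<partial>F1) \<partial>M)"
proof -
  have m: "(\<lambda>\<omega>. (\<omega>, X (Suc N) \<omega>)) \<in> measurable M (past N \<Otimes>\<^sub>M borel)"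
    using id_measurable_past X_measurable[of "Suc N"] by (intro measurable_Pair) auto
  have d: "distr M (past N) (\<lambda>\<omega>. \<omega>) \<Otimes>\<^sub>M F1
     = distr M (past N \<Otimes>\<^sub>M borel) (\<lambda>\<omega>. (\<omega>, X (Suc N) \<omega>))"
  proof (rule pair_measure_eqI)
    show "sigma_finite_measure (distr M (past N) (\<lambda>\<omega>. \<omega>))"
      using prob_space_distr[OF id_measurable_past] by (intro finite_measure.axioms(1) prob_space.finite_measure)
    show "sigma_finite_measure F1" by unfold_locales
    show "sets (distr M (past N) (\<lambda>\<omega>. \<omega>) \<Otimes>\<^sub>M F1)
      = sets (distr M (past N \<Otimes>\<^sub>M borel) (\<lambda>\<omega>. (\<omega>, X (Suc N) \<omega>)))"
      by (simp cong: sets_pair_measure_cong)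
    fix A B assume A: "A \<in> sets (distr M (past N) (\<lambda>\<omega>. \<omega>))" and B: "B \<in> sets F1"
    then have A': "A \<in> sets (past N)" and B': "B \<in> sets borel" by auto
    have AM: "A \<in> sets M" using A' sets_past_le by auto
    have "prob (A \<inter> (X (Suc N) -` B \<inter> space M)) = prob A * prob (X (Suc N) -` B \<inter> space M)"
      using A' B' by (intro indep_setD[OF indep_past_next]) (auto intro: sigma_sets.Basic)
    moreover have "measure F1 B = prob (X (Suc N) -` B \<inter> space M)"
      using post_change_law[of "Suc N"] N B' X_measurable[of "Suc N"] by (metis le_imp_less_Suc le_add1 measure_distr plus_1_eq_Suc)
    moreover have "emeasure (distr M (past N) (\<lambda>\<omega>. \<omega>)) A = prob A"
      using A' AM sets.sets_into_space[OF AM]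
      by (simp add: emeasure_distr[OF id_measurable_past] emeasure_eq_measure Int_absorb2)
    moreover have "emeasure (distr M (past N \<Otimes>\<^sub>M borel) (\<lambda>\<omega>. (\<omega>, X (Suc N) \<omega>))) (A \<times> B)
       = prob (A \<inter> (X (Suc N) -` B \<inter> space M))"
      using A' B' sets.sets_into_space[OF AM]
      by (subst emeasure_distr[OF m]) (auto simp: emeasure_eq_measure intro!: arg_cong[where f=prob])
    ultimately show "emeasure (distr M (past N) (\<lambda>\<omega>. \<omega>)) A * emeasure F1 B
       = emeasure (distr M (past N \<Otimes>\<^sub>M borel) (\<lambda>\<omega>. (\<omega>, X (Suc N) \<omega>))) (A \<times> B)"
      by (simp add: F1.emeasure_eq_measure ennreal_mult)
  qed
  have f': "f \<in> borel_measurable (distr M (past N) (\<lambda>\<omega>. \<omega>) \<Otimes>\<^sub>M F1)"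
    using f unfolding d by simp
  have "(\<integral>\<^sup>+\<omega>. f (\<omega>, X (Suc N) \<omega>) \<partial>M) = (\<integral>\<^sup>+z. f z \<partial>distr M (past N \<Otimes>\<^sub>M borel) (\<lambda>\<omega>. (\<omega>, X (Suc N) \<omega>)))"
    using f m by (subst nn_integral_distr) auto
  also have "\<dots> = (\<integral>\<^sup>+\<omega>. (\<integral>\<^sup>+x. f (\<omega>, x) \<partial>F1) \<partial>distr M (past N) (\<lambda>\<omega>. \<omega>))"
    unfolding d[symmetric] by (rule F1.nn_integral_fst[OF f', symmetric])
  also have "\<dots> = (\<integral>\<^sup>+\<omega>. (\<integral>\<^sup>+x. f (\<omega>, x) \<partial>F1) \<partial>M)"
  proof (rule nn_integral_distr[OF id_measurable_past])
    have "f \<in> borel_measurable (past N \<Otimes>\<^sub>M F1)"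
      using f by (simp cong: measurable_cong_sets sets_pair_measure_cong)
    from F1.borel_measurable_nn_integral_fst[OF this]
    show "(\<lambda>\<omega>. \<integral>\<^sup>+x. f (\<omega>, x) \<partial>F1) \<in> borel_measurable (distr M (past N) (\<lambda>\<omega>. \<omega>))" by simp
  qed
  finally show ?thesis .
qed

text \<open>For a set C measurable with respect to \<open>past N\<close> and the next observation,
  with tau \<le> N, this is a version of the conditional probability given \<open>past N\<close>
  that the pair falls into C. The centred indicator \<open>increment\<close> is thus a martingale
  difference.\<close>

definition next_mass :: "('a \<times> real) set \<Rightarrow> 'a \<Rightarrow> real" where
  "next_mass C \<omega> = measure F1 (Pair \<omega> -` C)"

definition increment :: "nat \<Rightarrow> (nat \<Rightarrow> ('a \<times> real) set) \<Rightarrow> nat \<Rightarrow> 'a \<Rightarrow> real" where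
  "increment n C i \<omega> = indicator (C i) (\<omega>, X (Suc (n + i)) \<omega>) - next_mass (C i) \<omega>"

lemma next_mass_measurable:
  assumes "C \<in> sets (past N \<Otimes>\<^sub>M borel)"
  shows "next_mass C \<in> borel_measurable (past N)"
proof -
  have "C \<in> sets (past N \<Otimes>\<^sub>M F1)"
    using assms by (simp cong: sets_pair_measure_cong)
  from F1.measurable_emeasure_Pair[OF this] show ?thesis
    unfolding next_mass_def measure_def by simp
qed

lemma increment_measurable:
  assumes C: "C i \<in> sets (past (n + i) \<Otimes>\<^sub>M borel)" and i: "i < m"
  shows "increment n C i \<in> borel_measurable (past (n + m))"
proof -
  have [measurable]: "(\<lambda>\<omega>. \<omega>) \<in> measurable (past (n + m)) (past (n + i))"
    using i by (intro id_past_measurable_past) simp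
  have [measurable]: "X (Suc (n + i)) \<in> borel_measurable (past (n + m))"
    using i by (intro X_measurable_past) auto
  have [measurable]: "next_mass (C i) \<in> borel_measurable (past (n + m))"
    using measurable_compose[OF \<open>(\<lambda>\<omega>. \<omega>) \<in> measurable (past (n + m)) (past (n + i))\<close> next_mass_measurable[OF C]] .
  note C[measurable]
  have [measurable]: "(\<lambda>\<omega>. indicator (C i) (\<omega>, X (Suc (n + i)) \<omega>) :: real) \<in> borel_measurable (past (n + m))"
    by (rule measurable_compose[OF measurable_Pair borel_measurable_indicator[OF C]]) measurable
  show ?thesis unfolding increment_def by measurable
qed

text \<open>Induction from the last step backwards: with the past frozen, the newest factor
  integrates to at most exp(\<theta>^2 / 8) by Hoeffding's lemma. The indicator of \<open>B\<close>
  stays frozen throughout and ends up as the factor \<open>emeasure M B\<close>.\<close>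

lemma azuma_mgf:
  assumes n: "tau \<le> n" and C: "\<And>i. C i \<in> sets (past (n + i) \<Otimes>\<^sub>M borel)" and B: "B \<in> sets (past n)"
  shows "(\<integral>\<^sup>+\<omega>. indicator B \<omega> * ennreal (exp (\<theta> * (\<Sum>i<m. increment n C i \<omega>))) \<partial>M)
    \<le> ennreal (exp (real m * (\<theta>\<^sup>2 / 8))) * emeasure M B"
proof (induction m)
  case 0
  have "B \<in> sets M" using B sets_past_le by auto
  then show ?case by (simp add: nn_integral_indicator)
next
  case (Suc m)
  define g where "g \<omega> = indicator B \<omega> * ennreal (exp (\<theta> * (\<Sum>i<m. increment n C i \<omega>)))" for \<omega>
  define f where "f = (\<lambda>(\<omega>, x). g \<omega> * ennreal (exp (\<theta> * (indicator (C m) (\<omega>, x) - next_mass (C m) \<omega>))))"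
  have Bm: "B \<in> sets (past (n + m))" using B sets_past_mono[of n "n + m"] by auto
  note increment_measurable[OF C, measurable] next_mass_measurable[OF C, measurable] C[measurable] Bm[measurable]
  have g[measurable]: "g \<in> borel_measurable (past (n + m))"
  proof -
    have "(\<lambda>\<omega>. \<Sum>i<m. increment n C i \<omega>) \<in> borel_measurable (past (n + m))"
      by (intro borel_measurable_sum increment_measurable[OF C]) auto
    then show ?thesis unfolding g_def by measurable
  qed
  have f: "f \<in> borel_measurable (past (n + m) \<Otimes>\<^sub>M borel)"
    unfolding f_def case_prod_beta by measurable
  have "(\<integral>\<^sup>+\<omega>. indicator B \<omega> * ennreal (exp (\<theta> * (\<Sum>i<Suc m. increment n C i \<omega>))) \<partial>M)
     = (\<integral>\<^sup>+\<omega>. f (\<omega>, X (Suc (n + m)) \<omega>) \<partial>M)"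
    by (intro nn_integral_cong)
       (simp add: f_def g_def increment_def[of n C m] distrib_left exp_add ennreal_mult mult.assoc)
  also have "\<dots> = (\<integral>\<^sup>+\<omega>. (\<integral>\<^sup>+x. f (\<omega>, x) \<partial>F1) \<partial>M)"
    using n by (intro nn_integral_next[OF f]) simp
  also have "\<dots> \<le> (\<integral>\<^sup>+\<omega>. ennreal (exp (\<theta>\<^sup>2 / 8)) * g \<omega> \<partial>M)"
  proof (intro nn_integral_mono)
    fix \<omega> assume "\<omega> \<in> space M"
    have Cs: "Pair \<omega> -` C m \<in> sets F1" using sets_Pair1[OF C[of m]] by simp
    have "(\<integral>\<^sup>+x. f (\<omega>, x) \<partial>F1)
       = g \<omega> * (\<integral>\<^sup>+x. ennreal (exp (\<theta> * (indicator (Pair \<omega> -` C m) x - measure F1 (Pair \<omega> -` C m)))) \<partial>F1)"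
    proof (subst nn_integral_cmult[symmetric])
      show "(\<lambda>x. ennreal (exp (\<theta> * (indicator (Pair \<omega> -` C m) x - measure F1 (Pair \<omega> -` C m)))))
          \<in> borel_measurable F1"
        using Cs by measurable
    qed (simp add: f_def next_mass_def indicator_def)
    also have "\<dots> \<le> g \<omega> * ennreal (exp (\<theta>\<^sup>2 / 8))"
      by (intro mult_left_mono F1.nn_integral_centered_indicator_mgf Cs) auto
    finally show "(\<integral>\<^sup>+x. f (\<omega>, x) \<partial>F1) \<le> ennreal (exp (\<theta>\<^sup>2 / 8)) * g \<omega>" by (simp add: mult.commute)
  qed
  also have "\<dots> = ennreal (exp (\<theta>\<^sup>2 / 8)) * (\<integral>\<^sup>+\<omega>. g \<omega> \<partial>M)"
    using measurable_compose[OF id_measurable_past g] by (intro nn_integral_cmult) simp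
  also have "\<dots> \<le> ennreal (exp (\<theta>\<^sup>2 / 8)) * (ennreal (exp (real m * (\<theta>\<^sup>2 / 8))) * emeasure M B)"
    using Suc.IH unfolding g_def by (intro mult_left_mono) auto
  also have "\<dots> = ennreal (exp (real (Suc m) * (\<theta>\<^sup>2 / 8))) * emeasure M B"
  proof -
    have "exp (\<theta>\<^sup>2 / 8) * exp (real m * (\<theta>\<^sup>2 / 8)) = exp (real (Suc m) * (\<theta>\<^sup>2 / 8))"
      unfolding exp_add[symmetric] by (simp add: algebra_simps)
    then show ?thesis by (simp add: ennreal_mult' flip: mult.assoc ennreal_mult'')
  qed
  finally show ?case .
qed

lemma azuma_one_sided:
  assumes n: "tau \<le> n" and C: "\<And>i. C i \<in> sets (past (n + i) \<Otimes>\<^sub>M borel)" and B: "B \<in> sets (past n)"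
    and x: "0 \<le> x" and s: "\<bar>s\<bar> = (1::real)"
  shows "prob {\<omega>\<in>B. real m * x < s * (\<Sum>i<m. increment n C i \<omega>)} \<le> exp (- 2 * real m * x\<^sup>2) * prob B"
proof -
  have BM: "B \<in> sets M" using B sets_past_le by auto
  \<comment> \<open>The optimal Chernoff parameter: it minimizes m \<theta>^2 / 8 - |\<theta>| m x,
    with minimum - 2 m x^2.\<close>
  define \<theta> where "\<theta> = 4 * x * s"
  have s2: "s\<^sup>2 = 1" using s by (metis power2_abs one_power2)
  let ?S = "\<lambda>\<omega>. \<Sum>i<m. increment n C i \<omega>"
  let ?c = "ennreal (exp (- 4 * real m * x\<^sup>2))"
  have "?S \<in> borel_measurable (past (n + m))"
    by (intro borel_measurable_sum increment_measurable[OF C]) auto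
  from measurable_compose[OF id_measurable_past this]
  have S[measurable]: "?S \<in> borel_measurable M" by simp
  have sub: "{\<omega>\<in>B. real m * x < s * ?S \<omega>} = B \<inter> {\<omega>\<in>space M. real m * x < s * ?S \<omega>}"
    using sets.sets_into_space[OF BM] by auto
  have "emeasure M {\<omega>\<in>B. real m * x < s * ?S \<omega>}
     = (\<integral>\<^sup>+\<omega>. indicator {\<omega>\<in>B. real m * x < s * ?S \<omega>} \<omega> \<partial>M)"
    unfolding sub by (intro nn_integral_indicator[symmetric] sets.Int BM) measurable
  also have "\<dots> \<le> (\<integral>\<^sup>+\<omega>. ?c * (indicator B \<omega> * ennreal (exp (\<theta> * ?S \<omega>))) \<partial>M)"
  proof (intro nn_integral_mono)
    fix \<omega>
    show "indicator {\<omega>\<in>B. real m * x < s * ?S \<omega>} \<omega> \<le> ?c * (indicator B \<omega> * ennreal (exp (\<theta> * ?S \<omega>)))"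
    proof (cases "\<omega> \<in> B \<and> real m * x < s * ?S \<omega>")
      case True
      then have "4 * x * (real m * x) \<le> 4 * x * (s * ?S \<omega>)" using x by (intro mult_left_mono) auto
      then have "1 \<le> exp (- 4 * real m * x\<^sup>2) * exp (\<theta> * ?S \<omega>)"
        by (simp add: \<theta>_def power2_eq_square algebra_simps flip: exp_add)
      then show ?thesis using True by (simp flip: ennreal_mult)
    qed (auto simp: indicator_def)
  qed
  also have "\<dots> = ?c * (\<integral>\<^sup>+\<omega>. indicator B \<omega> * ennreal (exp (\<theta> * ?S \<omega>)) \<partial>M)"
  proof (rule nn_integral_cmult)
    have "(\<lambda>\<omega>. indicator B \<omega> * ennreal (exp (\<theta> * T \<omega>))) \<in> borel_measurable M"
      if "T \<in> borel_measurable M" for T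
      using that BM by measurable
    from this[OF S] show "(\<lambda>\<omega>. indicator B \<omega> * ennreal (exp (\<theta> * ?S \<omega>))) \<in> borel_measurable M" .
  qed
  also have "\<dots> \<le> ?c * (ennreal (exp (real m * (\<theta>\<^sup>2 / 8))) * emeasure M B)"
    by (intro mult_left_mono azuma_mgf n C B) auto
  also have "\<dots> = ennreal (exp (- 2 * real m * x\<^sup>2) * prob B)"
    by (simp add: emeasure_eq_measure \<theta>_def power_mult_distrib s2 flip: ennreal_mult mult.assoc exp_add)
  finally show ?thesis by (simp add: emeasure_eq_measure)
qed

lemma azuma:
  assumes "tau \<le> n" and "\<And>i. C i \<in> sets (past (n + i) \<Otimes>\<^sub>M borel)" and "B \<in> sets (past n)"
    and "0 \<le> x"
  shows "{\<omega>\<in>B. real m * x < \<bar>\<Sum>i<m. increment n C i \<omega>\<bar>} \<in> events"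
    and "prob {\<omega>\<in>B. real m * x < \<bar>\<Sum>i<m. increment n C i \<omega>\<bar>} \<le> 2 * exp (- 2 * real m * x\<^sup>2) * prob B"
proof -
  let ?S = "\<lambda>\<omega>. \<Sum>i<m. increment n C i \<omega>"
  have BM: "B \<in> sets M" using assms sets_past_le by auto
  have "?S \<in> borel_measurable (past (n + m))"
    by (intro borel_measurable_sum increment_measurable[OF assms(2)]) auto
  from measurable_compose[OF id_measurable_past this]
  have S[measurable]: "?S \<in> borel_measurable M" by simp
  have ev: "{\<omega>\<in>B. P (?S \<omega>)} \<in> events" if "Measurable.pred borel P" for P
  proof -
    have "{\<omega>\<in>B. P (?S \<omega>)} = B \<inter> {\<omega>\<in>space M. P (?S \<omega>)}" using sets.sets_into_space[OF BM] by auto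
    also have "\<dots> \<in> events" using that BM by measurable
    finally show ?thesis .
  qed
  show "{\<omega>\<in>B. real m * x < \<bar>?S \<omega>\<bar>} \<in> events" by (rule ev) measurable
  have "prob {\<omega>\<in>B. real m * x < \<bar>?S \<omega>\<bar>}
     \<le> prob ({\<omega>\<in>B. real m * x < 1 * ?S \<omega>} \<union> {\<omega>\<in>B. real m * x < (-1) * ?S \<omega>})"
    by (intro finite_measure_mono sets.Un ev) auto
  also have "\<dots> \<le> prob {\<omega>\<in>B. real m * x < 1 * ?S \<omega>} + prob {\<omega>\<in>B. real m * x < (-1) * ?S \<omega>}"
    by (intro measure_Un_le ev) auto
  also have "\<dots> \<le> exp (- 2 * real m * x\<^sup>2) * prob B + exp (- 2 * real m * x\<^sup>2) * prob B"
    by (intro add_mono azuma_one_sided assms) auto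
  finally show "prob {\<omega>\<in>B. real m * x < \<bar>?S \<omega>\<bar>} \<le> 2 * exp (- 2 * real m * x\<^sup>2) * prob B"
    by (simp add: algebra_simps)
qed

end

section \<open>Interval discrepancy\<close>

lemma pi_sq_ge: "9 \<le> (pi::real)\<^sup>2"
proof -
  have "3\<^sup>2 \<le> (pi::real)\<^sup>2" using pi_gt3 by (intro power_mono) auto
  then show ?thesis by simp
qed

context
  fixes eta :: real and k :: nat
  assumes eta: "0 < eta" "eta < 1" and k: "1 \<le> k"
begin

lemma lam_arg_ge: "6 * (real k)\<^sup>2 \<le> 2 * pi\<^sup>2 * (real k)\<^sup>2 / (3 * eta)"
proof -
  have "6 * (3 * eta) \<le> 2 * pi\<^sup>2 * 1" using pi_sq_ge eta by simp
  then have "6 \<le> 2 * pi\<^sup>2 / (3 * eta)" using eta by (simp add: field_simps)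
  from mult_right_mono[OF this, of "(real k)\<^sup>2"] show ?thesis by simp
qed

text \<open>Nonnegativity already makes the square root in \<open>lam\<close> genuine; the stronger
  bound 1 forces k > 2 whenever 2 \<open>lam\<close> is below 1, which the grid estimate
  exploits.\<close>

lemma lam_log_ge_1: "1 \<le> ln (2 * pi\<^sup>2 * (real k)\<^sup>2 / (3 * eta))"
proof -
  have "exp 1 \<le> (3::real)" using exp_le by simp
  also have "3 \<le> 6 * (real k)\<^sup>2" using k by (simp add: one_le_power order_trans[of 3 "6 * 1"])
  also note lam_arg_ge
  finally show ?thesis using eta k by (subst ln_ge_iff) auto
qed

lemma lam_sq: "2 * real k * (lam eta k)\<^sup>2 = ln (2 * pi\<^sup>2 * (real k)\<^sup>2 / (3 * eta))"
  using k lam_log_ge_1 by (simp add: lam_def)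

lemma lam_nonneg: "0 \<le> lam eta k"
  using lam_log_ge_1 by (auto simp: lam_def intro!: divide_nonneg_nonneg)

lemma exp_lam_sq: "exp (- (2 * real k * (lam eta k)\<^sup>2)) = 3 * eta / (2 * pi\<^sup>2 * (real k)\<^sup>2)"
  unfolding lam_sq exp_minus using eta k by (subst exp_ln) auto

text \<open>Since the deviation of an interval may be as large as \<open>2\<lambda>\<^sub>k\<close>, its Hoeffding bound is the fourth
  power of that of \<open>\<lambda>\<^sub>k\<close>, which pays for a union bound over the \<open>O(k\<^sup>2)\<close> grid intervals.\<close>

lemma grid_union_bound:
  assumes small: "2 * lam eta k < 1"
  shows "1 / real (4 * k) \<le> lam eta k"
    and "(real (4 * k + 2))\<^sup>2 * (2 * exp (- 2 * real k * (2 * lam eta k - 2 / real (4 * k))\<^sup>2))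
      \<le> 3 * eta / (pi\<^sup>2 * (real k)\<^sup>2)"
proof -
  let ?l = "lam eta k"
  define e where "e = 3 * eta / (2 * pi\<^sup>2 * (real k)\<^sup>2)"
  have e: "0 < e" "e \<le> 1 / (6 * (real k)\<^sup>2)"
    using eta k lam_arg_ge by (auto simp: e_def field_simps)
  \<comment> \<open>From 1 \<le> 2 k lam^2 and 4 lam^2 < 1 it follows that k > 2.\<close>
  have "(2 * ?l)\<^sup>2 < 1\<^sup>2" using small lam_nonneg by (intro power_strict_mono) auto
  then have "2 * real k * (?l)\<^sup>2 < real k / 2" using k by (simp add: power_mult_distrib)
  then have "2 < real k" using lam_sq lam_log_ge_1 by linarith
  have l2: "1 \<le> 2 * real k * ?l\<^sup>2" using lam_sq lam_log_ge_1 by simp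
  show "1 / real (4 * k) \<le> ?l"
  proof (rule power2_le_imp_le[OF _ lam_nonneg])
    have "1 / (real (4 * k))\<^sup>2 \<le> 1 / (2 * real k)"
      using k by (simp add: field_simps power2_eq_square)
    also have "\<dots> \<le> ?l\<^sup>2" using l2 k by (simp add: field_simps)
    finally show "(1 / real (4 * k))\<^sup>2 \<le> ?l\<^sup>2" by (simp add: power_divide)
  qed
  \<comment> \<open>Expanding the square, the mixed term is 4 lam < 2. Shrinking the radius by two
    grid cells thus costs only the factor exp 2 in probability.\<close>
  have "2 * real k * (2 * ?l - 2 / real (4 * k))\<^sup>2 = 8 * real k * ?l\<^sup>2 - 4 * ?l + 1 / (2 * real k)"
    using k by (simp add: power2_eq_square field_simps)
  also have "\<dots> \<ge> 4 * (2 * real k * ?l\<^sup>2) - 2"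
  proof -
    have "0 \<le> 1 / (2 * real k)" by simp
    then show ?thesis using small by linarith
  qed
  finally have "exp (- 2 * real k * (2 * ?l - 2 / real (4 * k))\<^sup>2) \<le> exp (2 + of_nat 4 * (- (2 * real k * ?l\<^sup>2)))"
    by simp
  also have "\<dots> = exp 2 * e ^ 4"
    unfolding exp_add exp_of_nat_mult exp_lam_sq e_def ..
  finally have x: "exp (- 2 * real k * (2 * ?l - 2 / real (4 * k))\<^sup>2) \<le> exp 2 * e ^ 4" .
  have e9: "exp 2 \<le> (9::real)"
  proof -
    have "exp 2 = exp 1 * exp (1::real)" by (simp flip: exp_add)
    also have "\<dots> \<le> 3 * 3" using exp_le by (intro mult_mono) auto
    finally show ?thesis by simp
  qed
  \<comment> \<open>With 4 k + 2 \<le> 5 k and exp 2 \<le> 9 the total is at most 2 e times 225 k^2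
    e^3, and e \<le> 1 / (6 k^2) makes the second factor at most 1.\<close>
  have "(real (4 * k + 2))\<^sup>2 \<le> (5 * real k)\<^sup>2" using \<open>2 < real k\<close> by (intro power_mono) auto
  then have "(real (4 * k + 2))\<^sup>2 * (2 * exp (- 2 * real k * (2 * ?l - 2 / real (4 * k))\<^sup>2))
     \<le> (5 * real k)\<^sup>2 * (2 * (9 * e ^ 4))"
    using x e9 e by (intro mult_mono) (auto intro: order_trans mult_right_mono)
  also have "\<dots> = 2 * e * (225 * (real k)\<^sup>2 * e ^ 3)"
    by (simp add: power2_eq_square power3_eq_cube power4_eq_xxxx)
  also have "\<dots> \<le> 2 * e * 1"
  proof (intro mult_left_mono)
    have "225 * (real k)\<^sup>2 * e ^ 3 \<le> 225 * (real k)\<^sup>2 * (1 / (6 * (real k)\<^sup>2)) ^ 3"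
      using e by (intro mult_left_mono power_mono) auto
    also have "\<dots> = 225 / 216 / ((real k)\<^sup>2)\<^sup>2"
      using k by (simp add: field_simps power2_eq_square power3_eq_cube)
    also have "\<dots> \<le> 1"
    proof -
      have "2\<^sup>2 \<le> (real k)\<^sup>2" using \<open>2 < real k\<close> by (intro power_mono) auto
      then have "4\<^sup>2 \<le> ((real k)\<^sup>2)\<^sup>2" by (intro power_mono) auto
      then show ?thesis using k by (simp add: divide_le_eq)
    qed
    finally show "225 * (real k)\<^sup>2 * e ^ 3 \<le> 1" .
  qed (use e in auto)
  finally show "(real (4 * k + 2))\<^sup>2 * (2 * exp (- 2 * real k * (2 * ?l - 2 / real (4 * k))\<^sup>2))
      \<le> 3 * eta / (pi\<^sup>2 * (real k)\<^sup>2)" by (simp add: e_def)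
qed

end

text \<open>The last summand of \<open>a_bound\<close>: the radius at which the two-sided Azuma
  bounds of all J bins together cost exactly 3 eta / (pi^2 m^2).\<close>

definition azuma_radius :: "nat \<Rightarrow> real \<Rightarrow> nat \<Rightarrow> real" where
  "azuma_radius J eta m = sqrt (1 / (2 * real m) * ln (2 * real J * pi\<^sup>2 * (real m)\<^sup>2 / (3 * eta)))"

text \<open>The comparison with ln m / m serves a different purpose than the tail bound: it is the
  growth that makes the increment bound exceed any threshold.\<close>

lemma azuma_radius:
  assumes eta: "0 < eta" "eta < 1" and J: "1 \<le> J" and m: "1 \<le> m"
  shows "0 \<le> azuma_radius J eta m"
    and "ln (real m) / real m \<le> (azuma_radius J eta m)\<^sup>2"
    and "real J * (2 * exp (- 2 * real m * (azuma_radius J eta m)\<^sup>2)) = 3 * eta / (pi\<^sup>2 * (real m)\<^sup>2)"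
proof -
  let ?A = "2 * real J * pi\<^sup>2 * (real m)\<^sup>2 / (3 * eta)"
  have "6 * (real m)\<^sup>2 \<le> 2 * pi\<^sup>2 * (real m)\<^sup>2 / (3 * eta)" using lam_arg_ge[OF eta m] .
  also have "\<dots> \<le> real J * (2 * pi\<^sup>2 * (real m)\<^sup>2 / (3 * eta))"
  proof -
    have "1 * (2 * pi\<^sup>2 * (real m)\<^sup>2 / (3 * eta)) \<le> real J * (2 * pi\<^sup>2 * (real m)\<^sup>2 / (3 * eta))"
      using J eta by (intro mult_right_mono) auto
    then show ?thesis by simp
  qed
  also have "\<dots> = ?A" by simp
  finally have A: "6 * (real m)\<^sup>2 \<le> ?A" .
  have m2: "1 \<le> (real m)\<^sup>2" using m by simp
  have "1 \<le> ?A" using A m2 by linarith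
  then have l0: "0 \<le> ln ?A" by simp
  then show "0 \<le> azuma_radius J eta m"
    by (auto simp: azuma_radius_def intro!: divide_nonneg_nonneg)
  have sq: "(azuma_radius J eta m)\<^sup>2 = 1 / (2 * real m) * ln ?A"
    unfolding azuma_radius_def using l0 by (intro real_sqrt_pow2) (auto intro!: divide_nonneg_nonneg)
  have "2 * ln (real m) = ln ((real m)\<^sup>2)" using m by (simp add: ln_realpow)
  also have "\<dots> \<le> ln ?A" using A m2 by (intro ln_mono; linarith)
  finally show "ln (real m) / real m \<le> (azuma_radius J eta m)\<^sup>2"
    unfolding sq using m by (simp add: field_simps)
  have "- 2 * real m * (azuma_radius J eta m)\<^sup>2 = - ln ?A" unfolding sq using m by simp
  then have "exp (- 2 * real m * (azuma_radius J eta m)\<^sup>2) = inverse ?A"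
    using \<open>1 \<le> ?A\<close> by (simp only: exp_minus) (subst exp_ln, auto)
  then show "real J * (2 * exp (- 2 * real m * (azuma_radius J eta m)\<^sup>2)) = 3 * eta / (pi\<^sup>2 * (real m)\<^sup>2)"
    using J by simp
qed

lemma a_bound_eq:
  "a_bound J eta d m b =
     2 / real m * (\<Sum>i<m. real d / (real d + real i) * b
        + real i / (real d + real i) * lam eta i + 1 / (real d + real i + 1))
     + azuma_radius J eta m"
proof -
  have "(\<Sum>i = 1..m. real d / (real d + real i - 1) * b
        + (real i - 1) / (real d + real i - 1) * lam eta (i - 1) + 1 / (real d + real i))
    = (\<Sum>i<m. real d / (real d + real i) * b
        + real i / (real d + real i) * lam eta i + 1 / (real d + real i + 1))"
    by (rule sum.reindex_bij_witness[of _ Suc "\<lambda>i. i - 1"]) (auto simp: of_nat_diff algebra_simps)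
  then show ?thesis by (simp add: a_bound_def azuma_radius_def)
qed

context change_point_model
begin

lemma emp_dev_le_b_dev:
  assumes "1 \<le> d"
  shows "\<bar>1 / real d * (\<Sum>l = 1..d. of_bool (X l \<omega> \<le> x)) - cdf F1 x\<bar> \<le> b_dev F1 X d \<omega>"
  unfolding b_dev_def
proof (rule cSUP_upper)
  show "bdd_above (range (\<lambda>x. \<bar>1 / real d * (\<Sum>l = 1..d. of_bool (X l \<omega> \<le> x)) - cdf F1 x\<bar>))"
  proof (rule bdd_aboveI2[of _ _ 1])
    fix x
    have "(\<Sum>l = 1..d. of_bool (X l \<omega> \<le> x)) \<le> (\<Sum>l = 1..d. 1 :: real)" by (intro sum_mono) auto
    then have "1 / real d * (\<Sum>l = 1..d. of_bool (X l \<omega> \<le> x)) \<le> 1" using assms by (simp add: field_simps)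
    moreover have "0 \<le> 1 / real d * (\<Sum>l = 1..d. of_bool (X l \<omega> \<le> x))" by (simp add: sum_nonneg)
    ultimately show "\<bar>1 / real d * (\<Sum>l = 1..d. of_bool (X l \<omega> \<le> x)) - cdf F1 x\<bar> \<le> 1"
      using F1.cdf_nonneg[of x] F1.cdf_bounded_prob[of x] by linarith
  qed
qed simp

lemma b_dev_nonneg: "1 \<le> d \<Longrightarrow> 0 \<le> b_dev F1 X d \<omega>"
  using emp_dev_le_b_dev[of d \<omega> 0] by linarith

lemma emp_interval_le_b_dev:
  assumes d: "1 \<le> d" and xy: "x \<le> y"
  shows "\<bar>(\<Sum>l = 1..d. of_bool (x < X l \<omega> \<and> X l \<omega> \<le> y)) - real d * (cdf F1 y - cdf F1 x)\<bar>
    \<le> 2 * (real d * b_dev F1 X d \<omega>)"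
proof -
  let ?S = "\<lambda>x. (\<Sum>l = 1..d. of_bool (X l \<omega> \<le> x)) :: real"
  have 1: "\<bar>?S x - real d * cdf F1 x\<bar> \<le> real d * b_dev F1 X d \<omega>" for x
  proof -
    have "?S x - real d * cdf F1 x = real d * (1 / real d * ?S x - cdf F1 x)"
      using d by (simp add: algebra_simps)
    then show ?thesis
      using mult_left_mono[OF emp_dev_le_b_dev[OF d, of \<omega> x], of "real d"] by (simp add: abs_mult)
  qed
  have "(\<Sum>l = 1..d. of_bool (x < X l \<omega> \<and> X l \<omega> \<le> y)) = ?S y - ?S x"
    unfolding sum_subtractf[symmetric] using xy by (intro sum.cong) auto
  then have "(\<Sum>l = 1..d. of_bool (x < X l \<omega> \<and> X l \<omega> \<le> y)) - real d * (cdf F1 y - cdf F1 x)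
     = (?S y - real d * cdf F1 y) - (?S x - real d * cdf F1 x)" by (simp add: algebra_simps)
  then show ?thesis using 1[of x] 1[of y] by linarith
qed

text \<open>A quantile cell described through the distribution function, so that no quantile
  function has to be chosen and the F1-mass is read off from the levels, even where F1 is
  flat.\<close>

definition grid_set :: "nat \<Rightarrow> nat \<Rightarrow> nat \<Rightarrow> real set" where
  "grid_set k g h = {z. cdf F1 z < real h / real (4 * k)} - {z. cdf F1 z < real g / real (4 * k)}"

text \<open>The constant sections turn \<open>increment\<close> into the centred indicator of a
  fixed grid interval. The radius is short of 2 lam by two mesh widths, one for each endpoint of a
  general interval, and the indices reach 4 k + 1 because an upper endpoint may be rounded beyond
  level 1.\<close>

definition grid_bad :: "real \<Rightarrow> nat \<Rightarrow> nat \<Rightarrow> 'a set" where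
  "grid_bad eta n k = (\<Union>g\<le>4 * k + 1. \<Union>h\<le>4 * k + 1. {\<omega>\<in>space M.
     real k * (2 * lam eta k - 2 / real (4 * k))
       < \<bar>\<Sum>i<k. increment n (\<lambda>_. space M \<times> grid_set k g h) i \<omega>\<bar>})"

lemma cdf_F1_measurable [measurable]: "cdf F1 \<in> borel_measurable borel"
  using F1_continuous by (rule borel_measurable_continuous_onI)

lemma grid_set_sets: "grid_set k g h \<in> sets borel"
  unfolding grid_set_def by measurable

lemma const_section_sets: "space M \<times> grid_set k g h \<in> sets (past N \<Otimes>\<^sub>M borel)"
  using grid_set_sets sets.top[of "past N"] by (intro pair_measureI) simp_all

lemma grid_bad_prob:
  assumes n: "tau \<le> n" and B: "B \<in> sets (past n)" and eta: "0 < eta" "eta < 1"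
    and k: "1 \<le> k" and small: "2 * lam eta k < 1"
  shows "B \<inter> grid_bad eta n k \<in> events"
    and "prob (B \<inter> grid_bad eta n k) \<le> 3 * eta / (pi\<^sup>2 * (real k)\<^sup>2) * prob B"
proof -
  let ?r = "2 * lam eta k - 2 / real (4 * k)"
  define E where "E g h = {\<omega>\<in>B. real k * ?r < \<bar>\<Sum>i<k. increment n (\<lambda>_. space M \<times> grid_set k g h) i \<omega>\<bar>}" for g h
  have r: "0 \<le> ?r" using grid_union_bound(1)[OF eta k small] by simp
  have B': "B \<subseteq> space M" using B sets.sets_into_space by fastforce
  have eq: "B \<inter> grid_bad eta n k = (\<Union>g\<le>4 * k + 1. \<Union>h\<le>4 * k + 1. E g h)"
    using B' by (auto simp: grid_bad_def E_def)
  have ev: "E g h \<in> events" for g h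
    unfolding E_def by (intro azuma(1) n const_section_sets B r)
  have pr: "prob (E g h) \<le> 2 * exp (- 2 * real k * ?r\<^sup>2) * prob B" for g h
    unfolding E_def by (intro azuma(2) n const_section_sets B r)
  show "B \<inter> grid_bad eta n k \<in> events" unfolding eq using ev by auto
  have "prob (B \<inter> grid_bad eta n k) \<le> (\<Sum>g\<le>4 * k + 1. prob (\<Union>h\<le>4 * k + 1. E g h))"
    unfolding eq using ev by (intro measure_UNION_le) auto
  also have "\<dots> \<le> (\<Sum>g\<le>4 * k + 1. \<Sum>h\<le>4 * k + 1. prob (E g h))"
    using ev by (intro sum_mono measure_UNION_le) auto
  also have "\<dots> \<le> (\<Sum>g\<le>4 * k + 1. \<Sum>h\<le>4 * k + 1. 2 * exp (- 2 * real k * ?r\<^sup>2) * prob B)"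
    by (intro sum_mono pr)
  also have "\<dots> = (real (4 * k + 2))\<^sup>2 * (2 * exp (- 2 * real k * ?r\<^sup>2)) * prob B"
    by (simp add: power2_eq_square mult.assoc)
  also have "\<dots> \<le> 3 * eta / (pi\<^sup>2 * (real k)\<^sup>2) * prob B"
    by (intro mult_right_mono grid_union_bound(2)[OF eta k small]) simp
  finally show "prob (B \<inter> grid_bad eta n k) \<le> 3 * eta / (pi\<^sup>2 * (real k)\<^sup>2) * prob B" .
qed

lemma measure_F1_grid:
  assumes "g \<le> h" "1 \<le> k" "g \<le> 4 * k"
  shows "measure F1 (grid_set k g h) = min 1 (real h / real (4 * k)) - real g / real (4 * k)"
proof -
  have m: "measure F1 {z. cdf F1 z < real h / real (4 * k)} = min 1 (real h / real (4 * k))" for h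
  proof (cases "h \<le> 4 * k")
    case True
    then have "real h / real (4 * k) \<le> 1" using assms by (simp add: divide_le_eq_1)
    then show ?thesis by (subst F1.measure_cdf_less[OF F1_continuous]) auto
  next
    case False
    then have h: "1 < real h / real (4 * k)" using assms by (simp add: less_divide_eq)
    then have "{z. cdf F1 z < real h / real (4 * k)} = UNIV"
      using F1.cdf_bounded_prob by (auto intro: le_less_trans)
    then show ?thesis using h F1.prob_space by (simp add: F1.space_eq_univ)
  qed
  have "measure F1 (grid_set k g h)
     = measure F1 {z. cdf F1 z < real h / real (4 * k)} - measure F1 {z. cdf F1 z < real g / real (4 * k)}"
    unfolding grid_set_def
  proof (rule F1.finite_measure_Diff)
    have "real g / real (4 * k) \<le> real h / real (4 * k)" using assms by (intro divide_right_mono) auto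
    then show "{z. cdf F1 z < real g / real (4 * k)} \<subseteq> {z. cdf F1 z < real h / real (4 * k)}" by auto
  qed auto
  moreover have "real g / real (4 * k) \<le> 1" using assms by (simp add: divide_le_eq_1)
  ultimately show ?thesis using m[of g] m[of h] by (auto simp: not_le)
qed

text \<open>An interval is squeezed between two grid intervals whose F1-masses differ from its own
  by at most two mesh widths. Together with the grid deviation 2 lam - 2 / (4 k) this gives exactly
  2 lam.\<close>

lemma interval_discrepancy:
  assumes eta: "0 < eta" "eta < 1" and \<omega>: "\<omega> \<in> space M"
    and good: "k = 0 \<or> 1 \<le> 2 * lam eta k \<or> \<omega> \<notin> grid_bad eta n k"
    and xy: "x \<le> y"
  shows "\<bar>(\<Sum>i<k. of_bool (x < X (Suc (n + i)) \<omega> \<and> X (Suc (n + i)) \<omega> \<le> y))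
      - real k * (cdf F1 y - cdf F1 x)\<bar> \<le> 2 * (real k * lam eta k)"
proof -
  let ?F = "cdf F1"
  let ?S = "(\<Sum>i<k. of_bool (x < X (Suc (n + i)) \<omega> \<and> X (Suc (n + i)) \<omega> \<le> y)) :: real"
  have F: "0 \<le> ?F x" "?F x \<le> ?F y" "?F y \<le> 1"
    using F1.cdf_nonneg F1.cdf_nondecreasing[OF xy] F1.cdf_bounded_prob by auto
  consider "k = 0" | "1 \<le> k" "1 \<le> 2 * lam eta k" | "1 \<le> k" "2 * lam eta k < 1" "\<omega> \<notin> grid_bad eta n k"
    using good by fastforce
  then show ?thesis
  proof cases
    case 1
    then show ?thesis by simp
  next
    case 2
    \<comment> \<open>The count and k times the mass both lie between 0 and k, and here k \<le> 2 k
      lam.\<close>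
    have "0 \<le> ?S" by (simp add: sum_nonneg)
    moreover have "?S \<le> (\<Sum>i<k. 1)" by (intro sum_mono) auto
    moreover have "0 \<le> real k * (?F y - ?F x)" using F by simp
    moreover have "real k * (?F y - ?F x) \<le> real k * 1" using F by (intro mult_left_mono) auto
    moreover have "real k * 1 \<le> real k * (2 * lam eta k)" using 2 by (intro mult_left_mono) auto
    ultimately show ?thesis by (simp add: abs_le_iff)
  next
    case 3
    define G where "G = real (4 * k)"
    have G: "0 < G" using 3 by (simp add: G_def)
    define N where "N g h = (\<Sum>i<k. indicator (grid_set k g h) (X (Suc (n + i)) \<omega>) :: real)" for g h
    have dev: "\<bar>N g h - real k * measure F1 (grid_set k g h)\<bar> \<le> real k * (2 * lam eta k - 2 / G)"
      if "g \<le> 4 * k + 1" "h \<le> 4 * k + 1" for g h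
    proof -
      have "(\<Sum>i<k. increment n (\<lambda>_. space M \<times> grid_set k g h) i \<omega>)
          = N g h - real k * measure F1 (grid_set k g h)"
        using \<omega> by (simp add: increment_def next_mass_def N_def sum_subtractf indicator_times)
      moreover have "\<not> real k * (2 * lam eta k - 2 / G) < \<bar>\<Sum>i<k. increment n (\<lambda>_. space M \<times> grid_set k g h) i \<omega>\<bar>"
        using 3(3) \<omega> that by (auto simp: grid_bad_def G_def)
      ultimately show ?thesis by simp
    qed
    \<comment> \<open>Levels rounded down: the grid interval from gx to gy + 1 contains (x, y], and
      the one from gx + 1 to gy is contained in it.\<close>
    define gx where "gx = nat \<lfloor>G * ?F x\<rfloor>"
    define gy where "gy = nat \<lfloor>G * ?F y\<rfloor>"
    have gx: "real gx \<le> G * ?F x" "G * ?F x < real gx + 1" using F G by (auto simp: gx_def)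
    have gy: "real gy \<le> G * ?F y" "G * ?F y < real gy + 1" using F G by (auto simp: gy_def)
    have fx: "real gx / G \<le> ?F x" "?F x < real gx / G + 1 / G"
      using gx G by (auto simp: field_simps)
    have fy: "real gy / G \<le> ?F y" "?F y < real gy / G + 1 / G"
      using gy G by (auto simp: field_simps)
    have "G * ?F y \<le> G * 1" "G * ?F x \<le> G * ?F y" using F G by (auto simp del: mult_1_right)
    with gx gy have "real gy \<le> real (4 * k)" "real gx \<le> real (4 * k)" "real gx < real (gy + 1)"
      by (auto simp: G_def)
    then have le: "gy \<le> 4 * k" "gx \<le> 4 * k" "gx \<le> gy" by linarith+
    have up: "?S \<le> real k * (?F y - ?F x) + 2 * (real k * lam eta k)"
    proof -
      have "?S \<le> N gx (Suc gy)"
        unfolding N_def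
      proof (intro sum_mono)
        fix i
        let ?z = "X (Suc (n + i)) \<omega>"
        have "?z \<in> grid_set k gx (Suc gy)" if "x < ?z" "?z \<le> y"
        proof -
          have "?F x \<le> ?F ?z" "?F ?z \<le> ?F y" using that by (auto intro: F1.cdf_nondecreasing)
          then have "G * ?F x \<le> G * ?F ?z" "G * ?F ?z \<le> G * ?F y" using G by auto
          with gx gy have "real gx \<le> G * ?F ?z" "G * ?F ?z < real (Suc gy)" by auto
          then show ?thesis using G unfolding grid_set_def G_def[symmetric] by (simp add: field_simps)
        qed
        then show "of_bool (x < ?z \<and> ?z \<le> y) \<le> (indicator (grid_set k gx (Suc gy)) ?z :: real)" by auto
      qed
      also have "\<dots> \<le> real k * measure F1 (grid_set k gx (Suc gy)) + real k * (2 * lam eta k - 2 / G)"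
        using dev[of gx "Suc gy"] le by (simp add: abs_le_iff)
      finally have "?S \<le> real k * measure F1 (grid_set k gx (Suc gy)) + real k * (2 * lam eta k - 2 / G)" .
      moreover have "measure F1 (grid_set k gx (Suc gy)) \<le> real (Suc gy) / G - real gx / G"
        using le 3 by (subst measure_F1_grid) (auto simp: G_def)
      then have "measure F1 (grid_set k gx (Suc gy)) \<le> ?F y - ?F x + 2 / G"
        using fx fy by (simp add: add_divide_distrib)
      then have "real k * measure F1 (grid_set k gx (Suc gy)) \<le> real k * (?F y - ?F x + 2 / G)"
        by (intro mult_left_mono) auto
      ultimately show ?thesis by (simp add: algebra_simps)
    qed
    have lo: "real k * (?F y - ?F x) - 2 * (real k * lam eta k) \<le> ?S"
    proof (cases "Suc gx \<le> gy")
      case True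
      have "?F y - ?F x - 2 / G \<le> real gy / G - real (Suc gx) / G"
        using fx fy by (simp add: add_divide_distrib)
      also have "\<dots> = measure F1 (grid_set k (Suc gx) gy)"
        using True le 3 G by (subst measure_F1_grid) (auto simp: G_def min_def field_simps)
      finally have "real k * (?F y - ?F x - 2 / G) \<le> real k * measure F1 (grid_set k (Suc gx) gy)"
        by (intro mult_left_mono) auto
      also have "\<dots> \<le> N (Suc gx) gy + real k * (2 * lam eta k - 2 / G)"
        using dev[of "Suc gx" gy] le True by (simp add: abs_le_iff)
      finally have "real k * (?F y - ?F x - 2 / G) \<le> N (Suc gx) gy + real k * (2 * lam eta k - 2 / G)" .
      moreover have "N (Suc gx) gy \<le> ?S"
        unfolding N_def
      proof (intro sum_mono)
        fix i
        let ?z = "X (Suc (n + i)) \<omega>"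
        have "x < ?z \<and> ?z \<le> y" if "?z \<in> grid_set k (Suc gx) gy"
        proof -
          have "real (Suc gx) / G \<le> ?F ?z" "?F ?z < real gy / G"
            using that unfolding grid_set_def G_def[symmetric] by auto
          then have "real (Suc gx) \<le> G * ?F ?z" "G * ?F ?z < real gy" using G by (auto simp: field_simps)
          with gx gy have "G * ?F x < G * ?F ?z" "G * ?F ?z < G * ?F y" by auto
          then have "?F x < ?F ?z" "?F ?z < ?F y" using G by auto
          then show ?thesis using F1.cdf_nondecreasing[of ?z x] F1.cdf_nondecreasing[of y ?z] by fastforce
        qed
        then show "(indicator (grid_set k (Suc gx) gy) ?z :: real) \<le> of_bool (x < ?z \<and> ?z \<le> y)"
          by (auto simp: indicator_def)
      qed
      ultimately show ?thesis by (simp add: algebra_simps)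
    next
      case False
      \<comment> \<open>Both endpoints lie in the same cell and there is no inner grid interval; the
        mass itself is then below the allowed error.\<close>
      with le have "gx = gy" by simp
      then have "G * (?F y - ?F x) \<le> 1" using gx gy by (simp add: algebra_simps)
      then have "?F y - ?F x \<le> 2 / G" using G by (simp add: field_simps)
      also have "2 / G \<le> 2 * lam eta k"
        using grid_union_bound(1)[OF eta 3(1,2)] by (simp add: G_def)
      finally have "real k * (?F y - ?F x) \<le> real k * (2 * lam eta k)" by (intro mult_left_mono) auto
      moreover have "0 \<le> ?S" by (simp add: sum_nonneg)
      ultimately show ?thesis by simp
    qed
    show ?thesis using up lo by (simp add: abs_le_iff)
  qed
qed

end

section \<open>Bin frequencies\<close>

text \<open>Solving for the count turns a bin into a window of length (D + 1) / J. For the last bin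
  the upper constraint holds automatically, since s + u \<le> D + 1.\<close>

lemma bin_iff:
  fixes D s u :: real
  assumes J: "1 \<le> J" and j: "j \<in> {1..J}" and D: "0 < D + 1" and su: "s \<le> D" "u \<le> 1"
  defines "lo \<equiv> (real j - 1) * (D + 1) / real J - u" and "hi \<equiv> real j * (D + 1) / real J - u"
  shows "(s + u) / (D + 1) \<in> bin J j \<longleftrightarrow> lo \<le> s \<and> (j = J \<or> s < hi)"
proof -
  have 1: "(real j - 1) / real J \<le> (s + u) / (D + 1) \<longleftrightarrow> lo \<le> s"
    using J D by (simp add: lo_def field_simps)
  have 2: "(s + u) / (D + 1) < real j / real J \<longleftrightarrow> s < hi"
    using J D by (simp add: hi_def field_simps)
  have 3: "(s + u) / (D + 1) \<le> 1" using D su by (simp add: divide_le_eq_1)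
  show ?thesis using 1 2 3 j by (auto simp: bin_def)
qed

context change_point_model
begin

text \<open>The bin event with the new observation separated as second coordinate. The randomizer of
  time N + 1 may be read from the first coordinate because \<open>past N\<close> contains all
  randomizers.\<close>

definition pval_section :: "nat \<Rightarrow> nat \<Rightarrow> nat \<Rightarrow> ('a \<times> real) set" where
  "pval_section J j N = {z \<in> space (past N \<Otimes>\<^sub>M borel).
     ((\<Sum>r = 1..N. of_bool (X r (fst z) > snd z)) + U (Suc N) (fst z)) / real (Suc N) \<in> bin J j}"

lemma bin_sets [measurable]: "bin J j \<in> sets borel"
  by (simp add: bin_def)

lemma pval_section_sets: "pval_section J j N \<in> sets (past N \<Otimes>\<^sub>M borel)"
proof -
  have [measurable]: "X r \<in> borel_measurable (past N)" if "r \<in> {1..N}" for r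
    using that by (intro X_measurable_past) auto
  have [measurable]: "U (Suc N) \<in> borel_measurable (past N)"
    by (intro U_measurable_past) auto
  have "(\<lambda>z. \<Sum>r = 1..N. of_bool (X r (fst z) > snd z) :: real) \<in> borel_measurable (past N \<Otimes>\<^sub>M borel)"
    by (intro borel_measurable_sum) measurable
  note this[measurable]
  show ?thesis unfolding pval_section_def by measurable
qed

lemma indicator_pval_section:
  assumes "\<omega> \<in> space M"
  shows "indicator (pval_section J j N) (\<omega>, X (Suc N) \<omega>) = (of_bool (pval X U (Suc N) \<omega> \<in> bin J j) :: real)"
  using assms
  by (simp add: pval_section_def pval_def indicator_def space_pair_measure atLeastLessThanSuc_atLeastAtMost)

text \<open>Given the past, the number S of earlier points above x decreases from D = n + k to 0,
  and the bin is a window of S. The first n points contribute 2 n b to the interval discrepancy and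
  the k new ones 2 k lam; dividing by D produces the weights of b and lam.\<close>

lemma next_mass_pval_section:
  assumes J: "2 \<le> J" and j: "j \<in> {1..J}" and eta: "0 < eta" "eta < 1" and \<omega>: "\<omega> \<in> space M"
    and n: "1 \<le> n" and u: "0 \<le> U (Suc (n + k)) \<omega>" "U (Suc (n + k)) \<omega> \<le> 1"
    and good: "k = 0 \<or> 1 \<le> 2 * lam eta k \<or> \<omega> \<notin> grid_bad eta n k"
  shows "\<bar>next_mass (pval_section J j (n + k)) \<omega> - 1 / real J\<bar>
    \<le> 2 * (real n / (real n + real k) * b_dev F1 X n \<omega> + real k / (real n + real k) * lam eta k
          + 1 / (real n + real k + 1))"
proof -
  define D where "D = real (n + k)"
  define b where "b = b_dev F1 X n \<omega>"
  define E where "E = 2 * (real n * b + real k * lam eta k)"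
  define u' where "u' = U (Suc (n + k)) \<omega>"
  define S where "S x = (\<Sum>r = 1..n + k. of_bool (X r \<omega> > x) :: real)" for x
  define lo where "lo = (real j - 1) * (D + 1) / real J - u'"
  define hi where "hi = real j * (D + 1) / real J - u'"
  have D: "1 \<le> D" using n by (simp add: D_def)
  have Santi: "antimono S"
    unfolding S_def antimono_def by (intro allI impI sum_mono) auto
  have S0: "0 \<le> S x" for x by (simp add: S_def sum_nonneg)
  have SD: "S x \<le> D" for x
  proof -
    have "S x \<le> (\<Sum>r = 1..n + k. 1)" unfolding S_def by (intro sum_mono) auto
    then show ?thesis by (simp add: D_def)
  qed
  have lim_bot: "(S \<longlongrightarrow> D) at_bot"
  proof -
    have "\<forall>\<^sub>F x in at_bot. of_bool (X r \<omega> > x) = (1::real)" for r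
      using eventually_gt_at_bot[of "X r \<omega>"] by (auto elim!: eventually_mono)
    then have "(S \<longlongrightarrow> (\<Sum>r = 1..n + k. 1)) at_bot"
      unfolding S_def by (intro tendsto_sum tendsto_eventually)
    then show ?thesis by (simp add: D_def)
  qed
  have lim_top: "(S \<longlongrightarrow> 0) at_top"
  proof -
    have "\<forall>\<^sub>F x in at_top. of_bool (X r \<omega> > x) = (0::real)" for r
      using eventually_ge_at_top[of "X r \<omega>"] by (rule eventually_mono) simp
    then have "(S \<longlongrightarrow> (\<Sum>r = 1..n + k. 0)) at_top"
      unfolding S_def by (intro tendsto_sum tendsto_eventually)
    then show ?thesis by simp
  qed
  have Sdiff: "\<bar>(S x - S y) - D * (cdf F1 y - cdf F1 x)\<bar> \<le> E" if xy: "x \<le> y" for x y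
  proof -
    let ?f = "\<lambda>r. of_bool (x < X r \<omega> \<and> X r \<omega> \<le> y) :: real"
    have "S x - S y = (\<Sum>r = 1..n + k. ?f r)"
      unfolding S_def sum_subtractf[symmetric] using xy by (intro sum.cong) auto
    also have "\<dots> = (\<Sum>r = 1..n. ?f r) + (\<Sum>r = n + 1..n + k. ?f r)"
      using n by (intro sum.ub_add_nat) auto
    also have "(\<Sum>r = n + 1..n + k. ?f r) = (\<Sum>i<k. ?f (Suc (n + i)))"
      by (rule sum.reindex_bij_witness[of _ "\<lambda>i. Suc (n + i)" "\<lambda>r. r - Suc n"]) auto
    finally have "(S x - S y) - D * (cdf F1 y - cdf F1 x)
       = ((\<Sum>r = 1..n. ?f r) - real n * (cdf F1 y - cdf F1 x))
       + ((\<Sum>i<k. ?f (Suc (n + i))) - real k * (cdf F1 y - cdf F1 x))"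
      by (simp add: D_def algebra_simps)
    moreover have "\<bar>p + q\<bar> \<le> 2 * (p' + q')" if "\<bar>p\<bar> \<le> 2 * p'" "\<bar>q\<bar> \<le> 2 * q'" for p q p' q' :: real
      using that abs_triangle_ineq[of p q] by (simp add: distrib_left)
    note this[OF emp_interval_le_b_dev[OF n xy, of \<omega>] interval_discrepancy[OF eta \<omega> good xy]]
    ultimately show ?thesis unfolding E_def b_def by simp
  qed
  have w: "hi - lo = (D + 1) / real J"
    using J by (simp add: hi_def lo_def field_simps)
  have sec: "Pair \<omega> -` pval_section J j (n + k) = {x. lo \<le> S x \<and> (j = J \<or> S x < hi)}"
  proof (rule set_eqI)
    fix x
    have "x \<in> Pair \<omega> -` pval_section J j (n + k) \<longleftrightarrow> (S x + u') / (D + 1) \<in> bin J j"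
      using \<omega> by (simp add: pval_section_def S_def u'_def D_def space_pair_measure add.commute)
    also have "\<dots> \<longleftrightarrow> lo \<le> S x \<and> (j = J \<or> S x < hi)"
      unfolding lo_def hi_def using J j D SD[of x] u by (intro bin_iff) (auto simp: u'_def)
    finally show "x \<in> Pair \<omega> -` pval_section J j (n + k) \<longleftrightarrow> x \<in> {x. lo \<le> S x \<and> (j = J \<or> S x < hi)}"
      by simp
  qed
  have lo: "- u' \<le> lo" using J j D by (simp add: lo_def)
  have hi: "hi \<le> D + 1 - u'"
  proof -
    have "real j * (D + 1) \<le> real J * (D + 1)" using j D by (intro mult_right_mono) auto
    then show ?thesis using J by (simp add: hi_def field_simps)
  qed
  have lohi: "lo \<le> hi"
  proof -
    have "0 \<le> (D + 1) / real J" using D by simp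
    then show ?thesis using w by linarith
  qed
  have full: "j = J \<Longrightarrow> hi = D + 1 - u'" using J by (simp add: hi_def)
  have D0: "0 < D" using D by simp
  note window = F1.count_window_measure[where full="j = J", OF F1_continuous D0 Santi S0 SD lim_bot lim_top Sdiff
      u[folded u'_def] lo hi lohi full]
  have up: "D * next_mass (pval_section J j (n + k)) \<omega> \<le> hi - lo + E"
    unfolding next_mass_def sec by (rule window(1))
  have low: "hi - lo - 1 - E \<le> D * next_mass (pval_section J j (n + k)) \<omega>"
    unfolding next_mass_def sec by (rule window(2))
  have J2: "1 / real J \<le> 1" "0 < 1 / real J" using J by auto
  have w': "hi - lo = D * (1 / real J) + 1 / real J" unfolding w by (simp add: add_divide_distrib)
  have "\<bar>D * (x - r)\<bar> \<le> E + 1"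
    \<comment> \<open>The window has width D / J + 1 / J, and 0 < 1 / J \<le> 1: rounding costs at
      most one point in either direction.\<close>
    if "D * x \<le> hi - lo + E" "hi - lo - 1 - E \<le> D * x" "hi - lo = D * r + r" "0 < r" "r \<le> 1" for x r
    using that by (simp add: abs_le_iff algebra_simps)
  from this[OF up low w' J2(2,1)] have "\<bar>D * (next_mass (pval_section J j (n + k)) \<omega> - 1 / real J)\<bar> \<le> E + 1" .
  then have "D * \<bar>next_mass (pval_section J j (n + k)) \<omega> - 1 / real J\<bar> \<le> E + 1"
    using D by (simp add: abs_mult)
  then have "\<bar>next_mass (pval_section J j (n + k)) \<omega> - 1 / real J\<bar> \<le> (E + 1) / D"
    using D by (simp add: field_simps)
  \<comment> \<open>The rounding cost 1 / D is at most 2 / (D + 1), which matches the last summand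
    in the sum of \<open>a_bound\<close> with its prefactor 2.\<close>
  also have "\<dots> \<le> E / D + 2 / (D + 1)"
  proof -
    have "1 / D \<le> 2 / (D + 1)" using D by (simp add: field_simps)
    then show ?thesis by (simp add: add_divide_distrib)
  qed
  also have "\<dots> = 2 * (real n / (real n + real k) * b + real k / (real n + real k) * lam eta k
          + 1 / (real n + real k + 1))"
    by (simp add: E_def D_def add_divide_distrib distrib_left)
  finally show ?thesis unfolding b_def .
qed

definition bin_bad :: "real \<Rightarrow> nat \<Rightarrow> nat \<Rightarrow> nat \<Rightarrow> 'a set" where
  "bin_bad eta J n m = (\<Union>j\<in>{1..J}. {\<omega>\<in>space M.
     real m * azuma_radius J eta m < \<bar>\<Sum>i<m. increment n (\<lambda>i. pval_section J j (n + i)) i \<omega>\<bar>})"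

lemma bin_bad_prob:
  assumes n: "tau \<le> n" and B: "B \<in> sets (past n)" and eta: "0 < eta" "eta < 1"
    and J: "1 \<le> J" and m: "1 \<le> m"
  shows "B \<inter> bin_bad eta J n m \<in> events"
    and "prob (B \<inter> bin_bad eta J n m) \<le> 3 * eta / (pi\<^sup>2 * (real m)\<^sup>2) * prob B"
proof -
  let ?r = "azuma_radius J eta m"
  define E where "E j = {\<omega>\<in>B. real m * ?r < \<bar>\<Sum>i<m. increment n (\<lambda>i. pval_section J j (n + i)) i \<omega>\<bar>}" for j
  note r = azuma_radius(1)[OF eta J m]
  have B': "B \<subseteq> space M" using B sets.sets_into_space by fastforce
  have eq: "B \<inter> bin_bad eta J n m = (\<Union>j\<in>{1..J}. E j)"
    using B' by (auto simp: bin_bad_def E_def)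
  have ev: "E j \<in> events" for j
    unfolding E_def by (intro azuma(1) n pval_section_sets B r)
  show "B \<inter> bin_bad eta J n m \<in> events" unfolding eq using ev by auto
  have "prob (B \<inter> bin_bad eta J n m) \<le> (\<Sum>j\<in>{1..J}. prob (E j))"
    unfolding eq using ev by (intro measure_UNION_le) auto
  also have "\<dots> \<le> (\<Sum>j\<in>{1..J}. 2 * exp (- 2 * real m * ?r\<^sup>2) * prob B)"
    unfolding E_def by (intro sum_mono azuma(2) n pval_section_sets B r)
  also have "\<dots> = real J * (2 * exp (- 2 * real m * ?r\<^sup>2)) * prob B" by simp
  also have "\<dots> = 3 * eta / (pi\<^sup>2 * (real m)\<^sup>2) * prob B"
    unfolding azuma_radius(3)[OF eta J m] ..
  finally show "prob (B \<inter> bin_bad eta J n m) \<le> 3 * eta / (pi\<^sup>2 * (real m)\<^sup>2) * prob B" .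
qed

text \<open>Grid failures count only while 2 lam < 1, because otherwise the interval bound is
  trivial. The index is shifted so that only positive sample sizes occur.\<close>

definition bad :: "real \<Rightarrow> nat \<Rightarrow> nat \<Rightarrow> 'a set" where
  "bad eta J n = (\<Union>k. (if 2 * lam eta (Suc k) < 1 then grid_bad eta n (Suc k) else {})
                     \<union> bin_bad eta J n (Suc k))"

text \<open>Both families of failures have budget 3 eta / (pi^2 k^2) at sample size k, and the sum
  of 1 / k^2 is pi^2 / 6, so the total is exactly eta.\<close>

lemma bad_prob:
  assumes n: "tau \<le> n" and B: "B \<in> sets (past n)" and eta: "0 < eta" "eta < 1" and J: "1 \<le> J"
  shows "B \<inter> bad eta J n \<in> events" and "prob (B \<inter> bad eta J n) \<le> eta * prob B"
proof -
  define E where "E k = B \<inter> ((if 2 * lam eta (Suc k) < 1 then grid_bad eta n (Suc k) else {})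
      \<union> bin_bad eta J n (Suc k))" for k
  let ?c = "6 * eta / pi\<^sup>2 * prob B"
  have eq: "B \<inter> bad eta J n = (\<Union>k. E k)" by (auto simp: bad_def E_def)
  have E: "E k \<in> events \<and> prob (E k) \<le> ?c * (1 / (real k + 1)\<^sup>2)" for k
  proof -
    define G where "G = B \<inter> (if 2 * lam eta (Suc k) < 1 then grid_bad eta n (Suc k) else {})"
    have G: "G \<in> events" "prob G \<le> 3 * eta / (pi\<^sup>2 * (real (Suc k))\<^sup>2) * prob B"
      using grid_bad_prob[OF n B eta, of "Suc k"] eta by (auto simp: G_def)
    note b = bin_bad_prob[OF n B eta J, of "Suc k"]
    have "E k = G \<union> (B \<inter> bin_bad eta J n (Suc k))" by (auto simp: E_def G_def)
    moreover have "prob (G \<union> (B \<inter> bin_bad eta J n (Suc k))) \<le> prob G + prob (B \<inter> bin_bad eta J n (Suc k))"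
      using G b by (intro measure_Un_le) auto
    moreover have "3 * eta / (pi\<^sup>2 * (real (Suc k))\<^sup>2) * prob B + 3 * eta / (pi\<^sup>2 * (real (Suc k))\<^sup>2) * prob B
        = ?c * (1 / (real k + 1)\<^sup>2)" by (simp add: add.commute)
    ultimately show ?thesis using G b by (auto intro: order_trans)
  qed
  show "B \<inter> bad eta J n \<in> events" unfolding eq using E by auto
  have s: "(\<lambda>k. ?c * (1 / (real k + 1)\<^sup>2)) sums (?c * (pi\<^sup>2 / 6))"
    using inverse_squares_sums by (intro sums_mult) (simp add: add.commute)
  have sE: "summable (\<lambda>k. prob (E k))"
    using E by (intro summable_comparison_test'[OF sums_summable[OF s], of 0]) auto
  have "prob (B \<inter> bad eta J n) \<le> (\<Sum>k. prob (E k))"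
    unfolding eq using E sE by (intro finite_measure_subadditive_countably) auto
  also have "\<dots> \<le> ?c * (pi\<^sup>2 / 6)"
    using E sE by (intro sums_le[OF _ summable_sums[OF sE] s]) auto
  also have "\<dots> = eta * prob B" by simp
  finally show "prob (B \<inter> bad eta J n) \<le> eta * prob B" .
qed

text \<open>The new frequency minus the average of its conditional probabilities is an average of
  martingale differences, covered by the Azuma radius; that average differs from 1 / J by at most
  the average of the individual bounds.\<close>

lemma bin_frequency_bound:
  assumes J: "2 \<le> J" and j: "j \<in> {1..J}" and eta: "0 < eta" "eta < 1"
    and \<omega>: "\<omega> \<in> space M" "\<omega> \<notin> bad eta J n"
    and n: "1 \<le> n" and m: "1 \<le> m" and u: "\<And>i. 1 \<le> i \<Longrightarrow> 0 \<le> U i \<omega> \<and> U i \<omega> \<le> 1"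
  shows "\<bar>real (bin_count J X U (n + m) j \<omega> - bin_count J X U n j \<omega>) / real m - 1 / real J\<bar>
     \<le> a_bound J eta n m (b_dev F1 X n \<omega>)"
proof -
  let ?b = "b_dev F1 X n \<omega>"
  let ?d = "\<lambda>i. real n / (real n + real i) * ?b + real i / (real n + real i) * lam eta i
          + 1 / (real n + real i + 1)"
  let ?pi = "\<lambda>i. next_mass (pval_section J j (n + i)) \<omega>"
  have good: "k = 0 \<or> 1 \<le> 2 * lam eta k \<or> \<omega> \<notin> grid_bad eta n k" for k
  proof (cases k)
    case (Suc l)
    then show ?thesis using \<omega>(2) by (fastforce simp: bad_def not_less split: if_splits)
  qed simp
  have pi: "\<bar>?pi i - 1 / real J\<bar> \<le> 2 * ?d i" for i
    using u[of "Suc (n + i)"] by (intro next_mass_pval_section J j eta \<omega> n good) auto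
  have cnt: "real (bin_count J X U (n + m) j \<omega> - bin_count J X U n j \<omega>)
      = (\<Sum>i<m. of_bool (pval X U (Suc (n + i)) \<omega> \<in> bin J j))"
  proof -
    have "bin_count J X U (n + m) j \<omega> = bin_count J X U n j \<omega>
        + (\<Sum>i<m. of_bool (pval X U (Suc (n + i)) \<omega> \<in> bin J j))"
      by (induction m) (auto simp: bin_count_Suc)
    then show ?thesis by simp
  qed
  have inc: "(\<Sum>i<m. increment n (\<lambda>i. pval_section J j (n + i)) i \<omega>)
     = real (bin_count J X U (n + m) j \<omega> - bin_count J X U n j \<omega>) - (\<Sum>i<m. ?pi i)"
    unfolding cnt increment_def sum_subtractf using \<omega> by (simp add: indicator_pval_section)
  obtain l where l: "m = Suc l" using m by (cases m) auto
  have "\<omega> \<notin> bin_bad eta J n m" using \<omega>(2) by (auto simp: bad_def l)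
  then have az: "\<bar>real (bin_count J X U (n + m) j \<omega> - bin_count J X U n j \<omega>) - (\<Sum>i<m. ?pi i)\<bar>
      \<le> real m * azuma_radius J eta m"
    using \<omega>(1) j unfolding inc[symmetric] by (force simp: bin_bad_def not_less)
  have "\<bar>(\<Sum>i<m. ?pi i) - real m * (1 / real J)\<bar> = \<bar>\<Sum>i<m. ?pi i - 1 / real J\<bar>"
    by (simp add: sum_subtractf)
  also have "\<dots> \<le> (\<Sum>i<m. \<bar>?pi i - 1 / real J\<bar>)" by (rule sum_abs)
  also have "\<dots> \<le> (\<Sum>i<m. 2 * ?d i)" by (intro sum_mono pi)
  finally have "\<bar>real (bin_count J X U (n + m) j \<omega> - bin_count J X U n j \<omega>) - real m * (1 / real J)\<bar>
      \<le> 2 * (\<Sum>i<m. ?d i) + real m * azuma_radius J eta m"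
    using az by (simp add: sum_distrib_left)
  then have "\<bar>real (bin_count J X U (n + m) j \<omega> - bin_count J X U n j \<omega>) - real m * (1 / real J)\<bar> / real m
      \<le> (2 * (\<Sum>i<m. ?d i) + real m * azuma_radius J eta m) / real m"
    by (intro divide_right_mono) auto
  moreover have "\<bar>real (bin_count J X U (n + m) j \<omega> - bin_count J X U n j \<omega>) - real m * (1 / real J)\<bar> / real m
     = \<bar>real (bin_count J X U (n + m) j \<omega> - bin_count J X U n j \<omega>) / real m - 1 / real J\<bar>"
  proof -
    have "(x - real m * (1 / real J)) / real m = x / real m - 1 / real J" for x
      using m by (simp add: diff_divide_distrib)
    then show ?thesis by (metis abs_divide abs_of_nat)
  qed
  moreover have "(2 * (\<Sum>i<m. ?d i) + real m * azuma_radius J eta m) / real m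
      = a_bound J eta n m ?b"
    unfolding a_bound_eq using m by (simp add: add_divide_distrib)
  ultimately show ?thesis by simp
qed

end

section \<open>Finiteness of the guaranteed delay\<close>

text \<open>Moving mass x from the second bin to the first stays in the ball. With y = J x the
  divergence is ((1 + y) ln (1 + y) + (1 - y) ln (1 - y)) / J, which is at least y^2 / J.\<close>

lemma Phi_ge_two_point:
  assumes J: "2 \<le> J" and x: "0 \<le> x" "x \<le> 1 / real J" "x \<le> a"
  shows "real J * x\<^sup>2 \<le> Phi J a"
proof -
  define q where "q j = (1 / real J) + (if j = 1 then x else 0) - (if j = 2 then x else 0)" for j :: nat
  define y where "y = real J * x"
  have y: "0 \<le> y" "y \<le> 1" using x J by (auto simp: y_def field_simps)
  have i12: "(1::nat) \<in> {1..J}" "(2::nat) \<in> {1..J}" using J by auto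
  have "q \<in> simplex_vec J"
    using x J i12 by (auto simp: simplex_vec_def q_def sum.distrib sum_subtractf)
  moreover have "\<bar>q j - 1 / real J\<bar> \<le> a" for j
    using x by (auto simp: q_def)
  ultimately have "KL_vec J q (unif_vec J) \<le> Phi J a"
    using J by (intro KL_le_Phi) auto
  moreover have "KL_vec J q (unif_vec J) = ((1 + y) * ln (1 + y) + (1 - y) * ln (1 - y)) / real J"
  proof -
    have "KL_vec J q (unif_vec J)
       = (\<Sum>j=1..J. (if j = 1 then (1 + y) * ln (1 + y) / real J else 0)
                  + (if j = 2 then (1 - y) * ln (1 - y) / real J else 0))"
      unfolding KL_vec_def
    proof (intro sum.cong refl)
      fix j
      have "(1 / real J + x) * real J = 1 + y" "(1 / real J - x) * real J = 1 - y"
        "1 / real J + x = (1 + y) / real J" "1 / real J - x = (1 - y) / real J"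
        using J by (auto simp: y_def field_simps)
      then show "q j * ln (q j / unif_vec J j)
        = (if j = 1 then (1 + y) * ln (1 + y) / real J else 0) + (if j = 2 then (1 - y) * ln (1 - y) / real J else 0)"
        using J by (auto simp: q_def unif_vec_def)
    qed
    also have "\<dots> = (1 + y) * ln (1 + y) / real J + (1 - y) * ln (1 - y) / real J"
      using i12 by (simp add: sum.distrib)
    finally show ?thesis by (simp add: add_divide_distrib)
  qed
  moreover have "y\<^sup>2 \<le> (1 + y) * ln (1 + y) + (1 - y) * ln (1 - y)"
  proof -
    \<comment> \<open>The scalar inequality is Pinsker's for a fair coin against a coin of bias (1 +
      y) / 2.\<close>
    define p2 where "p2 j = (1/2 :: real)" for j :: nat
    define q2 where "q2 j = (if j = 1 then (1 + y) / 2 else (1 - y) / 2)" for j :: nat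
    have sum2: "(\<Sum>j=1..2. f j) = f 1 + f 2" for f :: "nat \<Rightarrow> real"
      by (simp add: numeral_2_eq_2)
    have "2 * (TV_vec 2 p2 q2)\<^sup>2 \<le> KL_vec 2 q2 p2"
    proof (rule pinsker)
      show "(\<Sum>j=1..2. p2 j) = 1" "(\<Sum>j=1..2. q2 j) = 1"
        unfolding sum2 by (auto simp: p2_def q2_def field_simps)
    qed (use y in \<open>auto simp: p2_def q2_def\<close>)
    moreover have "TV_vec 2 p2 q2 = y / 2"
      using y unfolding TV_vec_def sum2 by (simp add: p2_def q2_def field_simps)
    moreover have "KL_vec 2 q2 p2 = ((1 + y) * ln (1 + y) + (1 - y) * ln (1 - y)) / 2"
    proof -
      have r: "q2 1 / p2 1 = 1 + y" "q2 2 / p2 2 = 1 - y" "q2 1 = (1 + y) / 2" "q2 2 = (1 - y) / 2"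
        by (auto simp: p2_def q2_def field_simps)
      show ?thesis unfolding KL_vec_def sum2 r(1,2) unfolding r(3,4) by (simp add: add_divide_distrib)
    qed
    ultimately show ?thesis by (simp add: power_divide)
  qed
  then have "y\<^sup>2 / real J \<le> ((1 + y) * ln (1 + y) + (1 - y) * ln (1 - y)) / real J"
    by (intro divide_right_mono) auto
  moreover have "y\<^sup>2 / real J = real J * x\<^sup>2"
    using J by (simp add: y_def power2_eq_square)
  ultimately show ?thesis by simp
qed

lemma a_bound_ge_radius:
  assumes "0 < eta" "eta < 1" "0 \<le> b"
  shows "azuma_radius J eta m \<le> a_bound J eta d m b"
proof -
  have "0 \<le> lam eta i" for i
    using lam_nonneg[OF assms(1,2), of i] by (cases "i = 0") (auto simp: lam_def)
  then have "0 \<le> 2 / real m * (\<Sum>i<m. real d / (real d + real i) * b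
        + real i / (real d + real i) * lam eta i + 1 / (real d + real i + 1))"
    using assms by (intro mult_nonneg_nonneg sum_nonneg add_nonneg_nonneg) auto
  then show ?thesis by (simp add: a_bound_eq)
qed

text \<open>This makes \<open>r_delay\<close> finite: otherwise \<open>DV - DC > r_delay\<close> would be impossible.\<close>

lemma U_bound_unbounded:
  assumes J: "2 \<le> J" and eta: "0 < eta" "eta < 1" and d: "1 \<le> d" and b: "0 \<le> b"
  shows "\<exists>m\<ge>1. h \<le> U_bound tau J eta0 eta d m b V"
proof -
  define C where "C = 2 * real d * (max V 0)\<^sup>2 + (real J - 1) / 2 * ln 2 - eps_const tau J eta0 + h"
  have "(\<lambda>m. ln (real m) / real m) \<longlonglongrightarrow> 0" by (rule lim_ln_over_n)
  then have "\<forall>\<^sub>F m in sequentially. ln (real m) / real m < (1 / real J)\<^sup>2"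
    using J by (intro order_tendstoD(2)) auto
  moreover have "\<forall>\<^sub>F m in sequentially. max C 0 \<le> ln (real m)"
    using filterlim_compose[OF ln_at_top filterlim_real_sequentially] unfolding filterlim_at_top by blast
  ultimately have "\<forall>\<^sub>F m in sequentially. 1 \<le> m \<and> ln (real m) / real m < (1 / real J)\<^sup>2 \<and> max C 0 \<le> ln (real m)"
    using eventually_ge_at_top[of 1] by eventually_elim auto
  then obtain m where m: "1 \<le> m" "ln (real m) / real m < (1 / real J)\<^sup>2" "max C 0 \<le> ln (real m)"
    by (auto dest: eventually_happens)
  define a where "a = a_bound J eta d m b"
  \<comment> \<open>This choice makes m J x^2 = J ln m. It lies below the Azuma radius, hence below
    a, and is at most 1 / J for the chosen m.\<close>
  define x where "x = sqrt (ln (real m) / real m)"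
  have J1: "1 \<le> J" using J by simp
  note rad = azuma_radius[OF eta J1 m(1)]
  have ra: "azuma_radius J eta m \<le> a" unfolding a_def by (rule a_bound_ge_radius[OF eta b])
  have a0: "0 \<le> a" using rad(1) ra by linarith
  have x2: "x\<^sup>2 = ln (real m) / real m" using m by (simp add: x_def)
  have x: "0 \<le> x" "x \<le> 1 / real J" "x \<le> a"
  proof -
    show "0 \<le> x" using m by (simp add: x_def)
    show "x \<le> 1 / real J" by (rule power2_le_imp_le) (use m x2 in auto)
    have "x \<le> azuma_radius J eta m" by (rule power2_le_imp_le) (use rad x2 in auto)
    then show "x \<le> a" using ra by linarith
  qed
  have "real m * (real J * x\<^sup>2) \<le> real m * Phi J a"
    using Phi_ge_two_point[OF J x] by (intro mult_left_mono) auto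
  then have Phi: "real J * ln (real m) \<le> real m * Phi J a" using m by (simp add: x2)
  have "2 * real d * real m / (real d + real m) * (max (V - real J / 2 * a) 0)\<^sup>2 \<le> 2 * real d * (max V 0)\<^sup>2"
  proof (intro mult_mono power_mono)
    show "2 * real d * real m / (real d + real m) \<le> 2 * real d" using d by (simp add: divide_le_eq)
    have "0 \<le> real J / 2 * a" using a0 by simp
    then show "max (V - real J / 2 * a) 0 \<le> max V 0" by linarith
  qed auto
  moreover have "(real J - 1) / 2 * ln (1 + real m / real d) \<le> (real J - 1) / 2 * (ln 2 + ln (real m))"
  proof (intro mult_left_mono)
    have "real m / real d \<le> real m / 1" using d by (intro divide_left_mono) auto
    then have "1 + real m / real d \<le> 2 * real m" using m by simp
    then have "ln (1 + real m / real d) \<le> ln (2 * real m)" using m by (intro ln_mono) (auto intro: add_pos_nonneg)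
    then show "ln (1 + real m / real d) \<le> ln 2 + ln (real m)" using m by (simp add: ln_mult)
  qed (use J in auto)
  \<comment> \<open>Since J - (J - 1) / 2 \<ge> 1, the gain J ln m survives the logarithmic penalty
    with at least ln m to spare, and m was chosen such that ln m \<ge> C.\<close>
  moreover have "ln (real m) \<le> real J * ln (real m) - (real J - 1) / 2 * ln (real m)"
  proof -
    have "1 * ln (real m) \<le> (real J - (real J - 1) / 2) * ln (real m)"
      using m J by (intro mult_right_mono) (auto simp: field_simps)
    then show ?thesis by (simp add: left_diff_distrib)
  qed
  ultimately have "h \<le> U_bound tau J eta0 eta d m b V"
    using Phi m(3) unfolding U_bound_def a_def[symmetric] C_def distrib_left by linarith
  then show ?thesis using m by blast
qed

section \<open>Measurability\<close>

text \<open>Outside [0, 1] no index qualifies and the description operator returns one fixed value;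
  measurability on the whole line thus rests on uniqueness alone.\<close>

lemma bin_index_measurable:
  assumes "1 \<le> J" shows "bin_index J \<in> measurable borel (count_space UNIV)"
proof -
  have [measurable]: "bin J j \<in> sets borel" for j by (simp add: bin_def)
  have "(\<lambda>p. THE j. j \<in> {1..J} \<and> p \<in> bin J j) \<in> measurable borel (count_space UNIV)"
  proof (rule measurable_THE[where I = UNIV])
    fix p i j assume ij: "i \<in> {1..J} \<and> p \<in> bin J i" "j \<in> {1..J} \<and> p \<in> bin J j"
    have "0 \<le> p"
    proof -
      have "0 \<le> (real i - 1) / real J" using ij by auto
      also have "\<dots> \<le> p" using ij by (auto simp: bin_def split: if_splits)
      finally show ?thesis .
    qed
    moreover have "p \<le> 1"
    proof (cases "i < J")
      case True
      then have "p < real i / real J" using ij by (simp add: bin_def)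
      also have "\<dots> \<le> 1" using ij assms by (simp add: divide_le_eq_1)
      finally show ?thesis by simp
    qed (use ij in \<open>auto simp: bin_def\<close>)
    ultimately show "i = j" using ex1_bin[OF assms] ij by blast
  qed auto
  then show ?thesis by (simp add: bin_index_def[abs_def])
qed

context
  fixes N :: "'a measure" and X U :: "nat \<Rightarrow> 'a \<Rightarrow> real" and t :: nat
  assumes X: "\<And>i. 1 \<le> i \<Longrightarrow> i \<le> t \<Longrightarrow> X i \<in> borel_measurable N"
    and U: "\<And>i. 1 \<le> i \<Longrightarrow> i \<le> t \<Longrightarrow> U i \<in> borel_measurable N"
begin

text \<open>The sigma-algebra is left arbitrary because the same facts are used for \<open>M\<close>
  and for the history up to time n.\<close>

lemma pval_measurable:
  assumes "1 \<le> s" "s \<le> t" shows "pval X U s \<in> borel_measurable N"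
proof -
  have [measurable]: "X s \<in> borel_measurable N" "U s \<in> borel_measurable N" using X U assms by auto
  have "(\<lambda>\<omega>. \<Sum>r = 1..<s. of_bool (X r \<omega> > X s \<omega>) :: real) \<in> borel_measurable N"
  proof (intro borel_measurable_sum)
    fix r assume "r \<in> {1..<s}"
    then have [measurable]: "X r \<in> borel_measurable N" using X assms by auto
    show "(\<lambda>\<omega>. of_bool (X r \<omega> > X s \<omega>) :: real) \<in> borel_measurable N" by measurable
  qed
  note this[measurable]
  show ?thesis unfolding pval_def[abs_def] by measurable
qed

lemma bin_count_measurable:
  assumes "s \<le> t" shows "(\<lambda>\<omega>. bin_count J X U s j \<omega>) \<in> measurable N (count_space UNIV)"
  using assms
proof (induction s)
  case 0
  show ?case by (simp add: bin_count_def)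
next
  case (Suc s)
  have [measurable]: "bin J j \<in> sets borel" by (simp add: bin_def)
  have [measurable]: "pval X U (Suc s) \<in> borel_measurable N" using Suc.prems by (intro pval_measurable) auto
  have [measurable]: "(\<lambda>\<omega>. bin_count J X U s j \<omega>) \<in> measurable N (count_space UNIV)" using Suc by simp
  show ?case unfolding bin_count_Suc by measurable
qed

lemma real_bin_count_measurable:
  assumes "s \<le> t" shows "(\<lambda>\<omega>. real (bin_count J X U s j \<omega>)) \<in> borel_measurable N"
  by (rule measurable_compose[OF bin_count_measurable[OF assms]]) simp

lemma KT_measurable:
  assumes "1 \<le> J" "s \<le> t" shows "KT J X U s \<in> borel_measurable N"
  unfolding KT_def[abs_def]
proof (intro borel_measurable_prod)
  fix i assume i: "i \<in> {1..s}"
  have "(\<lambda>\<omega>. bin_index J (pval X U i \<omega>)) \<in> measurable N (count_space UNIV)"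
    using i assms by (intro measurable_compose[OF pval_measurable bin_index_measurable]) auto
  \<comment> \<open>The bin index is itself random; as it takes countably many values, measurability
    for each fixed bin suffices.\<close>
  then have [measurable]: "(\<lambda>\<omega>. real (bin_count J X U (i - 1) (bin_index J (pval X U i \<omega>)) \<omega>)) \<in> borel_measurable N"
    by (rule measurable_compose_countable[OF real_bin_count_measurable, rotated]) (use i assms in auto)
  show "(\<lambda>\<omega>. real J * ((real (bin_count J X U (i - 1) (bin_index J (pval X U i \<omega>)) \<omega>) + 1 / 2)
       / (real (i - 1) + real J / 2))) \<in> borel_measurable N" by measurable
qed

lemma log_KT_measurable:
  assumes "1 \<le> J" "s \<le> t" shows "log_KT J X U s \<in> borel_measurable N"
proof -
  note KT_measurable[OF assms, measurable]
  show ?thesis unfolding log_KT_def[abs_def] by measurable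
qed

lemma V_dev_measurable:
  assumes "d \<le> t" shows "V_dev J X U d \<in> borel_measurable N"
proof -
  note real_bin_count_measurable[OF assms, measurable]
  show ?thesis unfolding V_dev_def[abs_def] TV_vec_def by measurable
qed

end

context change_point_model
begin

text \<open>By right continuity, the supremum may be taken over the rationals.\<close>

lemma b_dev_measurable:
  assumes d: "1 \<le> d" shows "b_dev F1 X d \<in> borel_measurable M"
proof (rule borel_measurable_iff_le[THEN iffD2], intro allI)
  fix c
  define f where "f \<omega> x = \<bar>1 / real d * (\<Sum>l = 1..d. of_bool (X l \<omega> \<le> x)) - cdf F1 x\<bar>" for \<omega> x
  have bdd: "f \<omega> x \<le> b_dev F1 X d \<omega>" for \<omega> x
    unfolding f_def by (rule emp_dev_le_b_dev[OF d])
  have "b_dev F1 X d \<omega> \<le> c \<longleftrightarrow> (\<forall>q\<in>\<rat>. f \<omega> q \<le> c)" for \<omega>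
  proof
    assume "b_dev F1 X d \<omega> \<le> c"
    then show "\<forall>q\<in>\<rat>. f \<omega> q \<le> c" using bdd by (blast intro: order_trans)
  next
    assume q: "\<forall>q\<in>\<rat>. f \<omega> q \<le> c"
    have "f \<omega> x \<le> c" for x
    proof (rule ccontr)
      assume "\<not> f \<omega> x \<le> c"
      have ob: "((\<lambda>y. of_bool (X l \<omega> \<le> y)) \<longlongrightarrow> (of_bool (X l \<omega> \<le> x) :: real)) (at_right x)" for l
      proof (rule tendsto_eventually, cases "X l \<omega> \<le> x")
        case True
        then show "\<forall>\<^sub>F y in at_right x. of_bool (X l \<omega> \<le> y) = (of_bool (X l \<omega> \<le> x) :: real)"
          by (auto simp: eventually_at_filter)
      next
        case False
        then have "\<forall>\<^sub>F y in at_right x. y \<in> {x<..<X l \<omega>}" by (intro eventually_at_right_real) simp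
        then show "\<forall>\<^sub>F y in at_right x. of_bool (X l \<omega> \<le> y) = (of_bool (X l \<omega> \<le> x) :: real)"
          by (rule eventually_mono) (use False in auto)
      qed
      have "(cdf F1 \<longlongrightarrow> cdf F1 x) (at_right x)"
        using F1.cdf_is_right_cont[of x] by (simp add: continuous_within)
      then have "(f \<omega> \<longlongrightarrow> f \<omega> x) (at_right x)"
        unfolding f_def by (intro tendsto_intros ob)
      then have "\<forall>\<^sub>F y in at_right x. c < f \<omega> y"
        using \<open>\<not> f \<omega> x \<le> c\<close> by (intro order_tendstoD(1)) auto
      then obtain z where z: "x < z" "\<And>y. x < y \<Longrightarrow> y < z \<Longrightarrow> c < f \<omega> y"
        by (auto simp: eventually_at_right_field)
      obtain q where "q \<in> \<rat>" "x < q" "q < z" using Rats_dense_in_real[OF z(1)] by blast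
      with z(2)[of q] q show False by fastforce
    qed
    then show "b_dev F1 X d \<omega> \<le> c" unfolding b_dev_def f_def by (intro cSUP_least) auto
  qed
  then have "{\<omega> \<in> space M. b_dev F1 X d \<omega> \<le> c} = {\<omega> \<in> space M. \<forall>q\<in>\<rat>. f \<omega> q \<le> c}" by simp
  also have "\<dots> \<in> sets M"
  proof (rule sets.sets_Collect_countable_All'[OF _ countable_rat])
    fix q :: real
    have "(\<lambda>\<omega>. \<Sum>l = 1..d. of_bool (X l \<omega> \<le> q) :: real) \<in> borel_measurable M"
    proof (intro borel_measurable_sum)
      fix l assume "l \<in> {1..d}"
      then have [measurable]: "X l \<in> borel_measurable M" by (intro X_measurable) auto
      show "(\<lambda>\<omega>. of_bool (X l \<omega> \<le> q) :: real) \<in> borel_measurable M" by measurable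
    qed
    note this[measurable]
    show "{\<omega> \<in> space M. f \<omega> q \<le> c} \<in> sets M" unfolding f_def by measurable
  qed
  finally show "{\<omega> \<in> space M. b_dev F1 X d \<omega> \<le> c} \<in> sets M" .
qed

lemma log_KT_measurable_M: "1 \<le> J \<Longrightarrow> log_KT J X U t \<in> borel_measurable M"
  by (rule log_KT_measurable[OF X_measurable U_measurable _ order_refl])

lemma U_path_measurable:
  assumes J: "1 \<le> J" and eta: "0 < eta" "eta < 1" and d: "1 \<le> d" and m: "1 \<le> m"
  shows "U_path tau J F1 X U eta0 eta d m \<in> borel_measurable M"
proof -
  note b_dev_measurable[OF d, measurable]
  have [measurable]: "V_dev J X U d \<in> borel_measurable M"
    by (rule V_dev_measurable[OF X_measurable U_measurable order_refl])
  let ?a = "\<lambda>\<omega>. a_bound J eta d m (b_dev F1 X d \<omega>)"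
  have a[measurable]: "?a \<in> borel_measurable M" unfolding a_bound_eq by measurable
  have a0: "0 \<le> ?a \<omega>" for \<omega>
    using a_bound_ge_radius[OF eta b_dev_nonneg[OF d], of J m d \<omega>] azuma_radius(1)[OF eta J m] by linarith
  \<comment> \<open>\<open>Phi\<close> is Borel by monotonicity, which is available on nonnegative
    arguments only; truncation at 0 extends it and changes nothing at the radii that occur.\<close>
  have "mono (\<lambda>x. Phi J (max 0 x))" by (intro monoI Phi_mono[OF J]) auto
  from measurable_compose[OF a borel_measurable_mono[OF this]]
  have "(\<lambda>\<omega>. Phi J (max 0 (?a \<omega>))) \<in> borel_measurable M" .
  then have [measurable]: "(\<lambda>\<omega>. Phi J (?a \<omega>)) \<in> borel_measurable M" using a0 by (simp add: max_absorb2)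
  show ?thesis unfolding U_path_def[abs_def] U_bound_def by measurable
qed

lemma A_event_sets:
  assumes "tau \<le> n" "1 \<le> J" shows "A_event M tau J X U eta0 \<in> sets (hist M X U n)"
proof -
  have [measurable]: "(\<lambda>\<omega>. real (bin_count J X U tau j \<omega>)) \<in> borel_measurable (hist M X U n)" for j
    by (rule real_bin_count_measurable[OF X_measurable_hist U_measurable_hist assms(1)])
  have "A_event M tau J X U eta0
     = {\<omega> \<in> space (hist M X U n). \<forall>j\<in>{1..J}. c_const tau J eta0 \<le> real (bin_count J X U tau j \<omega>) / real tau}"
    using assms(2) by (auto simp: A_event_def)
  also have "\<dots> \<in> sets (hist M X U n)" by measurable
  finally show ?thesis .
qed

end

section \<open>Crossing times as random variables\<close>

lemma crossing_time_eq_enat: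
  "crossing_time tau W B \<omega> = enat n \<longleftrightarrow>
     tau + 1 \<le> n \<and> W n \<omega> > B n \<and> (\<forall>t\<in>{tau + 1..<n}. \<not> W t \<omega> > B t)"
proof -
  let ?S = "{enat t | t. tau + 1 \<le> t \<and> W t \<omega> > B t}"
  show ?thesis
  proof
    assume *: "crossing_time tau W B \<omega> = enat n"
    have "?S \<noteq> {}"
    proof
      assume "?S = {}"
      then have "crossing_time tau W B \<omega> = Inf {}" unfolding crossing_time_def by (simp only:)
      with * show False by (simp add: top_enat_def)
    qed
    \<comment> \<open>A nonempty set of extended naturals attains its infimum.\<close>
    then have "Inf ?S \<in> ?S" by (auto simp: Inf_enat_def intro: LeastI)
    with * have "enat n \<in> ?S" by (simp add: crossing_time_def)
    moreover have "\<not> W t \<omega> > B t" if "t \<in> {tau + 1..<n}" for t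
    proof
      assume "W t \<omega> > B t"
      with that have "Inf ?S \<le> enat t" by (intro Inf_lower) auto
      with * that show False by (simp add: crossing_time_def)
    qed
    ultimately show "tau + 1 \<le> n \<and> W n \<omega> > B n \<and> (\<forall>t\<in>{tau + 1..<n}. \<not> W t \<omega> > B t)" by auto
  next
    assume *: "tau + 1 \<le> n \<and> W n \<omega> > B n \<and> (\<forall>t\<in>{tau + 1..<n}. \<not> W t \<omega> > B t)"
    show "crossing_time tau W B \<omega> = enat n"
      unfolding crossing_time_def
    proof (rule antisym)
      show "Inf ?S \<le> enat n" using * by (intro Inf_lower) auto
      show "enat n \<le> Inf ?S" using * by (intro Inf_greatest) (auto simp: not_less[symmetric])
    qed
  qed
qed

lemma less_crossing_time:
  "enat n < crossing_time tau W B \<omega> \<longleftrightarrow> (\<forall>t\<in>{tau + 1..n}. \<not> W t \<omega> > B t)"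
proof -
  let ?S = "{enat t | t. tau + 1 \<le> t \<and> W t \<omega> > B t}"
  have "enat (Suc n) \<le> Inf ?S \<longleftrightarrow> (\<forall>t. tau + 1 \<le> t \<and> W t \<omega> > B t \<longrightarrow> Suc n \<le> t)"
    unfolding le_Inf_iff by auto
  also have "\<dots> \<longleftrightarrow> (\<forall>t\<in>{tau + 1..n}. \<not> W t \<omega> > B t)"
    by (metis atLeastAtMost_iff not_less_eq_eq)
  finally have "enat (Suc n) \<le> Inf ?S \<longleftrightarrow> (\<forall>t\<in>{tau + 1..n}. \<not> W t \<omega> > B t)" .
  then show ?thesis by (simp add: crossing_time_def Suc_ile_eq)
qed

lemma crossing_time_measurable:
  assumes "\<And>t. W t \<in> borel_measurable M"
  shows "crossing_time tau W B \<in> measurable M (count_space UNIV)"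
proof (rule measurable_count_space_eq_countable[THEN iffD2, OF countableI_type], intro conjI ballI)
  fix a :: enat
  note assms[measurable]
  have fin: "{\<omega> \<in> space M. crossing_time tau W B \<omega> = enat n} \<in> sets M" for n
    unfolding crossing_time_eq_enat by measurable
  have "{\<omega> \<in> space M. crossing_time tau W B \<omega> = a} \<in> sets M"
  proof (cases a)
    case (enat n)
    then show ?thesis using fin by simp
  next
    case infinity
    have "{\<omega> \<in> space M. crossing_time tau W B \<omega> = \<infinity>}
       = space M - (\<Union>n. {\<omega> \<in> space M. crossing_time tau W B \<omega> = enat n})"
      by auto
    then show ?thesis using fin infinity by auto
  qed
  moreover have "crossing_time tau W B -` {a} \<inter> space M = {\<omega> \<in> space M. crossing_time tau W B \<omega> = a}" by auto
  ultimately show "crossing_time tau W B -` {a} \<inter> space M \<in> sets M" by simp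
qed auto

text \<open>A supremum strictly below something is finite, hence bounded by some natural number k.
  The resulting countable quantifiers make the delay event measurable.\<close>

lemma Sup_enat_less_iff:
  "Sup {enat r | r. P r} < x \<longleftrightarrow> (\<exists>k. enat k < x \<and> (\<forall>r>k. \<not> P r))"
proof
  assume *: "Sup {enat r | r. P r} < x"
  then obtain k where k: "Sup {enat r | r. P r} = enat k" by (cases "Sup {enat r | r. P r}") auto
  have "\<not> P r" if "k < r" for r
  proof
    assume "P r"
    then have "enat r \<le> Sup {enat r | r. P r}" by (intro Sup_upper) auto
    then show False using k that by simp
  qed
  then show "\<exists>k. enat k < x \<and> (\<forall>r>k. \<not> P r)" using * k by auto
next
  assume "\<exists>k. enat k < x \<and> (\<forall>r>k. \<not> P r)"
  then obtain k where k: "enat k < x" "\<And>r. P r \<Longrightarrow> r \<le> k" by (auto simp: not_less[symmetric])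
  then have "Sup {enat r | r. P r} \<le> enat k" by (intro Sup_least) auto
  then show "Sup {enat r | r. P r} < x" using k(1) by simp
qed

section \<open>Conditional guarantees\<close>

text \<open>On the subset \<open>B\<close> of \<open>G\<close> where the claim fails, the
  conditional expectation integrates to \<open>prob (B \<inter> E)\<close>, which is at least (1 -
  \<eta>) \<open>prob B\<close>. The nonnegative gap (1 - \<eta>) minus the conditional expectation
  thus integrates to 0 over \<open>B\<close>; as it is strictly positive there, \<open>B\<close> is
  null.\<close>

lemma (in prob_space) real_cond_exp_indicator_ge:
  assumes sub: "subalgebra M N" and G: "G \<in> sets N" and E: "E \<in> events"
    and le: "\<And>B. B \<in> sets N \<Longrightarrow> B \<subseteq> G \<Longrightarrow> prob (B - E) \<le> \<eta> * prob B"
  shows "AE \<omega> in M. \<omega> \<in> G \<longrightarrow> 1 - \<eta> \<le> real_cond_exp M N (indicator E) \<omega>"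
proof -
  interpret finite_measure_subalgebra M N by unfold_locales (rule sub)
  let ?c = "real_cond_exp M N (indicator E)"
  have space: "space N = space M" using sub by (simp add: subalgebra_def)
  define B where "B = {\<omega> \<in> space N. \<omega> \<in> G \<and> ?c \<omega> < 1 - \<eta>}"
  have BN: "B \<in> sets N" unfolding B_def using G by measurable
  have BM: "B \<in> events" using BN sub by (auto simp: subalgebra_def)
  have iE: "integrable M (indicator E :: 'a \<Rightarrow> real)" using E by (simp add: integrable_indicator_iff emeasure_eq_measure)
  have ic: "integrable M ?c" by (rule real_cond_exp_int(1)[OF iE])
  have icB: "integrable M (\<lambda>\<omega>. indicator B \<omega> * ?c \<omega>)"
    using integrable_real_mult_indicator[OF BM ic] by (simp add: mult.commute)
  let ?f = "\<lambda>\<omega>. (1 - \<eta>) * indicator B \<omega> - indicator B \<omega> * ?c \<omega>"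
  have iB: "integrable M (\<lambda>\<omega>. (1 - \<eta>) * indicator B \<omega> :: real)"
    using BM by (simp add: integrable_indicator_iff emeasure_eq_measure)
  have i: "integrable M ?f" using iB icB by (rule Bochner_Integration.integrable_diff)
  have nn: "0 \<le> ?f \<omega>" for \<omega> by (auto simp: B_def indicator_def)
  have "(\<integral>\<omega>. indicator B \<omega> * ?c \<omega> \<partial>M) = (\<integral>\<omega>. indicator B \<omega> * indicator E \<omega> \<partial>M)"
    using real_cond_exp_intA[OF iE BN] by (simp add: set_lebesgue_integral_def)
  also have "\<dots> = prob (B \<inter> E)"
    using BM E by (simp add: indicator_inter_arith[symmetric])
  finally have "(\<integral>\<omega>. ?f \<omega> \<partial>M) = (1 - \<eta>) * prob B - prob (B \<inter> E)"
    using BM by (simp add: Bochner_Integration.integral_diff[OF iB icB])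
  moreover have "prob (B - E) \<le> \<eta> * prob B" using BN by (intro le) (auto simp: B_def)
  moreover have "prob B = prob (B \<inter> E) + prob (B - E)"
    using BM E by (subst finite_measure_Union[symmetric]) (auto intro!: arg_cong[where f=prob])
  ultimately have "(\<integral>\<omega>. ?f \<omega> \<partial>M) \<le> 0" by (simp add: algebra_simps)
  moreover have "0 \<le> (\<integral>\<omega>. ?f \<omega> \<partial>M)" using nn by (intro integral_nonneg_AE) auto
  ultimately have "AE \<omega> in M. ?f \<omega> = 0"
    using integral_nonneg_eq_0_iff_AE[OF i] nn by auto
  then show ?thesis
    by (rule AE_mp) (auto intro!: AE_I2 simp: B_def space indicator_def)
qed

text \<open>Both events depend only on the process up to time n. Applied to the history, this makes
  the event on which the theorem conditions available at time n.\<close>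

lemma crossing_time_adapted:
  assumes W: "\<And>t. t \<le> n \<Longrightarrow> W t \<in> borel_measurable N"
  shows "{\<omega> \<in> space N. crossing_time tau W B \<omega> = enat n} \<in> sets N"
    and "{\<omega> \<in> space N. enat n < crossing_time tau W B \<omega>} \<in> sets N"
proof -
  have P: "{\<omega> \<in> space N. W t \<omega> > B t} \<in> sets N" if "t \<le> n" for t
    by (rule borel_measurable_less[OF borel_measurable_const W[OF that]])
  then have Q: "{\<omega> \<in> space N. \<not> W t \<omega> > B t} \<in> sets N" if "t \<le> n" for t
    using that by (intro sets.sets_Collect_neg)
  show "{\<omega> \<in> space N. crossing_time tau W B \<omega> = enat n} \<in> sets N"
    unfolding crossing_time_eq_enat
    by (intro sets.sets_Collect_conj sets.sets_Collect_const P sets.sets_Collect_countable_All' Q) auto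
  show "{\<omega> \<in> space N. enat n < crossing_time tau W B \<omega>} \<in> sets N"
    unfolding less_crossing_time
    by (intro sets.sets_Collect_countable_All' Q) auto
qed

context change_point_model
begin

lemma AE_U_bounds: "AE \<omega> in M. \<forall>i\<ge>1. 0 \<le> U i \<omega> \<and> U i \<omega> \<le> 1"
proof -
  have "AE \<omega> in M. 1 \<le> i \<longrightarrow> 0 \<le> U i \<omega> \<and> U i \<omega> \<le> 1" for i
  proof (cases "1 \<le> i")
    case True
    have m: "U i \<in> borel_measurable M" by (rule U_measurable[OF True])
    have "prob (U i -` {0..1} \<inter> space M) = measure (distr M borel (U i)) {0..1}"
      by (rule measure_distr[OF m, symmetric]) simp
    also have "\<dots> = 1" unfolding uniform_law[OF True] by (simp add: measure_def)
    finally have "AE \<omega> in M. \<omega> \<in> U i -` {0..1} \<inter> space M"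
      using m by (subst AE_in_set_eq_1) (auto intro: measurable_sets)
    then show ?thesis by eventually_elim auto
  qed simp
  then show ?thesis by (simp add: AE_all_countable)
qed

lemma pval_bounds:
  assumes "\<forall>i\<ge>1. 0 \<le> U i \<omega> \<and> U i \<omega> \<le> 1" "1 \<le> i"
  shows "0 \<le> pval X U i \<omega> \<and> pval X U i \<omega> \<le> 1"
proof -
  let ?S = "(\<Sum>r = 1..<i. of_bool (X r \<omega> > X i \<omega>)) :: real"
  have "0 \<le> ?S" by (simp add: sum_nonneg)
  moreover have "?S \<le> (\<Sum>r = 1..<i. 1)" by (intro sum_mono) auto
  then have "?S \<le> real i - 1" using assms(2) by (simp add: of_nat_diff)
  moreover have "0 \<le> U i \<omega>" "U i \<omega> \<le> 1" using assms by auto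
  ultimately have "0 \<le> ?S + U i \<omega>" "?S + U i \<omega> \<le> real i" by linarith+
  then show ?thesis unfolding pval_def using assms(2) by (simp add: divide_le_eq_1 del: sum_of_bool_eq)
qed

lemma log_KT_increment_le_U_path:
  assumes J: "2 \<le> J" and eta: "0 < eta" "eta < 1" and c: "0 < c_const tau J eta0" and n: "tau + 1 \<le> n"
    and u: "\<forall>i\<ge>1. 0 \<le> U i \<omega> \<and> U i \<omega> \<le> 1" and A: "\<omega> \<in> A_event M tau J X U eta0"
    and good: "\<omega> \<notin> bad eta J n" and m: "1 \<le> m"
  shows "log_KT J X U (n + m) \<omega> - log_KT J X U n \<omega> \<le> U_path tau J F1 X U eta0 eta n m \<omega>"
  unfolding U_path_def
proof (rule log_KT_le_U_bound[OF J tau_ge_1 _ m pval_bounds[OF u] c])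
  have \<omega>: "\<omega> \<in> space M" using A by (simp add: A_event_def)
  show "c_const tau J eta0 \<le> real (bin_count J X U tau j \<omega>) / real tau" if "j \<in> {1..J}" for j
    using A that J by (auto simp: A_event_def)
  show "\<bar>real (bin_count J X U (n + m) j \<omega> - bin_count J X U n j \<omega>) / real m - 1 / real J\<bar>
       \<le> a_bound J eta n m (b_dev F1 X n \<omega>)" if "j \<in> {1..J}" for j
    using u n by (intro bin_frequency_bound J that eta \<omega> good m) auto
qed (use n in auto)

text \<open>The bound reaches the gap at some m0, so the admissible r have a largest element k. For
  each m \<le> k the increment stays below the distance to ln (1 / alpha), hence no crossing occurs
  up to time n + k and the delay exceeds k.\<close>

lemma r_delay_less:
  assumes J: "2 \<le> J" and alpha: "0 < alpha" and eta: "0 < eta" "eta < 1" and n: "tau + 1 \<le> n"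
    and DV: "enat n < crossing_time tau (KT J X U) (\<lambda>_. 1 / alpha) \<omega>"
    and inc: "\<And>m. 1 \<le> m \<Longrightarrow>
      log_KT J X U (n + m) \<omega> - log_KT J X U n \<omega> \<le> U_path tau J F1 X U eta0 eta n m \<omega>"
  shows "r_delay tau J F1 X U alpha eta0 eta n \<omega>
    < crossing_time tau (KT J X U) (\<lambda>_. 1 / alpha) \<omega> - enat n"
proof -
  let ?DV = "crossing_time tau (KT J X U) (\<lambda>_. 1 / alpha) \<omega>"
  let ?u = "\<lambda>m. U_path tau J F1 X U eta0 eta n m \<omega>"
  let ?g = "gap J X U alpha n \<omega>"
  define P where "P r \<longleftrightarrow> (SUP m\<in>{1..r}. ereal (?u m)) < ereal ?g" for r
  have P: "?u m < ?g" if "P r" "m \<in> {1..r}" for m r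
  proof -
    have "ereal (?u m) \<le> (SUP m\<in>{1..r}. ereal (?u m))" using that(2) by (rule SUP_upper)
    also have "\<dots> < ereal ?g" using that(1) by (simp add: P_def)
    finally show ?thesis by simp
  qed
  have n1: "1 \<le> n" using n by simp
  obtain m0 where m0: "1 \<le> m0" "?g \<le> ?u m0"
    using U_bound_unbounded[OF J eta n1 b_dev_nonneg[OF n1], of ?g tau eta0 \<omega> "V_dev J X U n \<omega>"]
    by (auto simp: U_path_def)
  have "r \<le> m0" if "P r" for r using P[OF that, of m0] m0 by (cases "m0 \<le> r") auto
  \<comment> \<open>The supremum over the empty range is minus infinity, so r = 0 always
    qualifies.\<close>
  moreover have "P 0" by (simp add: P_def bot_ereal_def)
  ultimately have ex: "\<exists>k. P k \<and> (\<forall>r. P r \<longrightarrow> r \<le> k)"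
    using Nat.ex_has_greatest_nat[of P 0 m0] by blast
  then obtain k where k: "P k" "\<And>r. P r \<Longrightarrow> r \<le> k" by blast
  have "enat (n + k) < ?DV"
    unfolding less_crossing_time
  proof
    fix t assume t: "t \<in> {tau + 1..n + k}"
    show "\<not> 1 / alpha < KT J X U t \<omega>"
    proof (cases "t \<le> n")
      case True
      then show ?thesis using DV t unfolding less_crossing_time by auto
    next
      case False
      define m where "m = t - n"
      have m: "t = n + m" "m \<in> {1..k}" using False t by (auto simp: m_def)
      have "log_KT J X U t \<omega> - log_KT J X U n \<omega> < ?g"
        using inc[of m] P[OF k(1) m(2)] m by auto
      then have "ln (KT J X U t \<omega>) < ln (1 / alpha)" by (simp add: gap_def log_KT_def)
      then show ?thesis using KT_pos[of J X U t \<omega>] J alpha by (subst (asm) ln_less_cancel_iff) auto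
    qed
  qed
  then have "enat k < ?DV - enat n" by (cases ?DV) auto
  then show ?thesis
    unfolding r_delay_def P_def[symmetric] Sup_enat_less_iff using k(2) by (auto simp: not_less[symmetric])
qed

lemma increment_event:
  assumes J: "2 \<le> J" and eta: "0 < eta" "eta < 1" and n: "1 \<le> n"
  shows "{\<omega> \<in> space M. \<forall>m\<ge>1. log_KT J X U (n + m) \<omega> - log_KT J X U n \<omega>
     \<le> U_path tau J F1 X U eta0 eta n m \<omega>} \<in> events"
proof -
  have J1: "1 \<le> J" using J by simp
  note [measurable] = log_KT_measurable_M[OF J1] U_path_measurable[OF J1 eta n]
  have "{\<omega> \<in> space M. 1 \<le> m \<longrightarrow> log_KT J X U (n + m) \<omega> - log_KT J X U n \<omega>
     \<le> U_path tau J F1 X U eta0 eta n m \<omega>} \<in> events" for m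
    by (cases "1 \<le> m") auto
  then show ?thesis by (rule sets.sets_Collect_countable_All)
qed

lemma delay_event:
  fixes alpha :: real and BC :: "nat \<Rightarrow> real"
  assumes J: "2 \<le> J" and eta: "0 < eta" "eta < 1" and n: "1 \<le> n"
  defines "DV \<equiv> crossing_time tau (KT J X U) (\<lambda>_. 1 / alpha)"
    and "DC \<equiv> crossing_time tau (KT J X U) BC"
  shows "{\<omega> \<in> space M. DV \<omega> - DC \<omega> > r_delay tau J F1 X U alpha eta0 eta n \<omega>} \<in> events"
proof -
  have J1: "1 \<le> J" using J by simp
  have KT: "KT J X U t \<in> borel_measurable M" for t
    by (rule KT_measurable[OF X_measurable U_measurable J1 order_refl])
  have [measurable]: "DV \<in> measurable M (count_space UNIV)" "DC \<in> measurable M (count_space UNIV)"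
    unfolding DV_def DC_def by (rule crossing_time_measurable[OF KT])+
  note [measurable] = log_KT_measurable_M[OF J1]
  have S: "(\<lambda>\<omega>. SUP m\<in>{1..r}. ereal (U_path tau J F1 X U eta0 eta n m \<omega>)) \<in> borel_measurable M" for r
  proof (rule borel_measurable_SUP)
    fix m assume "m \<in> {1..r}"
    then have [measurable]: "U_path tau J F1 X U eta0 eta n m \<in> borel_measurable M"
      by (intro U_path_measurable[OF J1 eta n]) simp
    show "(\<lambda>\<omega>. ereal (U_path tau J F1 X U eta0 eta n m \<omega>)) \<in> borel_measurable M" by measurable
  qed simp
  note S[measurable]
  have [measurable]: "(\<lambda>\<omega>. ereal (gap J X U alpha n \<omega>)) \<in> borel_measurable M"
    unfolding gap_def by measurable
  show ?thesis unfolding r_delay_def Sup_enat_less_iff by measurable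
qed

end

theorem theorem4p9:
  fixes M :: "'a measure" and tau J :: nat and F0 F1 :: "real measure"
    and X U :: "nat \<Rightarrow> 'a \<Rightarrow> real" and BC :: "nat \<Rightarrow> real" and alpha eta eta0 :: real
    and DC DV :: "'a \<Rightarrow> enat"
  assumes model: "change_point_model M tau F0 F1 X U"
    and J: "2 \<le> J"
    and alpha: "0 < alpha" "alpha < 1"
    and eta: "0 < eta" "eta < 1"
    and eta0: "0 < eta0" "eta0 < 1"
    and c_pos: "0 < c_const tau J eta0"
    and BC_pos: "\<And>t. 1 \<le> t \<Longrightarrow> 0 < BC t"
    and DC_def: "DC = crossing_time tau (KT J X U) BC"
    and DV_def: "DV = crossing_time tau (KT J X U) (\<lambda>_. 1 / alpha)"
  shows "(\<forall>n \<ge> tau + 1. AE \<omega> in M.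
            \<omega> \<in> A_event M tau J X U eta0 \<longrightarrow> DC \<omega> = enat n \<longrightarrow> enat n < DV \<omega> \<longrightarrow>
            real_cond_exp M (hist M X U n)
              (indicator {\<omega>' \<in> space M. \<forall>m \<ge> 1.
                 log_KT J X U (n + m) \<omega>' - log_KT J X U n \<omega>'
                   \<le> U_path tau J F1 X U eta0 eta n m \<omega>'}) \<omega> \<ge> 1 - eta)
       \<and> (\<forall>n \<ge> tau + 1. AE \<omega> in M.
            \<omega> \<in> A_event M tau J X U eta0 \<longrightarrow> DC \<omega> = enat n \<longrightarrow> enat n < DV \<omega> \<longrightarrow>
            real_cond_exp M (hist M X U n)
              (indicator {\<omega>' \<in> space M.
                 DV \<omega>' - DC \<omega>' > r_delay tau J F1 X U alpha eta0 eta n \<omega>'}) \<omega> \<ge> 1 - eta)"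
proof -
  interpret change_point_model M tau F0 F1 X U by (rule model)
  have J1: "1 \<le> J" using J by simp
  let ?A = "A_event M tau J X U eta0"
  define E1 where "E1 n = {\<omega>' \<in> space M. \<forall>m \<ge> 1. log_KT J X U (n + m) \<omega>' - log_KT J X U n \<omega>'
                   \<le> U_path tau J F1 X U eta0 eta n m \<omega>'}" for n
  define E2 where "E2 n = {\<omega>' \<in> space M. DV \<omega>' - DC \<omega>' > r_delay tau J F1 X U alpha eta0 eta n \<omega>'}" for n
  define G where "G n = {\<omega> \<in> space (hist M X U n). \<omega> \<in> ?A \<and> DC \<omega> = enat n \<and> enat n < DV \<omega>}" for n
  have G_sets: "G n \<in> sets (hist M X U n)" if n: "tau + 1 \<le> n" for n
  proof -
    have A: "?A \<in> sets (hist M X U n)" using n J1 by (intro A_event_sets) auto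
    have K: "KT J X U t \<in> borel_measurable (hist M X U n)" if "t \<le> n" for t
      by (rule KT_measurable[OF X_measurable_hist U_measurable_hist J1 that])
    have "{\<omega> \<in> space (hist M X U n). DC \<omega> = enat n} \<in> sets (hist M X U n)"
      unfolding DC_def by (rule crossing_time_adapted(1)[OF K])
    moreover have "{\<omega> \<in> space (hist M X U n). enat n < DV \<omega>} \<in> sets (hist M X U n)"
      unfolding DV_def by (rule crossing_time_adapted(2)[OF K])
    moreover have "G n = ?A \<inter> {\<omega> \<in> space (hist M X U n). DC \<omega> = enat n} \<inter> {\<omega> \<in> space (hist M X U n). enat n < DV \<omega>}"
      by (auto simp: G_def A_event_def)
    ultimately show ?thesis using A by auto
  qed
  \<comment> \<open>Up to a null set, \<open>G n\<close> without \<open>bad\<close> is contained in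
    both target events, so one estimate serves both claims.\<close>
  have main: "prob (B - E) \<le> eta * prob B"
    if n: "tau + 1 \<le> n" and B: "B \<in> sets (hist M X U n)" "B \<subseteq> G n" and E: "E = E1 n \<or> E = E2 n" for n B E
  proof -
    have Bp: "B \<in> sets (past n)" using B sets_hist_le_past by auto
    have "AE \<omega> in M. \<omega> \<in> B - E \<longrightarrow> \<omega> \<in> B \<inter> bad eta J n"
      using AE_U_bounds
    proof (rule AE_mp, intro AE_I2 impI)
      fix \<omega> assume u: "\<forall>i\<ge>1. 0 \<le> U i \<omega> \<and> U i \<omega> \<le> 1" and \<omega>: "\<omega> \<in> B - E"
      have g: "\<omega> \<in> ?A" "DC \<omega> = enat n" "enat n < DV \<omega>" "\<omega> \<in> space M" using \<omega> B(2) by (auto simp: G_def)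
      show "\<omega> \<in> B \<inter> bad eta J n"
      proof (rule ccontr)
        assume "\<omega> \<notin> B \<inter> bad eta J n"
        then have good: "\<omega> \<notin> bad eta J n" using \<omega> by simp
        note inc = log_KT_increment_le_U_path[OF J eta c_pos n u g(1) good]
        have "\<omega> \<in> E1 n" using inc g(4) by (simp add: E1_def)
        \<comment> \<open>On \<open>G n\<close> the calibrated crossing time equals n, which turns
          the delay counted from n into the difference of the two crossing times.\<close>
        moreover have "\<omega> \<in> E2 n"
          using r_delay_less[OF J alpha(1) eta n g(3)[unfolded DV_def] inc] g(2,4)
          by (simp add: E2_def DV_def)
        ultimately show False using \<omega> E by auto
      qed
    qed
    then have "prob (B - E) \<le> prob (B \<inter> bad eta J n)"
      using n by (intro finite_measure_mono_AE bad_prob(1)[OF _ Bp eta J1]) auto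
    also have "\<dots> \<le> eta * prob B" using n by (intro bad_prob(2)[OF _ Bp eta J1]) auto
    finally show ?thesis .
  qed
  have ge: "AE \<omega> in M. \<omega> \<in> G n \<longrightarrow> 1 - eta \<le> real_cond_exp M (hist M X U n) (indicator E) \<omega>"
    if n: "tau + 1 \<le> n" and E: "E = E1 n \<or> E = E2 n" for n E
  proof (rule real_cond_exp_indicator_ge[OF subalgebra_hist G_sets[OF n]])
    have n1: "1 \<le> n" using n by simp
    show "E \<in> events"
      using E increment_event[OF J eta n1] delay_event[OF J eta n1]
      unfolding E1_def E2_def DV_def DC_def by blast
  qed (rule main[OF n _ _ E])
  have "AE \<omega> in M. \<omega> \<in> ?A \<longrightarrow> DC \<omega> = enat n \<longrightarrow> enat n < DV \<omega> \<longrightarrow>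
      1 - eta \<le> real_cond_exp M (hist M X U n) (indicator E) \<omega>"
    if n: "tau + 1 \<le> n" and E: "E = E1 n \<or> E = E2 n" for n E
    using ge[OF n E] by eventually_elim (auto simp: G_def A_event_def)
  then show ?thesis unfolding E1_def E2_def by blast
qed

end
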